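(* Let $(X(t))_{t\in[0,T]}$ be the solution of $$X(t)=X(0)+\int_0^t f(X(s))\,\mathrm{d}s+\sum_{k=1}^p Y_k\Bigl(\int_0^t\lambda_k(X(s))\,\mathrm{d}s\Bigr)\nu_k ,$$ and consider the Maruyama-type method with increment functions $\phi_1,\phi_3$ and step size $h=T/\overline n$, $\overline n\in\mathbb{N}$: $\widehat X_0=X(0)$, $\widehat\tau_k(0)=0$, and for $n=0,\dots,\overline n-1$, with $t_n=nh$, $$\widehat\tau_k(t_{n+1})=\widehat\tau_k(t_n)+h\,\phi_3(k,\widehat X_n,h),\qquad k=1,\dots,p,$$ $$\widehat X_{n+1}=\widehat X_n+h\,\phi_1(\widehat X_n,\widehat X_{n+1},h)+\sum_{k=1}^p\Bigl(Y_k\bigl(\widehat\tau_k(t_n)+h\,\phi_3(k,\widehat X_n,h)\bigr)-Y_k\bigl(\widehat\tau_k(t_n)\bigr)\Bigr)\nu_k .$$ Under the Lipschitz conditions $$|\phi_1(x_1,y_1,h)-\phi_1(x_2,y_2,h)|\le L_1|x_1-x_2|+L_2|y_1-y_2|,$$ $$|\phi_3(k,x_1,h)-\phi_3(k,x_2,h)|\le L_{3,k}\,|x_1-x_2|\qquad\forall\,k=1,\dots,p,$$ and, if the method is implicit, the step-size restriction $h<1/L_2$, the method possesses a unique solution almost surely and is convergent in the strong sense, if it is strongly consistent. In particular, if $X(0)=\widehat X_0$, then the strong global error satisfies $$\max_{n=1,\dots,\overline n}\mathbb{E}|X(t_n)-\widehat X_n|\le S\,h^{-1}\max_{n=1,\dots,\overline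 n}\bigl(\mathbb{E}|L_n|+\mathbb{E}|K_n|\bigr)$$ for a suitable constant $S>0$ independent of the initial condition.
   Context: Standing assumptions: $T>0$ is fixed; $Y_1,\dots,Y_p$ are independent unit rate Poisson processes on a complete probability space; $\nu_k\in\mathbb{R}^d$; $f:\mathbb{R}^d\to\mathbb{R}^d$ and $\lambda_k:\mathbb{R}^d\to\mathbb{R}_+$ are Lipschitz continuous, bounded and in general sufficiently smooth such that all occurring derivatives exist and are bounded, so that the equation has an almost surely unique càdlàg solution. The $\mathbb{R}^d$-valued function $\phi_1$ is an increment function of a (possibly implicit) one-step method for the drift, and the real-valued function $\phi_3$ is an increment function of a one-step quadrature scheme approximating the integrals of the $\lambda_k$. The Lipschitz conditions are required for all $x_1,x_2,y_1,y_2\in\mathbb{R}^d$ and all step sizes $h$ considered, with constants $L_1,L_2,L_{3,k}$. The method is called explicit if $\phi_1$ does not depend on its second argument (then $L_2=0$ and no step-size restriction is needed), and implicit otherwise. The strong local errors are, for $n=0,\dots,\overline n-1$, $$L_{n+1}=\int_{t_n}^{t_{n+1}}f(X(s))\,\mathrm{d}s-h\,\phi_1(X(t_n),X(t_{n+1}),h),$$ $$K_{n+1}=\sum_{k=1}^p\Bigl(\int_{t_n}^{t_{n+1}}\lambda_k(X(s))\,\mathrm{d}s-h\,\phi_3(k,X(t_n),h)\Bigr)\nu_k .$$ The method is strongly consistent if for some $q>0$ $$\max_{n=1,\dots,\overline n}\mathbb{E}|L_n|=\mathcal{O}(h^{1+q}),\qquad \max_{n=1,\dots,\overline n}\mathbb{E}|K_n|=\mathcal{O}(h^{1+q}).$$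 It is convergent in the strong sense if the strong global error $\max_{n=1,\dots,\overline n}\mathbb{E}|X(t_n)-\widehat X_n|$ vanishes as $h\to0$.
   Formalization: The claim fails if channel errors cancel in K_n; convergence and the bound are proved either for ν_k without cancellation (e.g. linearly independent) or, for all ν_k, with K_n measured channel by channel. φ_3 ≥ 0 is assumed, as Y_k lives on [0,∞); X(0) is independent of the Y_k. *)

theory Defs
  imports "HOL-Probability.Probability"
begin

text \<open>The driving processes are indexed by a finite type \<open>'k\<close>, so $p$ is its cardinality.\<close>

subsection \<open>The driving processes\<close>

definition poisson_process :: "'w measure \<Rightarrow> (real \<Rightarrow> 'w \<Rightarrow> nat) \<Rightarrow> bool" where
  "poisson_process M Y \<longleftrightarrow>
     (\<forall>t\<ge>0. Y t \<in> measurable M (count_space UNIV)) \<and>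
     (AE \<omega> in M. Y 0 \<omega> = 0 \<and> mono_on {0..} (\<lambda>t. Y t \<omega>) \<and>
        (\<forall>t\<ge>0. continuous (at_right t) (\<lambda>s. Y s \<omega>))) \<and>
     (\<forall>s t. 0 \<le> s \<longrightarrow> s < t \<longrightarrow>
        distr M (count_space UNIV) (\<lambda>\<omega>. Y t \<omega> - Y s \<omega>) = measure_pmf (poisson_pmf (t - s))) \<and>
     (\<forall>(t::nat \<Rightarrow> real) n. 0 \<le> t 0 \<longrightarrow> mono t \<longrightarrow>
        prob_space.indep_vars M (\<lambda>_. count_space UNIV)
          (\<lambda>i \<omega>. Y (t (Suc i)) \<omega> - Y (t i) \<omega>) {..<n})"

definition indep_poisson_processes :: "'w measure \<Rightarrow> ('k::finite \<Rightarrow> real \<Rightarrow> 'w \<Rightarrow> nat) \<Rightarrow> bool" where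
  "indep_poisson_processes M Y \<longleftrightarrow>
     (\<forall>k. poisson_process M (Y k)) \<and>
     prob_space.indep_vars M (\<lambda>k. PiM {0..} (\<lambda>_. count_space UNIV))
       (\<lambda>k \<omega>. \<lambda>t\<in>{0..}. Y k t \<omega>) UNIV"

text \<open>Independence of a random initial value from the whole family of driving processes;
  a deterministic initial value satisfies it trivially.\<close>

definition indep_of_processes ::
  "'w measure \<Rightarrow> ('k::finite \<Rightarrow> real \<Rightarrow> 'w \<Rightarrow> nat) \<Rightarrow> ('w \<Rightarrow> real ^ 'd) \<Rightarrow> bool" where
  "indep_of_processes M Y X0 \<longleftrightarrow>
     prob_space.indep_set M
       (sets (vimage_algebra (space M) X0 borel))
       (sets (vimage_algebra (space M) (\<lambda>\<omega>. \<lambda>(k, t)\<in>UNIV \<times> {0..}. Y k t \<omega>)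
          (PiM (UNIV \<times> {0..}) (\<lambda>_. count_space UNIV))))"

subsection \<open>The random time change equation\<close>

definition cadlag_on :: "real \<Rightarrow> (real \<Rightarrow> 'a::topological_space) \<Rightarrow> bool" where
  "cadlag_on T x \<longleftrightarrow>
     (\<forall>t\<in>{0..<T}. continuous (at_right t) x) \<and>
     (\<forall>t\<in>{0<..T}. \<exists>l. (x \<longlongrightarrow> l) (at_left t))"

definition rtc_solution ::
  "'w measure \<Rightarrow> real \<Rightarrow> ('k::finite \<Rightarrow> real \<Rightarrow> 'w \<Rightarrow> nat) \<Rightarrow> ('k \<Rightarrow> real ^ 'd) \<Rightarrow>
   (real ^ 'd \<Rightarrow> real ^ 'd) \<Rightarrow> ('k \<Rightarrow> real ^ 'd \<Rightarrow> real) \<Rightarrow> (real \<Rightarrow> 'w \<Rightarrow> real ^ 'd) \<Rightarrow> bool" where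
  "rtc_solution M T Y \<nu> f lam X \<longleftrightarrow>
     (\<forall>t\<in>{0..T}. X t \<in> borel_measurable M) \<and>
     indep_of_processes M Y (X 0) \<and>
     (AE \<omega> in M. cadlag_on T (\<lambda>t. X t \<omega>) \<and>
        (\<forall>t\<in>{0..T}. X t \<omega> = X 0 \<omega> + (LBINT s:{0..t}. f (X s \<omega>)) +
           (\<Sum>k\<in>UNIV. real (Y k (LBINT s:{0..t}. lam k (X s \<omega>)) \<omega>) *\<^sub>R \<nu> k)))"

subsection \<open>The Maruyama-type method\<close>

text \<open>The recursion along one sample path \<open>y\<close> of the driving processes, with \<open>N\<close> steps of size
  \<open>h\<close>. Only the entries up to \<open>N\<close> of the sequences are constrained.\<close>

definition maruyama_path ::
  "('k::finite \<Rightarrow> real \<Rightarrow> nat) \<Rightarrow> ('k \<Rightarrow> real ^ 'd) \<Rightarrow>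
   (real ^ 'd \<Rightarrow> real ^ 'd \<Rightarrow> real \<Rightarrow> real ^ 'd) \<Rightarrow> ('k \<Rightarrow> real ^ 'd \<Rightarrow> real \<Rightarrow> real) \<Rightarrow>
   real \<Rightarrow> nat \<Rightarrow> real ^ 'd \<Rightarrow> (nat \<Rightarrow> real ^ 'd) \<Rightarrow> ('k \<Rightarrow> nat \<Rightarrow> real) \<Rightarrow> bool" where
  "maruyama_path y \<nu> \<phi>1 \<phi>3 h N x0 x \<tau> \<longleftrightarrow>
     x 0 = x0 \<and> (\<forall>k. \<tau> k 0 = 0) \<and>
     (\<forall>n<N.
        (\<forall>k. \<tau> k (Suc n) = \<tau> k n + h * \<phi>3 k (x n) h) \<and>
        x (Suc n) = x n + h *\<^sub>R \<phi>1 (x n) (x (Suc n)) h +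
          (\<Sum>k\<in>UNIV. (real (y k (\<tau> k n + h * \<phi>3 k (x n) h)) - real (y k (\<tau> k n))) *\<^sub>R \<nu> k))"

definition maruyama_solution ::
  "'w measure \<Rightarrow> ('k::finite \<Rightarrow> real \<Rightarrow> 'w \<Rightarrow> nat) \<Rightarrow> ('k \<Rightarrow> real ^ 'd) \<Rightarrow>
   (real ^ 'd \<Rightarrow> real ^ 'd \<Rightarrow> real \<Rightarrow> real ^ 'd) \<Rightarrow> ('k \<Rightarrow> real ^ 'd \<Rightarrow> real \<Rightarrow> real) \<Rightarrow>
   real \<Rightarrow> nat \<Rightarrow> ('w \<Rightarrow> real ^ 'd) \<Rightarrow> (nat \<Rightarrow> 'w \<Rightarrow> real ^ 'd) \<Rightarrow> ('k \<Rightarrow> nat \<Rightarrow> 'w \<Rightarrow> real) \<Rightarrow> bool"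
  where
  "maruyama_solution M Y \<nu> \<phi>1 \<phi>3 h N X0 Xh \<tau>h \<longleftrightarrow>
     (\<forall>n\<le>N. Xh n \<in> borel_measurable M \<and> (\<forall>k. \<tau>h k n \<in> borel_measurable M)) \<and>
     (AE \<omega> in M. maruyama_path (\<lambda>k t. Y k t \<omega>) \<nu> \<phi>1 \<phi>3 h N (X0 \<omega>) (\<lambda>n. Xh n \<omega>) (\<lambda>k n. \<tau>h k n \<omega>))"

definition maruyama_unique_solution ::
  "'w measure \<Rightarrow> ('k::finite \<Rightarrow> real \<Rightarrow> 'w \<Rightarrow> nat) \<Rightarrow> ('k \<Rightarrow> real ^ 'd) \<Rightarrow>
   (real ^ 'd \<Rightarrow> real ^ 'd \<Rightarrow> real \<Rightarrow> real ^ 'd) \<Rightarrow> ('k \<Rightarrow> real ^ 'd \<Rightarrow> real \<Rightarrow> real) \<Rightarrow>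
   real \<Rightarrow> nat \<Rightarrow> ('w \<Rightarrow> real ^ 'd) \<Rightarrow> bool" where
  "maruyama_unique_solution M Y \<nu> \<phi>1 \<phi>3 h N X0 \<longleftrightarrow>
     (\<exists>Xh \<tau>h. maruyama_solution M Y \<nu> \<phi>1 \<phi>3 h N X0 Xh \<tau>h \<and>
        (AE \<omega> in M. \<forall>x \<tau>. maruyama_path (\<lambda>k t. Y k t \<omega>) \<nu> \<phi>1 \<phi>3 h N (X0 \<omega>) x \<tau> \<longrightarrow>
           (\<forall>n\<le>N. x n = Xh n \<omega> \<and> (\<forall>k. \<tau> k n = \<tau>h k n \<omega>))))"

definition explicit_method :: "real \<Rightarrow> ('a \<Rightarrow> 'a \<Rightarrow> real \<Rightarrow> 'a) \<Rightarrow> bool" where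
  "explicit_method T \<phi>1 \<longleftrightarrow> (\<forall>N::nat. N \<ge> 1 \<longrightarrow> (\<forall>x y z. \<phi>1 x y (T / N) = \<phi>1 x z (T / N)))"

text \<open>The numbers of steps \<open>N\<close> for which the step size \<open>h = T / N\<close> is considered. The restriction
  $h < 1/L_2$ is written as $h L_2 < 1$, which reads $1/0$ as infinity.\<close>

definition step_numbers :: "real \<Rightarrow> real \<Rightarrow> ('a \<Rightarrow> 'a \<Rightarrow> real \<Rightarrow> 'a) \<Rightarrow> nat set" where
  "step_numbers T L2 \<phi>1 = {N. N \<ge> 1 \<and> (\<not> explicit_method T \<phi>1 \<longrightarrow> T / N * L2 < 1)}"

subsection \<open>Errors, consistency and convergence\<close>

text \<open>Expectations of norms are taken in \<^typ>\<open>ennreal\<close>, so that an infinite expectation is not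
  silently replaced by 0.\<close>

definition Enorm :: "'w measure \<Rightarrow> ('w \<Rightarrow> 'a::real_normed_vector) \<Rightarrow> ennreal" where
  "Enorm M Z = (\<integral>\<^sup>+\<omega>. ennreal (norm (Z \<omega>)) \<partial>M)"

definition gridpt :: "real \<Rightarrow> nat \<Rightarrow> nat \<Rightarrow> real" where
  "gridpt T N n = real n * (T / N)"

text \<open>With \<open>h = T / N\<close>, the index \<open>n\<close> of \<open>drift_err\<close>, \<open>channel_err\<close> and \<open>jump_err\<close> stands for the
  step from $t_n$ to $t_{n+1}$, i.e. they are $L_{n+1}$, the \<open>k\<close>-th summand of $K_{n+1}$, and
  $K_{n+1}$.\<close>

definition drift_err ::
  "real \<Rightarrow> (real ^ 'd \<Rightarrow> real ^ 'd) \<Rightarrow> (real ^ 'd \<Rightarrow> real ^ 'd \<Rightarrow> real \<Rightarrow> real ^ 'd) \<Rightarrow>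
   (real \<Rightarrow> 'w \<Rightarrow> real ^ 'd) \<Rightarrow> nat \<Rightarrow> nat \<Rightarrow> 'w \<Rightarrow> real ^ 'd" where
  "drift_err T f \<phi>1 X N n \<omega> =
     (LBINT s:{gridpt T N n..gridpt T N (Suc n)}. f (X s \<omega>)) -
     (T / N) *\<^sub>R \<phi>1 (X (gridpt T N n) \<omega>) (X (gridpt T N (Suc n)) \<omega>) (T / N)"

definition channel_err ::
  "real \<Rightarrow> ('k \<Rightarrow> real ^ 'd) \<Rightarrow> ('k \<Rightarrow> real ^ 'd \<Rightarrow> real) \<Rightarrow> ('k \<Rightarrow> real ^ 'd \<Rightarrow> real \<Rightarrow> real) \<Rightarrow>
   (real \<Rightarrow> 'w \<Rightarrow> real ^ 'd) \<Rightarrow> nat \<Rightarrow> nat \<Rightarrow> 'k \<Rightarrow> 'w \<Rightarrow> real ^ 'd" where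
  "channel_err T \<nu> lam \<phi>3 X N n k \<omega> =
     ((LBINT s:{gridpt T N n..gridpt T N (Suc n)}. lam k (X s \<omega>)) -
      T / N * \<phi>3 k (X (gridpt T N n) \<omega>) (T / N)) *\<^sub>R \<nu> k"

definition jump_err ::
  "real \<Rightarrow> ('k::finite \<Rightarrow> real ^ 'd) \<Rightarrow> ('k \<Rightarrow> real ^ 'd \<Rightarrow> real) \<Rightarrow>
   ('k \<Rightarrow> real ^ 'd \<Rightarrow> real \<Rightarrow> real) \<Rightarrow> (real \<Rightarrow> 'w \<Rightarrow> real ^ 'd) \<Rightarrow> nat \<Rightarrow> nat \<Rightarrow> 'w \<Rightarrow> real ^ 'd" where
  "jump_err T \<nu> lam \<phi>3 X N n \<omega> = (\<Sum>k\<in>UNIV. channel_err T \<nu> lam \<phi>3 X N n k \<omega>)"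

text \<open>\<open>e N = O(h\<^sup>1\<^sup>+\<^sup>q)\<close> for $h = T/N \to 0$, for \<^typ>\<open>ennreal\<close>-valued \<open>e\<close>
  (\<^const>\<open>bigo\<close> requires a normed field).\<close>

definition bigo_step :: "real \<Rightarrow> real \<Rightarrow> (nat \<Rightarrow> ennreal) \<Rightarrow> bool" where
  "bigo_step T q e \<longleftrightarrow>
     (\<exists>C::real. \<forall>\<^sub>F N in sequentially. e N \<le> ennreal (C * (T / real N) powr (1 + q)))"

definition strongly_consistent ::
  "'w measure \<Rightarrow> real \<Rightarrow> ('k::finite \<Rightarrow> real ^ 'd) \<Rightarrow> (real ^ 'd \<Rightarrow> real ^ 'd) \<Rightarrow>
   ('k \<Rightarrow> real ^ 'd \<Rightarrow> real) \<Rightarrow> (real ^ 'd \<Rightarrow> real ^ 'd \<Rightarrow> real \<Rightarrow> real ^ 'd) \<Rightarrow>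
   ('k \<Rightarrow> real ^ 'd \<Rightarrow> real \<Rightarrow> real) \<Rightarrow> (real \<Rightarrow> 'w \<Rightarrow> real ^ 'd) \<Rightarrow> bool" where
  "strongly_consistent M T \<nu> f lam \<phi>1 \<phi>3 X \<longleftrightarrow>
     (\<exists>q>0.
        bigo_step T q (\<lambda>N. MAX n\<in>{..<N}. Enorm M (drift_err T f \<phi>1 X N n)) \<and>
        bigo_step T q (\<lambda>N. MAX n\<in>{..<N}. Enorm M (jump_err T \<nu> lam \<phi>3 X N n)))"

text \<open>The quadrature errors of different channels may cancel inside the sum \<^const>\<open>jump_err\<close>
  although the corresponding Poisson processes do not: for two channels with opposite vectors
  $\nu_2 = -\nu_1$, $\lambda_1 = \lambda_2 = 1$ and $\phi_3 = 2$ the sum vanishes, but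
  $Y_1(t) - Y_2(t)$ and $Y_1(2t) - Y_2(2t)$ differ. Two remedies are considered:
  measuring the quadrature errors channel by channel, or excluding cancellation by (a slight
  weakening of) linear independence of the vectors.\<close>

definition strongly_consistent_channelwise ::
  "'w measure \<Rightarrow> real \<Rightarrow> ('k::finite \<Rightarrow> real ^ 'd) \<Rightarrow> (real ^ 'd \<Rightarrow> real ^ 'd) \<Rightarrow>
   ('k \<Rightarrow> real ^ 'd \<Rightarrow> real) \<Rightarrow> (real ^ 'd \<Rightarrow> real ^ 'd \<Rightarrow> real \<Rightarrow> real ^ 'd) \<Rightarrow>
   ('k \<Rightarrow> real ^ 'd \<Rightarrow> real \<Rightarrow> real) \<Rightarrow> (real \<Rightarrow> 'w \<Rightarrow> real ^ 'd) \<Rightarrow> bool" where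
  "strongly_consistent_channelwise M T \<nu> f lam \<phi>1 \<phi>3 X \<longleftrightarrow>
     (\<exists>q>0.
        bigo_step T q (\<lambda>N. MAX n\<in>{..<N}. Enorm M (drift_err T f \<phi>1 X N n)) \<and>
        bigo_step T q (\<lambda>N. MAX n\<in>{..<N}. \<Sum>k\<in>UNIV. Enorm M (channel_err T \<nu> lam \<phi>3 X N n k)))"

definition no_cancellation :: "('k::finite \<Rightarrow> real ^ 'd) \<Rightarrow> bool" where
  "no_cancellation \<nu> \<longleftrightarrow>
     (\<forall>a. (\<Sum>k\<in>UNIV. a k *\<^sub>R \<nu> k) = 0 \<longrightarrow> (\<forall>k. a k *\<^sub>R \<nu> k = 0))"

definition strong_global_err ::
  "'w measure \<Rightarrow> real \<Rightarrow> (real \<Rightarrow> 'w \<Rightarrow> real ^ 'd) \<Rightarrow> nat \<Rightarrow> (nat \<Rightarrow> 'w \<Rightarrow> real ^ 'd) \<Rightarrow> ennreal" where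
  "strong_global_err M T X N Xh =
     (MAX n\<in>{1..N}. Enorm M (\<lambda>\<omega>. X (gridpt T N n) \<omega> - Xh n \<omega>))"

text \<open>Convergence for $h = T/N \to 0$; \<open>N\<close> runs through the step numbers considered, for which
  the method has an almost surely unique solution, and the limit is asserted for every version
  of these solutions.\<close>

definition strongly_convergent ::
  "'w measure \<Rightarrow> real \<Rightarrow> ('k::finite \<Rightarrow> real \<Rightarrow> 'w \<Rightarrow> nat) \<Rightarrow> ('k \<Rightarrow> real ^ 'd) \<Rightarrow>
   (real ^ 'd \<Rightarrow> real ^ 'd \<Rightarrow> real \<Rightarrow> real ^ 'd) \<Rightarrow> ('k \<Rightarrow> real ^ 'd \<Rightarrow> real \<Rightarrow> real) \<Rightarrow>
   real \<Rightarrow> (real \<Rightarrow> 'w \<Rightarrow> real ^ 'd) \<Rightarrow> bool" where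
  "strongly_convergent M T Y \<nu> \<phi>1 \<phi>3 L2 X \<longleftrightarrow>
     (\<forall>Xh \<tau>h. (\<forall>N\<in>step_numbers T L2 \<phi>1.
          maruyama_solution M Y \<nu> \<phi>1 \<phi>3 (T / N) N (X 0) (Xh N) (\<tau>h N)) \<longrightarrow>
        (\<lambda>N. strong_global_err M T X N (Xh N)) \<longlonglongrightarrow> 0)"

end

theory Submission
  imports Defs
begin

text \<open>Write $\tau_k(t)=\int_0^t\lambda_k(X)$ for the internal time of channel $k$. Telescoping both the
  equation and the recursion from time $0$ bounds $|X(t_n)-\widehat X_n|$ by the local errors, by
  Lipschitz terms and by the differences $|Y_k(\tau_k(t_n))-Y_k(\widehat\tau_k(t_n))|\,|\nu_k|$, and a
  discrete Gronwall argument finishes the proof once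
  $E|Y_k(\tau_k)-Y_k(\widehat\tau_k)|\le E|\tau_k-\widehat\tau_k|$ is known.

  This inequality is optional stopping: both internal times are stopping times for the filtration
  that observes channel $k$ up to its internal time $s$ and everything else completely. For the
  scheme, $\{\widehat\tau_k(t_n)<s\}$ does not change when $Y_k$ is stopped at $s$. For $X$, which is only
  assumed to be some measurable solution, one also needs that $X$ is a measurable functional of its
  data: it is the limit of paths that follow the equation for at most $n$ jumps and solve the drift
  equation by Picard iteration. These agree with every solution up to its $n$-th jump, so that
  $\{\tau_k(t)<s\}$ is read off from the approximations driven by the stopped process.\<close>

section \<open>Picard iteration along a forcing path\<close>

text \<open>The exact solution and the scheme read a Poisson path over different internal time
  intervals, so their increments over one step do not match. Summation from time 0 instead puts two
  random times of the same \<open>Y k\<close> side by side at each grid point. The resulting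
  inequality sees the quadrature error of each channel separately, whence the channelwise form of
  the bound; the form with the summed error uses \<open>no_cancellation\<close> at the price of a
  factor \<open>K\<close>. No moment of X(0) is assumed, so all expectations stay in ennreal, even
  in Gronwall's inequality, and finiteness is never checked. Since X satisfies its equation only
  almost surely, the observed past contains the events of probability 0 and 1, and X and Y are
  replaced by versions \<open>Xg\<close> and \<open>Yg\<close> that are regular at every sample
  point. The constant is S = (T/c) exp(growth T/c) K: T/c collects T/h local errors divided by a
  lower bound c of 1 - h L2, and the exponential is Gronwall's.\<close>

lemma set_integrable_power_Icc: "set_integrable lborel {0..t::real} (\<lambda>s. c * s ^ n)"
  by (intro borel_integrable_atLeastAtMost') (intro continuous_intros)

lemma set_integral_power_Icc:
  assumes "0 \<le> (t::real)"
  shows "(LBINT s:{0..t}. c * s ^ n) = c * t ^ Suc n / real (Suc n)"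
  using integral_power[OF assms, of n]
  by (simp add: set_lebesgue_integral_def mult.left_commute mult.commute)

lemma set_integrable_bounded_comp:
  fixes F :: "'a::euclidean_space \<Rightarrow> 'b::euclidean_space"
  assumes [measurable]: "F \<in> borel_measurable borel" "z \<in> borel_measurable borel"
    and B: "\<And>x. norm (F x) \<le> B"
  shows "set_integrable lborel {a..b::real} (\<lambda>s. F (z s))"
  unfolding set_integrable_def
proof (rule Bochner_Integration.integrable_bound)
  show "integrable lborel (\<lambda>s. indicator {a..b} s *\<^sub>R B)"
    by (simp add: emeasure_lborel_Icc_eq)
  show "AE s in lborel. norm (indicator {a..b} s *\<^sub>R F (z s)) \<le> norm (indicator {a..b} s *\<^sub>R B)"
    using B by (auto simp: indicator_def intro: order_trans[OF B abs_ge_self])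
qed simp

lemma set_integral_norm_bound_Icc:
  fixes u :: "real \<Rightarrow> 'b::euclidean_space"
  assumes "set_integrable lborel {a..b} u" "set_integrable lborel {a..b} v"
    and "\<And>s. s \<in> {a..b} \<Longrightarrow> norm (u s) \<le> v s"
  shows "norm (LBINT s:{a..b}. u s) \<le> (LBINT s:{a..b}. v s)"
proof -
  have "norm (LBINT s:{a..b}. u s) \<le> (LBINT s:{a..b}. norm (u s))"
    by (rule set_integral_norm_bound[OF assms(1)])
  also have "\<dots> \<le> (LBINT s:{a..b}. v s)"
    by (rule set_integral_mono) (use assms set_integrable_norm in auto)
  finally show ?thesis .
qed

lemma set_integral_singleton:
  fixes u :: "real \<Rightarrow> 'b::euclidean_space"
  shows "(LBINT s:{a}. u s) = 0"
  unfolding set_lebesgue_integral_def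
  by (intro integral_eq_zero_AE eventually_mono[OF AE_lborel_singleton[of a]]) auto

lemma set_integral_Icc_split:
  fixes u :: "real \<Rightarrow> 'b::euclidean_space"
  assumes "set_integrable lborel {a..c} u" "a \<le> b" "b \<le> c"
  shows "(LBINT s:{a..c}. u s) = (LBINT s:{a..b}. u s) + (LBINT s:{b..c}. u s)"
proof -
  have "{a..c} = {a..b} \<union> {b<..c}" using assms by auto
  moreover have "(LBINT s:{a..b} \<union> {b<..c}. u s) = (LBINT s:{a..b}. u s) + (LBINT s:{b<..c}. u s)"
    using assms by (intro set_integral_Un) (auto intro: set_integrable_subset)
  moreover have "(LBINT s:{b<..c}. u s) = (LBINT s:{b..c}. u s)"
    unfolding set_lebesgue_integral_def
    using set_integrable_subset[OF assms(1), of "{b<..c}"] set_integrable_subset[OF assms(1), of "{b..c}"]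
      AE_lborel_singleton[of b] assms(2,3)
    by (intro integral_cong_AE)
       (auto simp: set_integrable_def subset_eq elim!: eventually_mono split: split_indicator
         dest: borel_measurable_integrable)
  ultimately show ?thesis by simp
qed

primrec picard ::
  "('a \<Rightarrow> 'a::euclidean_space) \<Rightarrow> (real \<Rightarrow> 'a) \<Rightarrow> nat \<Rightarrow> real \<Rightarrow> 'a" where
  "picard f g 0 = g"
| "picard f g (Suc m) = (\<lambda>t. g t + (LBINT s:{0..t}. f (picard f g m s)))"

text \<open>A pointwise \<open>lim\<close>, total even where the iterates diverge: measurability in
  parameters then holds without any convergence argument, and the value matters only where
  \<open>ode_sol_eqI\<close> applies.\<close>

definition ode_sol ::
  "('a \<Rightarrow> 'a::euclidean_space) \<Rightarrow> (real \<Rightarrow> 'a) \<Rightarrow> real \<Rightarrow> 'a" where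
  "ode_sol f g t = lim (\<lambda>m. picard f g m t)"

text \<open>The moving endpoint is turned into a cut-off of the integrand, so that the integral runs
  over the fixed measure \<open>lborel\<close> and the measurability of parameter integrals
  applies.\<close>

lemma measurable_set_integral_upto [measurable (raw)]:
  fixes F :: "'a \<times> real \<Rightarrow> 'b::euclidean_space"
  assumes [measurable]: "(\<lambda>(w, s). F (w, s)) \<in> borel_measurable (N \<Otimes>\<^sub>M borel)"
    "t \<in> borel_measurable N"
  shows "(\<lambda>w. LBINT s:{0..t w}. F (w, s)) \<in> borel_measurable N"
proof -
  have "(\<lambda>w. LINT s|lborel. (if 0 \<le> s \<and> s \<le> t w then F (w, s) else 0)) \<in> borel_measurable N"
  proof (rule lborel.borel_measurable_lebesgue_integral)
    have [measurable]: "(\<lambda>x. F x) \<in> borel_measurable (N \<Otimes>\<^sub>M lborel)"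
      using assms(1) by (subst measurable_cong_sets[OF sets_pair_measure_cong[OF refl sets_lborel] refl]) simp
    show "(\<lambda>(w, s). if 0 \<le> s \<and> s \<le> t w then F (w, s) else 0) \<in> borel_measurable (N \<Otimes>\<^sub>M lborel)"
      by measurable
  qed
  also have "(\<lambda>w. LINT s|lborel. (if 0 \<le> s \<and> s \<le> t w then F (w, s) else 0)) =
      (\<lambda>w. LBINT s:{0..t w}. F (w, s))"
    unfolding set_lebesgue_integral_def by (auto intro!: Bochner_Integration.integral_cong simp: indicator_def)
  finally show ?thesis .
qed

text \<open>Measurability has to be joint in parameter and time, because the next iterate integrates
  the previous one over time.\<close>

lemma measurable_picard_joint:
  assumes [measurable]: "f \<in> borel_measurable borel"
    and g: "(\<lambda>(w, t). g w t) \<in> borel_measurable (N \<Otimes>\<^sub>M borel)"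
  shows "(\<lambda>(w, t). picard f (g w) m t) \<in> borel_measurable (N \<Otimes>\<^sub>M borel)"
proof (induction m)
  case (Suc m)
  have [measurable]: "(\<lambda>p. picard f (g (fst p)) m (snd p)) \<in> borel_measurable (N \<Otimes>\<^sub>M borel)"
    using Suc by (simp add: case_prod_beta')
  have [measurable]: "(\<lambda>p. g (fst p) (snd p)) \<in> borel_measurable (N \<Otimes>\<^sub>M borel)"
    using g by (simp add: case_prod_beta')
  have "(\<lambda>p. (\<lambda>(p, s). f (picard f (g (fst p)) m s)) p)
     \<in> borel_measurable ((N \<Otimes>\<^sub>M (borel::real measure)) \<Otimes>\<^sub>M (borel::real measure))"
  proof -
    have "(\<lambda>q. (fst (fst q), snd q)) \<in> ((N \<Otimes>\<^sub>M (borel::real measure)) \<Otimes>\<^sub>M (borel::real measure)) \<rightarrow>\<^sub>M (N \<Otimes>\<^sub>M borel)"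
      by measurable
    from measurable_compose[OF this, of "\<lambda>p. f (picard f (g (fst p)) m (snd p))" borel]
    show ?thesis by (simp add: case_prod_beta')
  qed
  then have "(\<lambda>p. LBINT s:{0..snd p}. (\<lambda>(p, s). f (picard f (g (fst p)) m s)) (p, s))
      \<in> borel_measurable (N \<Otimes>\<^sub>M borel)"
    by (intro measurable_set_integral_upto) auto
  then show ?case by (simp add: case_prod_beta')
qed (use g in simp)

lemma measurable_ode_sol_joint:
  assumes "f \<in> borel_measurable borel"
    and "(\<lambda>(w, t). g w t) \<in> borel_measurable (N \<Otimes>\<^sub>M borel)"
  shows "(\<lambda>(w, t). ode_sol f (g w) t) \<in> borel_measurable (N \<Otimes>\<^sub>M borel)"
  using borel_measurable_lim_metric[OF measurable_picard_joint[OF assms]]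
  by (simp add: ode_sol_def case_prod_beta')

text \<open>A solution \<open>x\<close> is given, so only the convergence of the iterates to it has
  to be shown. The forcing \<open>g\<close> may jump; it will carry the Poisson terms.\<close>

lemma ode_sol_eqI:
  fixes f :: "'a \<Rightarrow> 'a::euclidean_space"
  assumes f: "C-lipschitz_on UNIV f" and B: "\<And>x. norm (f x) \<le> B"
    and [measurable]: "x \<in> borel_measurable borel" "g \<in> borel_measurable borel"
    and eq: "\<And>t. 0 \<le> t \<Longrightarrow> t \<le> r \<Longrightarrow> x t = g t + (LBINT s:{0..t}. f (x s))"
    and t: "0 \<le> t" "t \<le> r"
  shows "ode_sol f g t = x t"
proof -
  have [measurable]: "f \<in> borel_measurable borel"
    using lipschitz_on_continuous_on[OF f] by (rule borel_measurable_continuous_onI)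
  have C: "0 \<le> C" using f by (rule lipschitz_on_nonneg)
  have B0: "0 \<le> B" using B[of 0] norm_ge_zero order_trans by blast
  \<comment> \<open>One path is treated as a family over a one-point parameter space, to reuse the
    joint measurability.\<close>
  have g': "(\<lambda>(w::unit, t). g t) \<in> borel_measurable (count_space UNIV \<Otimes>\<^sub>M borel)"
    by measurable
  have [measurable]: "picard f g m \<in> borel_measurable borel" for m
    using measurable_compose[OF _ measurable_picard_joint[OF _ g', of f m], of "\<lambda>t. ((), t)" borel]
    by simp
  \<comment> \<open>The start \<open>g\<close> misses \<open>x\<close> by an integral of
    \<open>f\<close>, at most B t. Each iteration puts the previous bound under the integral, which
    gains a factor C and one power of t; the new denominators build up the factorial.\<close>
  have bound: "norm (picard f g m t - x t) \<le> B * C ^ m / fact (Suc m) * t ^ Suc m"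
    if "0 \<le> t" "t \<le> r" for m t using that
  proof (induction m arbitrary: t)
    case 0
    have "norm (LBINT s:{0..t}. f (x s)) \<le> (LBINT s:{0..t}. B * s ^ 0)"
      using B by (intro set_integral_norm_bound_Icc set_integrable_bounded_comp set_integrable_power_Icc) auto
    also have "\<dots> = B * t" using 0 by (subst set_integral_power_Icc) auto
    finally show ?case using eq[of t] 0 by simp
  next
    case (Suc m)
    have i: "set_integrable lborel {0..t} (\<lambda>s. f (picard f g m s))"
      "set_integrable lborel {0..t} (\<lambda>s. f (x s))"
      by (intro set_integrable_bounded_comp[OF _ _ B]; measurable)+
    have "picard f g (Suc m) t - x t = (LBINT s:{0..t}. f (picard f g m s) - f (x s))"
      using eq[of t] Suc.prems by (simp add: set_integral_diff[OF i])
    also have "norm \<dots> \<le> (LBINT s:{0..t}. (C * (B * C ^ m / fact (Suc m))) * s ^ Suc m)"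
    proof (intro set_integral_norm_bound_Icc set_integral_diff(1)[OF i] set_integrable_power_Icc)
      fix s assume s: "s \<in> {0..t}"
      have "norm (f (picard f g m s) - f (x s)) \<le> C * norm (picard f g m s - x s)"
        using lipschitz_onD[OF f, of "picard f g m s" "x s"] by (simp add: dist_norm)
      also have "\<dots> \<le> C * (B * C ^ m / fact (Suc m) * s ^ Suc m)"
        using s Suc.prems by (intro mult_left_mono Suc.IH C) auto
      finally show "norm (f (picard f g m s) - f (x s)) \<le> C * (B * C ^ m / fact (Suc m)) * s ^ Suc m"
        by (simp add: mult.assoc)
    qed
    also have "\<dots> = C * (B * C ^ m / fact (Suc m)) * t ^ Suc (Suc m) / real (Suc (Suc m))"
      using Suc.prems by (intro set_integral_power_Icc)
    also have "\<dots> = B * C ^ Suc m / fact (Suc (Suc m)) * t ^ Suc (Suc m)"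
      by (simp add: divide_simps)
    finally show ?case .
  qed
  have "(\<lambda>m. picard f g m t) \<longlonglongrightarrow> x t"
  proof (rule LIM_zero_cancel, rule tendsto_norm_zero_cancel, rule tendsto_sandwich)
    show "\<forall>\<^sub>F m in sequentially. 0 \<le> norm (picard f g m t - x t)" by simp
    show "\<forall>\<^sub>F m in sequentially. norm (picard f g m t - x t) \<le> (B * t) * ((C * t) ^ m / fact m)"
    proof (intro always_eventually allI)
      fix m
      \<comment> \<open>Weakening (m+1)! to m! leaves B t times a term of the exponential series at
        C t, which tends to 0.\<close>
      have "B * C ^ m / fact (Suc m) * t ^ Suc m \<le> B * C ^ m / fact m * t ^ Suc m"
        using B0 C t by (intro mult_right_mono divide_left_mono fact_mono) auto
      with bound[OF t, of m] show "norm (picard f g m t - x t) \<le> (B * t) * ((C * t) ^ m / fact m)"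
        by (simp add: power_mult_distrib mult.assoc mult.left_commute)
    qed
    show "(\<lambda>m. (B * t) * ((C * t) ^ m / fact m)) \<longlonglongrightarrow> 0"
      using summable_LIMSEQ_zero[OF summable_exp[of "C * t"]]
      by (intro tendsto_mult_right_zero) (simp add: divide_inverse mult.commute)
  qed simp
  then show ?thesis unfolding ode_sol_def by (rule limI)
qed

section \<open>Measurable approximation of the time change equation\<close>

text \<open>The next multiple of 1/(m+1) strictly above \<open>u\<close>, also when \<open>u\<close>
  is itself a multiple. Strictness places the approximation in the filter \<open>at_right u\<close>
  and later produces the strict events \<tau> < s of the stopping argument.\<close>

definition grid_above :: "nat \<Rightarrow> real \<Rightarrow> real" where
  "grid_above m u = (of_int \<lfloor>real (Suc m) * u\<rfloor> + 1) / real (Suc m)"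

lemma grid_above_gt: "u < grid_above m u"
proof -
  have "real (Suc m) * u < of_int \<lfloor>real (Suc m) * u\<rfloor> + 1" by linarith
  then show ?thesis unfolding grid_above_def by (simp add: pos_less_divide_eq mult.commute)
qed

lemma grid_above_le: "grid_above m u \<le> u + 1 / real (Suc m)"
proof -
  have "of_int \<lfloor>real (Suc m) * u\<rfloor> + 1 \<le> real (Suc m) * u + 1" by linarith
  then have "grid_above m u \<le> (real (Suc m) * u + 1) / real (Suc m)"
    unfolding grid_above_def by (rule divide_right_mono) simp
  then show ?thesis by (simp add: add_divide_distrib del: of_nat_Suc)
qed

lemma filterlim_grid_above: "filterlim (\<lambda>m. grid_above m u) (at_right u) sequentially"
proof -
  have "(\<lambda>m. grid_above m u) \<longlonglongrightarrow> u"
  proof (rule tendsto_sandwich[of "\<lambda>_. u" _ _ "\<lambda>m. u + 1 / real (Suc m)"])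
    show "(\<lambda>m. u + 1 / real (Suc m)) \<longlonglongrightarrow> u"
      using tendsto_add[OF tendsto_const[of u] LIMSEQ_inverse_real_of_nat] by (simp add: inverse_eq_divide)
  qed (auto intro!: always_eventually less_imp_le[OF grid_above_gt] grid_above_le simp del: of_nat_Suc)
  then show ?thesis
    by (simp add: filterlim_at grid_above_gt less_imp_neq[OF grid_above_gt, symmetric])
qed

lemma right_cont_grid_above:
  assumes "continuous (at_right u) y"
  shows "(\<lambda>m. y (grid_above m u)) \<longlonglongrightarrow> y u"
  using filterlim_compose[OF _ filterlim_grid_above] assms by (auto simp: continuous_within)

text \<open>With the time replaced by \<open>grid_above m\<close> only countably many times occur,
  so measurability holds piece by piece; right continuity gives the limit in m.\<close>

lemma measurable_right_cont_joint:
  fixes y :: "'w \<Rightarrow> real \<Rightarrow> 'b::metric_space"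
  assumes y: "\<And>u. (\<lambda>w. y w u) \<in> borel_measurable N"
    and rc: "\<And>w u. w \<in> space N \<Longrightarrow> continuous (at_right u) (y w)"
  shows "(\<lambda>(w, u). y w u) \<in> borel_measurable (N \<Otimes>\<^sub>M borel)"
proof -
  have *: "(\<lambda>p. y (fst p) (grid_above m (snd p))) \<in> borel_measurable (N \<Otimes>\<^sub>M borel)" for m
  proof -
    have "(\<lambda>p. (\<lambda>i p. y (fst p) ((of_int i + 1) / real (Suc m))) \<lfloor>real (Suc m) * snd p\<rfloor> p)
      \<in> borel_measurable (N \<Otimes>\<^sub>M borel)"
      by (rule measurable_compose_countable[OF measurable_compose[OF measurable_fst y]]) measurable
    then show ?thesis by (simp only: grid_above_def)
  qed
  have "(\<lambda>p. y (fst p) (snd p)) \<in> borel_measurable (N \<Otimes>\<^sub>M borel)"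
    by (rule borel_measurable_LIMSEQ_metric[OF *])
       (auto simp: space_pair_measure intro!: right_cont_grid_above rc)
  then show ?thesis by (simp add: case_prod_beta')
qed

lemma right_cont_nat_real:
  fixes y :: "real \<Rightarrow> nat"
  assumes "continuous (at_right u) y"
  shows "continuous (at_right u) (\<lambda>v. real (y v))"
  using assms unfolding continuous_within tendsto_discrete
  by (intro tendsto_eventually) (auto elim: eventually_mono)

lemma measurable_right_cont_joint_nat:
  fixes y :: "'w \<Rightarrow> real \<Rightarrow> nat"
  assumes [measurable]: "\<And>u. (\<lambda>w. y w u) \<in> measurable N (count_space UNIV)"
    and rc: "\<And>w u. w \<in> space N \<Longrightarrow> continuous (at_right u) (y w)"
  shows "(\<lambda>(w, u). y w u) \<in> measurable (N \<Otimes>\<^sub>M borel) (count_space UNIV)"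
proof -
  have "(\<lambda>(w, u). real (y w u)) \<in> borel_measurable (N \<Otimes>\<^sub>M borel)"
    by (intro measurable_right_cont_joint right_cont_nat_real rc) measurable
  then have [measurable]: "(\<lambda>p. real (y (fst p) (snd p))) \<in> borel_measurable (N \<Otimes>\<^sub>M borel)"
    by (simp add: case_prod_beta')
  have "(\<lambda>p. nat \<lfloor>real (y (fst p) (snd p))\<rfloor>) \<in> measurable (N \<Otimes>\<^sub>M borel) (count_space UNIV)"
    by measurable
  then show ?thesis by (simp add: case_prod_beta')
qed

section \<open>Internal clocks, jump counts and the approximating paths\<close>

definition clock :: "('k \<Rightarrow> 'a \<Rightarrow> real) \<Rightarrow> (real \<Rightarrow> 'a) \<Rightarrow> 'k \<Rightarrow> real \<Rightarrow> real" where
  "clock lam z k t = (LBINT s:{0..t}. lam k (z s))"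

definition jump_count ::
  "('k::finite \<Rightarrow> 'a \<Rightarrow> real) \<Rightarrow> ('k \<Rightarrow> real \<Rightarrow> nat) \<Rightarrow> (real \<Rightarrow> 'a) \<Rightarrow> real \<Rightarrow> nat" where
  "jump_count lam y z t = (\<Sum>k\<in>UNIV. y k (clock lam z k t))"

text \<open>For nondecreasing \<open>y\<close> this is the minimum of \<open>t\<close> and the time of the \<open>(n+1)\<close>-st jump along \<open>z\<close>;
  written as an integral, it is visibly measurable.\<close>

definition jump_cutoff ::
  "('k::finite \<Rightarrow> 'a \<Rightarrow> real) \<Rightarrow> ('k \<Rightarrow> real \<Rightarrow> nat) \<Rightarrow> nat \<Rightarrow> (real \<Rightarrow> 'a) \<Rightarrow> real \<Rightarrow> real" where
  "jump_cutoff lam y n z t = (LBINT u:{0..t}. if jump_count lam y z u \<le> n then 1 else 0)"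

primrec rtc_approx ::
  "('a \<Rightarrow> 'a::euclidean_space) \<Rightarrow> ('k::finite \<Rightarrow> 'a \<Rightarrow> real) \<Rightarrow> ('k \<Rightarrow> 'a) \<Rightarrow>
   ('k \<Rightarrow> real \<Rightarrow> nat) \<Rightarrow> 'a \<Rightarrow> nat \<Rightarrow> real \<Rightarrow> 'a" where
  "rtc_approx f lam \<nu> y x0 0 = ode_sol f (\<lambda>_. x0)"
| "rtc_approx f lam \<nu> y x0 (Suc n) = ode_sol f (\<lambda>t. x0 +
     (\<Sum>k\<in>UNIV. real (y k (clock lam (rtc_approx f lam \<nu> y x0 n) k
        (jump_cutoff lam y n (rtc_approx f lam \<nu> y x0 n) t))) *\<^sub>R \<nu> k))"

lemma measurable_clock_joint:
  fixes lam :: "'k::finite \<Rightarrow> 'a::euclidean_space \<Rightarrow> real"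
  assumes [measurable]: "\<And>k. lam k \<in> borel_measurable borel"
    and z: "(\<lambda>(w, t). z w t) \<in> borel_measurable (N \<Otimes>\<^sub>M borel)"
  shows "(\<lambda>(w, t). clock lam (z w) k t) \<in> borel_measurable (N \<Otimes>\<^sub>M borel)"
proof -
  have [measurable]: "(\<lambda>p. z (fst p) (snd p)) \<in> borel_measurable (N \<Otimes>\<^sub>M borel)"
    using z by (simp add: case_prod_beta')
  have "(\<lambda>q. (fst (fst q), snd q)) \<in>
      ((N \<Otimes>\<^sub>M (borel::real measure)) \<Otimes>\<^sub>M (borel::real measure)) \<rightarrow>\<^sub>M (N \<Otimes>\<^sub>M borel)"
    by measurable
  from measurable_compose[OF this, of "\<lambda>p. lam k (z (fst p) (snd p))" borel]
  have "(\<lambda>p. (\<lambda>(p, s). lam k (z (fst p) s)) p)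
     \<in> borel_measurable ((N \<Otimes>\<^sub>M (borel::real measure)) \<Otimes>\<^sub>M (borel::real measure))"
    by (simp add: case_prod_beta')
  then have "(\<lambda>p. LBINT s:{0..snd p}. (\<lambda>(p, s). lam k (z (fst p) s)) (p, s))
      \<in> borel_measurable (N \<Otimes>\<^sub>M borel)"
    by (intro measurable_set_integral_upto) auto
  then show ?thesis by (simp add: case_prod_beta' clock_def)
qed

lemma measurable_jump_count_joint:
  fixes lam :: "'k::finite \<Rightarrow> 'a::euclidean_space \<Rightarrow> real"
  assumes lam: "\<And>k. lam k \<in> borel_measurable borel"
    and y: "\<And>k. (\<lambda>(w, u). y w k u) \<in> measurable (N \<Otimes>\<^sub>M borel) (count_space UNIV)"
    and z: "(\<lambda>(w, t). z w t) \<in> borel_measurable (N \<Otimes>\<^sub>M borel)"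
  shows "(\<lambda>(w, t). jump_count lam (y w) (z w) t) \<in> measurable (N \<Otimes>\<^sub>M borel) (count_space UNIV)"
proof -
  have [measurable]: "(\<lambda>p. clock lam (z (fst p)) k (snd p)) \<in> borel_measurable (N \<Otimes>\<^sub>M borel)" for k
    using measurable_clock_joint[OF lam z] by (simp add: case_prod_beta')
  have "(\<lambda>p. (fst p, clock lam (z (fst p)) k (snd p))) \<in> (N \<Otimes>\<^sub>M borel) \<rightarrow>\<^sub>M (N \<Otimes>\<^sub>M borel)" for k
    by measurable
  from measurable_compose[OF this y]
  have [measurable]: "(\<lambda>p. y (fst p) k (clock lam (z (fst p)) k (snd p)))
      \<in> measurable (N \<Otimes>\<^sub>M borel) (count_space UNIV)" for k
    by simp
  show ?thesis
    unfolding jump_count_def case_prod_beta' by measurable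
qed

lemma measurable_jump_cutoff_joint:
  fixes lam :: "'k::finite \<Rightarrow> 'a::euclidean_space \<Rightarrow> real"
  assumes lam: "\<And>k. lam k \<in> borel_measurable borel"
    and y: "\<And>k. (\<lambda>(w, u). y w k u) \<in> measurable (N \<Otimes>\<^sub>M borel) (count_space UNIV)"
    and z: "(\<lambda>(w, t). z w t) \<in> borel_measurable (N \<Otimes>\<^sub>M borel)"
  shows "(\<lambda>(w, t). jump_cutoff lam (y w) n (z w) t) \<in> borel_measurable (N \<Otimes>\<^sub>M borel)"
proof -
  have [measurable]: "(\<lambda>p. jump_count lam (y (fst p)) (z (fst p)) (snd p)) \<in> measurable (N \<Otimes>\<^sub>M borel) (count_space UNIV)"
    using measurable_jump_count_joint[OF lam y z] by (simp add: case_prod_beta')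
  have "(\<lambda>q. (fst (fst q), snd q)) \<in>
      ((N \<Otimes>\<^sub>M (borel::real measure)) \<Otimes>\<^sub>M (borel::real measure)) \<rightarrow>\<^sub>M (N \<Otimes>\<^sub>M borel)"
    by measurable
  from measurable_compose[OF this, of "\<lambda>p. if jump_count lam (y (fst p)) (z (fst p)) (snd p) \<le> n then 1 else 0" "borel::real measure"]
  have "(\<lambda>p. (\<lambda>(p, s). if jump_count lam (y (fst p)) (z (fst p)) s \<le> n then 1 else 0::real) p)
     \<in> borel_measurable ((N \<Otimes>\<^sub>M (borel::real measure)) \<Otimes>\<^sub>M (borel::real measure))"
    by (simp add: case_prod_beta')
  then have "(\<lambda>p. LBINT s:{0..snd p}. (\<lambda>(p, s). if jump_count lam (y (fst p)) (z (fst p)) s \<le> n then 1 else 0::real) (p, s))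
      \<in> borel_measurable (N \<Otimes>\<^sub>M borel)"
    by (intro measurable_set_integral_upto) auto
  then show ?thesis by (simp add: case_prod_beta' jump_cutoff_def)
qed

lemma measurable_rtc_forcing_joint:
  fixes lam :: "'k::finite \<Rightarrow> 'a::euclidean_space \<Rightarrow> real" and x0 :: "'w \<Rightarrow> 'a"
  assumes lam: "\<And>k. lam k \<in> borel_measurable borel"
    and y: "\<And>k. (\<lambda>(w, u). y w k u) \<in> measurable (N \<Otimes>\<^sub>M borel) (count_space UNIV)"
    and x0: "x0 \<in> borel_measurable N"
    and z: "(\<lambda>(w, t). z w t) \<in> borel_measurable (N \<Otimes>\<^sub>M borel)"
  shows "(\<lambda>(w, t). x0 w + (\<Sum>k\<in>UNIV. real (y w k (clock lam (z w) k (jump_cutoff lam (y w) n (z w) t))) *\<^sub>R \<nu> k))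
    \<in> borel_measurable (N \<Otimes>\<^sub>M borel)"
proof -
  have c: "(\<lambda>p. clock lam (z (fst p)) k (snd p)) \<in> borel_measurable (N \<Otimes>\<^sub>M borel)" for k
    using measurable_clock_joint[OF lam z] by (simp add: case_prod_beta')
  have [measurable]: "(\<lambda>p. jump_cutoff lam (y (fst p)) n (z (fst p)) (snd p)) \<in> borel_measurable (N \<Otimes>\<^sub>M borel)"
    using measurable_jump_cutoff_joint[OF lam y z] by (simp add: case_prod_beta')
  have "(\<lambda>p. (fst p, jump_cutoff lam (y (fst p)) n (z (fst p)) (snd p))) \<in> (N \<Otimes>\<^sub>M borel) \<rightarrow>\<^sub>M (N \<Otimes>\<^sub>M borel)" for k
    by measurable
  from measurable_compose[OF this c]
  have [measurable]: "(\<lambda>p. clock lam (z (fst p)) k (jump_cutoff lam (y (fst p)) n (z (fst p)) (snd p))) \<in> borel_measurable (N \<Otimes>\<^sub>M borel)" for k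
    by simp
  have "(\<lambda>p. (fst p, clock lam (z (fst p)) k (jump_cutoff lam (y (fst p)) n (z (fst p)) (snd p)))) \<in> (N \<Otimes>\<^sub>M borel) \<rightarrow>\<^sub>M (N \<Otimes>\<^sub>M borel)" for k
    by measurable
  from measurable_compose[OF this y]
  have [measurable]: "(\<lambda>p. y (fst p) k (clock lam (z (fst p)) k (jump_cutoff lam (y (fst p)) n (z (fst p)) (snd p))))
      \<in> measurable (N \<Otimes>\<^sub>M borel) (count_space UNIV)" for k
    by simp
  show ?thesis
    unfolding case_prod_beta'
    by (intro borel_measurable_add measurable_compose[OF measurable_fst x0]) measurable
qed

lemma measurable_rtc_approx_joint:
  fixes lam :: "'k::finite \<Rightarrow> 'a::euclidean_space \<Rightarrow> real"
  assumes f: "f \<in> borel_measurable borel" and lam: "\<And>k. lam k \<in> borel_measurable borel"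
    and y: "\<And>k. (\<lambda>(w, u). y w k u) \<in> measurable (N \<Otimes>\<^sub>M borel) (count_space UNIV)"
    and x0: "x0 \<in> borel_measurable N"
  shows "(\<lambda>(w, t). rtc_approx f lam \<nu> (y w) (x0 w) n t) \<in> borel_measurable (N \<Otimes>\<^sub>M borel)"
proof (induction n)
  case 0
  have "(\<lambda>(w, t). ode_sol f (\<lambda>_. x0 w) t) \<in> borel_measurable (N \<Otimes>\<^sub>M borel)"
    using measurable_compose[OF measurable_fst x0]
    by (intro measurable_ode_sol_joint[OF f]) (simp add: case_prod_beta')
  then show ?case by simp
next
  case (Suc n)
  show ?case
    unfolding rtc_approx.simps
    by (intro measurable_ode_sol_joint[OF f] measurable_rtc_forcing_joint[OF lam y x0 Suc])
qed

lemma set_integral_cong_except: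
  fixes u v :: "real \<Rightarrow> 'b::euclidean_space"
  assumes "set_integrable lborel {a..b} u" "set_integrable lborel {a..b} v"
    and "\<And>s. s \<in> {a..b} \<Longrightarrow> s \<noteq> c \<Longrightarrow> u s = v s"
  shows "(LBINT s:{a..b}. u s) = (LBINT s:{a..b}. v s)"
  unfolding set_lebesgue_integral_def
proof (intro integral_cong_AE)
  show "AE s in lborel. indicat_real {a..b} s *\<^sub>R u s = indicat_real {a..b} s *\<^sub>R v s"
    using AE_lborel_singleton[of c] assms(3) by (auto elim!: eventually_mono split: split_indicator)
qed (use assms(1,2) in \<open>auto simp: set_integrable_def\<close>)

text \<open>Turns a total jump count that has not increased into the absence of jumps in every
  single channel.\<close>

lemma nat_sum_mono_eqD:
  fixes a b :: "'k::finite \<Rightarrow> nat"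
  assumes le: "\<And>k. a k \<le> b k" and eq: "(\<Sum>k\<in>UNIV. b k) \<le> (\<Sum>k\<in>UNIV. a k)"
  shows "a k = b k"
proof (rule ccontr)
  assume "a k \<noteq> b k"
  then have "(\<Sum>k\<in>UNIV. a k) < (\<Sum>k\<in>UNIV. b k)"
    using le by (intro sum_strict_mono_ex1 ballI bexI[of _ k]) (auto simp: less_le)
  with eq show False by simp
qed

section \<open>Pathwise agreement of solutions with the approximations\<close>

locale rtc_data =
  fixes f :: "'a::euclidean_space \<Rightarrow> 'a" and lam :: "'k::finite \<Rightarrow> 'a \<Rightarrow> real" and \<nu> :: "'k \<Rightarrow> 'a"
    and C B \<Lambda> :: real
  assumes f_lip: "C-lipschitz_on UNIV f" and f_bound: "\<And>x. norm (f x) \<le> B"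
    and lam_measurable[measurable]: "\<And>k. lam k \<in> borel_measurable borel"
    and lam_nonneg: "\<And>k x. 0 \<le> lam k x" and lam_bound: "\<And>k x. lam k x \<le> \<Lambda>"
begin

lemma f_measurable[measurable]: "f \<in> borel_measurable borel"
  using lipschitz_on_continuous_on[OF f_lip] by (rule borel_measurable_continuous_onI)

lemma lam_integrable:
  "z \<in> borel_measurable borel \<Longrightarrow> set_integrable lborel {a..b::real} (\<lambda>s. lam k (z s))"
  by (rule set_integrable_bounded_comp[OF lam_measurable, where B = \<Lambda>]) (use lam_nonneg lam_bound in auto)

lemma clock_diff:
  assumes z: "z \<in> borel_measurable borel" and "0 \<le> s" "s \<le> t"
  shows "clock lam z k t - clock lam z k s = (LBINT u:{s..t}. lam k (z u))"
  unfolding clock_def using set_integral_Icc_split[OF lam_integrable[OF z] assms(2,3)] by simp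

lemma clock_mono:
  assumes z: "z \<in> borel_measurable borel" and "0 \<le> s" "s \<le> t"
  shows "clock lam z k s \<le> clock lam z k t"
proof -
  have "0 \<le> (LBINT u:{s..t}. lam k (z u))"
    unfolding set_lebesgue_integral_def
    by (intro integral_nonneg_AE) (auto simp: lam_nonneg)
  then show ?thesis using clock_diff[OF assms, of k] by simp
qed

lemma clock_0[simp]: "clock lam z k 0 = 0"
  by (simp add: clock_def set_integral_singleton)

lemma clock_nonneg: "z \<in> borel_measurable borel \<Longrightarrow> 0 \<le> t \<Longrightarrow> 0 \<le> clock lam z k t"
  using clock_mono[of z 0 t k] by simp

lemma clock_diff_le:
  assumes z: "z \<in> borel_measurable borel" and "0 \<le> s" "s \<le> t"
  shows "clock lam z k t - clock lam z k s \<le> \<Lambda> * (t - s)"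
proof -
  have "(LBINT u:{s..t}. lam k (z u)) \<le> (LBINT u:{s..t}. \<Lambda>)"
    by (intro set_integral_mono lam_integrable z lam_bound)
       (simp add: set_integrable_def emeasure_lborel_Icc_eq)
  also have "\<dots> = \<Lambda> * (t - s)" using assms by (simp add: set_integral_const)
  finally show ?thesis using clock_diff[OF assms, of k] by simp
qed

lemma Lambda_nonneg: "0 \<le> \<Lambda>"
  using lam_nonneg lam_bound order_trans by blast

lemma continuous_on_clock:
  assumes z: "z \<in> borel_measurable borel"
  shows "continuous_on {0..} (clock lam z k)"
proof (rule lipschitz_on_continuous_on[of \<Lambda>], rule lipschitz_onI)
  fix s t :: real assume "s \<in> {0..}" "t \<in> {0..}"
  then show "dist (clock lam z k s) (clock lam z k t) \<le> \<Lambda> * dist s t"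
    using clock_mono[OF z, of s t k] clock_diff_le[OF z, of s t k]
      clock_mono[OF z, of t s k] clock_diff_le[OF z, of t s k]
    by (cases "s \<le> t") (auto simp: dist_real_def abs_if)
qed (rule Lambda_nonneg)

text \<open>The endpoint is left out because an approximation is known to be right only strictly
  before its next missing jump, while its clock is needed at the time of that jump.\<close>

lemma clock_cong:
  assumes "x \<in> borel_measurable borel" "z \<in> borel_measurable borel"
    and "\<And>s. 0 \<le> s \<Longrightarrow> s < t \<Longrightarrow> z s = x s"
  shows "clock lam z k t = clock lam x k t"
  unfolding clock_def
  by (intro set_integral_cong_except[where c = t] lam_integrable assms) (use assms(3) in auto)

lemma jump_count_mono:
  assumes "z \<in> borel_measurable borel" "0 \<le> s" "s \<le> t" and y: "\<And>k. mono (y k)"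
  shows "jump_count lam y z s \<le> jump_count lam y z t"
  unfolding jump_count_def using assms by (intro sum_mono monoD[OF y] clock_mono)

text \<open>Each channel is constant on some interval to the right of its present clock reading, and
  the continuous clock stays in that interval for a while; finitely many channels allow a common
  \<open>d\<close>.\<close>

lemma jump_count_right_const:
  assumes z: "z \<in> borel_measurable borel" and "0 \<le> t"
    and y: "\<And>k. mono (y k)" and rc: "\<And>k u. continuous (at_right u) (y k)"
  shows "\<exists>d>0. \<forall>s. t \<le> s \<longrightarrow> s < t + d \<longrightarrow> jump_count lam y z s = jump_count lam y z t"
proof -
  have "\<forall>\<^sub>F s in at_right t. y k (clock lam z k s) = y k (clock lam z k t)" for k
  proof -
    have "\<forall>\<^sub>F v in at_right (clock lam z k t). y k v = y k (clock lam z k t)"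
      using rc[of "clock lam z k t" k] unfolding continuous_within tendsto_discrete .
    then obtain b where b: "b > clock lam z k t"
      "\<And>v. clock lam z k t < v \<Longrightarrow> v < b \<Longrightarrow> y k v = y k (clock lam z k t)"
      by (auto simp: eventually_at_right_field)
    have "(clock lam z k \<longlongrightarrow> clock lam z k t) (at_right t)"
      using continuous_on_clock[OF z, of k] \<open>0 \<le> t\<close>
      by (auto simp: continuous_on_def intro: tendsto_within_subset)
    then have "\<forall>\<^sub>F s in at_right t. clock lam z k s < b"
      using b(1) by (rule order_tendstoD)
    moreover have "\<forall>\<^sub>F s in at_right t. t < s" by (rule eventually_at_right_less)
    ultimately show ?thesis
    proof eventually_elim
      case (elim s)
      have "clock lam z k t \<le> clock lam z k s" using elim \<open>0 \<le> t\<close> by (intro clock_mono z) auto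
      \<comment> \<open>The clock may stand still to the right of t; then its reading is not inside
        the open interval where b(2) applies.\<close>
      then show ?case using b(2)[of "clock lam z k s"] elim by (cases "clock lam z k t = clock lam z k s") auto
    qed
  qed
  then have "\<forall>\<^sub>F s in at_right t. \<forall>k\<in>UNIV. y k (clock lam z k s) = y k (clock lam z k t)"
    by (intro eventually_ball_finite) auto
  then have "\<forall>\<^sub>F s in at_right t. jump_count lam y z s = jump_count lam y z t"
    by eventually_elim (simp add: jump_count_def)
  then obtain b where b: "b > t" "\<And>s. t < s \<Longrightarrow> s < b \<Longrightarrow> jump_count lam y z s = jump_count lam y z t"
    by (auto simp: eventually_at_right_field)
  show ?thesis
  proof (intro exI[of _ "b - t"] conjI allI impI)
    fix s assume "t \<le> s" "s < t + (b - t)"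
    then show "jump_count lam y z s = jump_count lam y z t" using b(2)[of s] by (cases "s = t") auto
  qed (use b in simp)
qed

lemma rtc_measurable_path:
  assumes y: "\<And>k u. continuous (at_right u) (y k)"
  shows "rtc_approx f lam \<nu> y x0 n \<in> borel_measurable borel"
    and "(\<lambda>t. x0 + (\<Sum>k\<in>UNIV. real (y k (clock lam (rtc_approx f lam \<nu> y x0 n) k
        (jump_cutoff lam y n (rtc_approx f lam \<nu> y x0 n) t))) *\<^sub>R \<nu> k)) \<in> borel_measurable borel"
    and "z \<in> borel_measurable borel \<Longrightarrow> jump_count lam y z \<in> measurable borel (count_space UNIV)"
proof -
  have pair: "(\<lambda>t. ((), t)) \<in> borel \<rightarrow>\<^sub>M count_space UNIV \<Otimes>\<^sub>M borel" by measurable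
  have y': "(\<lambda>(w::unit, u). y k u) \<in> measurable (count_space UNIV \<Otimes>\<^sub>M borel) (count_space UNIV)" for k
    by (intro measurable_right_cont_joint_nat y) auto
  have x0': "(\<lambda>w::unit. x0) \<in> borel_measurable (count_space UNIV)" by simp
  note m = measurable_rtc_approx_joint[where f = f and lam = lam and y = "\<lambda>w. y", OF f_measurable lam_measurable y' x0', of \<nu> n]
  from measurable_compose[OF pair m]
  show "rtc_approx f lam \<nu> y x0 n \<in> borel_measurable borel" by simp
  from measurable_compose[OF pair measurable_rtc_forcing_joint[OF lam_measurable y' x0' m]]
  show "(\<lambda>t. x0 + (\<Sum>k\<in>UNIV. real (y k (clock lam (rtc_approx f lam \<nu> y x0 n) k
        (jump_cutoff lam y n (rtc_approx f lam \<nu> y x0 n) t))) *\<^sub>R \<nu> k)) \<in> borel_measurable borel"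
    by simp
  assume z: "z \<in> borel_measurable borel"
  have "(\<lambda>(w::unit, t). z t) \<in> borel_measurable (count_space UNIV \<Otimes>\<^sub>M borel)"
    using measurable_compose[OF measurable_snd z] by (simp add: case_prod_beta')
  from measurable_compose[OF pair measurable_jump_count_joint[OF lam_measurable y' this]]
  show "jump_count lam y z \<in> measurable borel (count_space UNIV)" by simp
qed

text \<open>The horizon \<open>r\<close> is a parameter because, with a channel stopped at s, a
  solution is known to solve the stopped equation only while that channel's clock has not passed
  s.\<close>

definition rtc_path :: "('k \<Rightarrow> real \<Rightarrow> nat) \<Rightarrow> 'a \<Rightarrow> real \<Rightarrow> (real \<Rightarrow> 'a) \<Rightarrow> bool" where
  "rtc_path y x0 r x \<longleftrightarrow> x \<in> borel_measurable borel \<and>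
     (\<forall>t. 0 \<le> t \<longrightarrow> t \<le> r \<longrightarrow> x t = x0 + (LBINT s:{0..t}. f (x s)) +
        (\<Sum>k\<in>UNIV. real (y k (clock lam x k t)) *\<^sub>R \<nu> k))"

text \<open>Let \<sigma> be the time of the (n+1)-st jump. Before \<sigma> stage \<open>n\<close> is
  exact by induction, hence so are its clocks up to and including \<sigma>. After \<sigma> the
  solution makes no further jump while its count is at most n+1. So stage \<open>Suc n\<close> has
  the same forcing as the solution, and \<open>ode_sol_eqI\<close> identifies the two.\<close>

lemma rtc_approx_eq:
  assumes x: "rtc_path y x0 r x"
    and y: "\<And>k. mono (y k)" and rc: "\<And>k u. continuous (at_right u) (y k)"
    and "0 \<le> t" "t \<le> r" "jump_count lam y x t \<le> n"
  shows "rtc_approx f lam \<nu> y x0 n t = x t"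
  using assms(4-6)
proof (induction n arbitrary: t)
  case 0
  have xm: "x \<in> borel_measurable borel" using x by (simp add: rtc_path_def)
  show ?case
    unfolding rtc_approx.simps
  proof (rule ode_sol_eqI[OF f_lip f_bound xm _ _ \<open>0 \<le> t\<close> order_refl])
    fix t' assume t': "0 \<le> t'" "t' \<le> t"
    have "jump_count lam y x t' = 0" using jump_count_mono[of x t' t y, OF xm t' y] 0 by simp
    then show "x t' = x0 + (LBINT s:{0..t'}. f (x s))"
      using x t' 0 by (simp add: rtc_path_def jump_count_def)
  qed simp
next
  case (Suc n)
  let ?z = "rtc_approx f lam \<nu> y x0 n"
  have xm: "x \<in> borel_measurable borel" using x by (simp add: rtc_path_def)
  have zm: "?z \<in> borel_measurable borel" by (rule rtc_measurable_path[OF rc])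
  \<comment> \<open>Inserting 0 keeps the supremum meaningful when more than n jumps are already
    counted at time 0.\<close>
  define S where "S = insert 0 {s. 0 \<le> s \<and> s \<le> r \<and> jump_count lam y x s \<le> n}"
  define \<sigma> where "\<sigma> = Sup S"
  have S: "0 \<in> S" "bdd_above S" using Suc.prems by (auto simp: S_def bdd_above_def intro!: exI[of _ r])
  have \<sigma>0: "0 \<le> \<sigma>" unfolding \<sigma>_def by (intro cSup_upper S)
  have \<sigma>r: "\<sigma> \<le> r" unfolding \<sigma>_def using Suc.prems by (intro cSup_least) (auto simp: S_def)
  have below: "jump_count lam y x s \<le> n" if "0 \<le> s" "s < \<sigma>" for s
  proof -
    have "S \<noteq> {}" using S by auto
    moreover have "s < Sup S" using that by (simp add: \<sigma>_def)
    ultimately obtain s' where "s' \<in> S" "s < s'" by (metis less_cSupD)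
    then show ?thesis using jump_count_mono[of x s s' y, OF xm \<open>0 \<le> s\<close> _ y] that by (auto simp: S_def)
  qed
  \<comment> \<open>If the count were still at most n at \<sigma> < r, it would remain so for a
    while to the right, against the choice of \<sigma> as a supremum.\<close>
  have at: "n < jump_count lam y x \<sigma>" if "\<sigma> < r"
  proof (rule ccontr)
    assume "\<not> n < jump_count lam y x \<sigma>"
    moreover obtain d where d: "d > 0"
      "\<And>s. \<sigma> \<le> s \<Longrightarrow> s < \<sigma> + d \<Longrightarrow> jump_count lam y x s = jump_count lam y x \<sigma>"
      using jump_count_right_const[of x \<sigma> y, OF xm \<sigma>0 y rc] by blast
    define s where "s = min r (\<sigma> + d/2)"
    ultimately have "s \<in> S" "\<sigma> < s" using that \<sigma>0 d(2)[of s] d(1) by (auto simp: S_def s_def)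
    then show False unfolding \<sigma>_def using cSup_upper[OF _ S(2), of s] by simp
  qed
  have zx: "?z s = x s" if "0 \<le> s" "s < \<sigma>" for s
    using Suc.IH[of s] below[OF that] that \<sigma>r by simp
  have clk: "clock lam ?z k s = clock lam x k s" if "s \<le> \<sigma>" for s k
    using zx that by (intro clock_cong xm zm) auto
  have jc: "jump_count lam y ?z s = jump_count lam y x s" if "s \<le> \<sigma>" for s
    unfolding jump_count_def using clk[OF that] by simp
  \<comment> \<open>The count of stage \<open>n\<close> is at most n before \<sigma> and, if
    \<sigma> < t', larger from \<sigma> on, so the integral measures the time spent before
    \<sigma>.\<close>
  have cutoff: "jump_cutoff lam y n ?z t' = min t' \<sigma>" if t': "0 \<le> t'" "t' \<le> t" for t'
  proof -
    have le: "jump_count lam y ?z s \<le> n" if "0 \<le> s" "s < \<sigma>" for s using below[OF that] jc[of s] that by simp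
    have gt: "n < jump_count lam y ?z s" if "\<sigma> \<le> s" "\<sigma> < t'" for s
      using at jc[of \<sigma>] jump_count_mono[of ?z \<sigma> s y, OF zm \<sigma>0 \<open>\<sigma> \<le> s\<close> y] that t' Suc.prems by simp
    note [measurable] = rtc_measurable_path(3)[OF rc zm]
    have "jump_cutoff lam y n ?z t' = (LINT u|lborel. indicat_real {0..min t' \<sigma>} u)"
      unfolding jump_cutoff_def set_lebesgue_integral_def
    proof (rule integral_cong_AE)
      show "AE u in lborel. indicat_real {0..t'} u *\<^sub>R (if jump_count lam y ?z u \<le> n then 1 else 0) =
          indicat_real {0..min t' \<sigma>} u"
        using AE_lborel_singleton[of \<sigma>]
      proof eventually_elim
        case (elim u)
        then show ?case using le[of u] gt[of u] by (cases "u < \<sigma>") (auto split: split_indicator)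
      qed
    qed measurable
    also have "\<dots> = min t' \<sigma>" using t' \<sigma>0 by simp
    finally show ?thesis .
  qed
  show ?case
    unfolding rtc_approx.simps
  proof (rule ode_sol_eqI[OF f_lip f_bound xm rtc_measurable_path(2)[OF rc] _ \<open>0 \<le> t\<close> order_refl])
    fix t' assume t': "0 \<le> t'" "t' \<le> t"
    have "y k (clock lam ?z k (jump_cutoff lam y n ?z t')) = y k (clock lam x k t')" for k
    proof (cases "t' \<le> \<sigma>")
      case True
      then show ?thesis using cutoff[OF t'] clk[of t' k] by simp
    next
      case False
      \<comment> \<open>The count is at least n+1 at \<sigma> and at most n+1 at t', so no channel
        jumps in between and freezing the clocks at \<sigma> changes nothing.\<close>
      have "n < jump_count lam y x \<sigma>" using False t' Suc.prems by (intro at) simp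
      moreover have "jump_count lam y x t' \<le> Suc n"
        using jump_count_mono[of x t' t y, OF xm t' y] Suc.prems by simp
      ultimately have "y k (clock lam x k \<sigma>) = y k (clock lam x k t')"
        using False \<sigma>0 unfolding jump_count_def
        by (intro nat_sum_mono_eqD[where a = "\<lambda>k. y k (clock lam x k \<sigma>)"] monoD[OF y] clock_mono xm) auto
      then show ?thesis using cutoff[OF t'] clk[of \<sigma> k] False by simp
    qed
    then show "x t' = x0 + (\<Sum>k\<in>UNIV. real (y k (clock lam ?z k (jump_cutoff lam y n ?z t'))) *\<^sub>R \<nu> k) +
        (LBINT s:{0..t'}. f (x s))"
      using x t' Suc.prems by (simp add: rtc_path_def)
  qed
qed

end

section \<open>Dependence on a single channel\<close>

definition stop_channel :: "'k \<Rightarrow> real \<Rightarrow> ('k \<Rightarrow> real \<Rightarrow> nat) \<Rightarrow> 'k \<Rightarrow> real \<Rightarrow> nat" where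
  "stop_channel k s y j u = y j (if j = k then min u s else u)"

lemma mono_stop_channel:
  assumes "\<And>j. mono (y j)"
  shows "mono (stop_channel k s y j)"
  by (intro monoI) (auto simp: stop_channel_def intro!: monoD[OF assms])

lemma right_cont_stop_channel:
  assumes "\<And>j u. continuous (at_right u) (y j)"
  shows "continuous (at_right u) (stop_channel k s y j)"
proof (cases "j = k")
  case True
  have "\<forall>\<^sub>F v in at_right u. y j (min v s) = y j (min u s)"
  proof (cases "u < s")
    case True
    have "\<forall>\<^sub>F v in at_right u. y j v = y j u"
      using assms[of u j] unfolding continuous_within tendsto_discrete .
    moreover have "\<forall>\<^sub>F v in at_right u. v < s"
      using True by (auto simp: eventually_at_right_field)
    ultimately show ?thesis by eventually_elim (use True in simp)
  next
    case False
    have "\<forall>\<^sub>F v in at_right u. u < v" by (rule eventually_at_right_less)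
    then show ?thesis by eventually_elim (use False in simp)
  qed
  then show ?thesis
    using True unfolding continuous_within tendsto_discrete by (simp add: stop_channel_def)
qed (use assms in \<open>simp add: stop_channel_def[abs_def]\<close>)

text \<open>If the clock is at most s at t, stopping goes unnoticed, \<open>x\<close> solves the
  stopped equation and the approximate clocks are eventually exact. If it exceeds s, they are
  eventually exact at an earlier time where it equals s, and by monotonicity they are at least s at
  t. The second case relies on the strict inequality.\<close>

lemma (in rtc_data) clock_less_iff_stopped:
  assumes x: "rtc_path y x0 r x"
    and y: "\<And>k. mono (y k)" and rc: "\<And>k u. continuous (at_right u) (y k)"
    and t: "0 \<le> t" "t \<le> r" and s: "0 \<le> s"
  shows "clock lam x k t < s \<longleftrightarrow>
    (\<forall>\<^sub>F n in sequentially. clock lam (rtc_approx f lam \<nu> (stop_channel k s y) x0 n) k t < s)"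
proof -
  let ?y = "stop_channel k s y" let ?z = "rtc_approx f lam \<nu> ?y x0"
  have xm: "x \<in> borel_measurable borel" using x by (simp add: rtc_path_def)
  have y': "\<And>j. mono (?y j)" and rc': "\<And>j u. continuous (at_right u) (?y j)"
    by (intro mono_stop_channel right_cont_stop_channel y rc)+
  have zm: "?z n \<in> borel_measurable borel" for n by (rule rtc_measurable_path[OF rc'])
  have ev: "\<forall>\<^sub>F n in sequentially. clock lam (?z n) k t0 = clock lam x k t0"
    if t0: "0 \<le> t0" "t0 \<le> t" and le: "clock lam x k t0 \<le> s" for t0
  proof -
    have "rtc_path ?y x0 t0 x"
      unfolding rtc_path_def
    proof (intro conjI xm allI impI)
      fix u assume u: "0 \<le> u" "u \<le> t0"
      have "clock lam x k u \<le> s" using clock_mono[of x u t0 k, OF xm u] le by simp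
      \<comment> \<open>Up to t0 channel k is read at internal times at most s only, where it agrees
        with its stopped version.\<close>
      then have "?y j (clock lam x j u) = y j (clock lam x j u)" for j
        by (simp add: stop_channel_def min_absorb1)
      then show "x u = x0 + (LBINT s:{0..u}. f (x s)) + (\<Sum>k\<in>UNIV. real (?y k (clock lam x k u)) *\<^sub>R \<nu> k)"
        using x u t t0 by (simp add: rtc_path_def)
    qed
    note eq = rtc_approx_eq[OF this y' rc']
    have "clock lam (?z n) k t0 = clock lam x k t0" if n: "jump_count lam ?y x t0 \<le> n" for n
    proof (rule clock_cong[OF xm zm])
      fix u assume u: "0 \<le> u" "u < t0"
      then show "?z n u = x u" using jump_count_mono[of x u t0 ?y, OF xm _ _ y'] n
        by (intro eq) auto
    qed
    then show ?thesis by (auto simp: eventually_sequentially)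
  qed
  show ?thesis
  proof (cases "clock lam x k t \<le> s")
    case True
    note e = ev[OF t(1) order_refl True]
    show ?thesis
    proof
      assume "clock lam x k t < s"
      with e show "\<forall>\<^sub>F n in sequentially. clock lam (?z n) k t < s" by (auto elim: eventually_mono)
    next
      assume "\<forall>\<^sub>F n in sequentially. clock lam (?z n) k t < s"
      with e have "\<forall>\<^sub>F n in sequentially. clock lam x k t < s" by eventually_elim simp
      then show "clock lam x k t < s" by simp
    qed
  next
    case False
    have "continuous_on {0..t} (clock lam x k)"
      using continuous_on_clock[OF xm] by (rule continuous_on_subset) auto
    then obtain t0 where t0: "0 \<le> t0" "t0 \<le> t" "clock lam x k t0 = s"
      using IVT'[of "clock lam x k" 0 s t] t s False by auto
    have "\<forall>\<^sub>F n in sequentially. \<not> clock lam (?z n) k t < s"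
      using ev[OF t0(1,2) eq_refl[OF t0(3)]]
    proof eventually_elim
      case (elim n)
      then show ?case using clock_mono[OF zm t0(1,2), of n k] t0(3) by simp
    qed
    then have "\<not> (\<forall>\<^sub>F n in sequentially. clock lam (?z n) k t < s)"
      using eventually_conj[of "\<lambda>n. \<not> clock lam (?z n) k t < s" sequentially "\<lambda>n. clock lam (?z n) k t < s"] by auto
    with False show ?thesis by simp
  qed
qed

section \<open>The scheme as a functional of one sample path\<close>

locale scheme_data =
  fixes \<phi>1 :: "'a::euclidean_space \<Rightarrow> 'a \<Rightarrow> 'a" and \<phi>3 :: "'k::finite \<Rightarrow> 'a \<Rightarrow> real" and \<nu> :: "'k \<Rightarrow> 'a"
    and h L1 L2 :: real and L3 :: "'k \<Rightarrow> real"
  assumes h_pos: "0 < h" and L1_nonneg: "0 \<le> L1" and L2_nonneg: "0 \<le> L2" and L3_nonneg: "\<And>k. 0 \<le> L3 k"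
    and h_L2: "h * L2 < 1"
    and \<phi>1_lip: "\<And>x1 x2 y1 y2. norm (\<phi>1 x1 y1 - \<phi>1 x2 y2) \<le> L1 * norm (x1 - x2) + L2 * norm (y1 - y2)"
    and \<phi>3_lip: "\<And>k x1 x2. \<bar>\<phi>3 k x1 - \<phi>3 k x2\<bar> \<le> L3 k * norm (x1 - x2)"
    and \<phi>3_nonneg: "\<And>k x. 0 \<le> \<phi>3 k x"
begin

text \<open>The part \<open>v\<close> of the new state that is known beforehand is kept apart from
  the old state \<open>x\<close> inside \<phi>1; the step is then Lipschitz in the pair, hence
  measurable.\<close>

definition implicit_step :: "'a \<Rightarrow> 'a \<Rightarrow> 'a" where
  "implicit_step x v = (SOME w. w = v + h *\<^sub>R \<phi>1 x w)"

text \<open>The term h L2 |w1 - w2| of the Lipschitz bound is moved to the left. With equal data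
  this gives uniqueness of the step, with different data its Lipschitz continuity.\<close>

lemma implicit_step_estimate:
  assumes "w1 = v1 + h *\<^sub>R \<phi>1 x1 w1" "w2 = v2 + h *\<^sub>R \<phi>1 x2 w2"
  shows "(1 - h * L2) * norm (w1 - w2) \<le> norm (v1 - v2) + h * L1 * norm (x1 - x2)"
proof -
  have "w1 - w2 = (v1 - v2) + h *\<^sub>R (\<phi>1 x1 w1 - \<phi>1 x2 w2)"
    by (subst (1) assms(1), subst (1) assms(2)) (simp add: algebra_simps)
  also have "norm \<dots> \<le> norm (v1 - v2) + h * norm (\<phi>1 x1 w1 - \<phi>1 x2 w2)"
    using norm_triangle_ineq[of "v1 - v2" "h *\<^sub>R (\<phi>1 x1 w1 - \<phi>1 x2 w2)"] h_pos by simp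
  also have "\<dots> \<le> norm (v1 - v2) + h * (L1 * norm (x1 - x2) + L2 * norm (w1 - w2))"
    using h_pos \<phi>1_lip by (intro add_left_mono mult_left_mono) auto
  finally show ?thesis by (simp add: algebra_simps)
qed

lemma implicit_step_ex: "\<exists>w. w = v + h *\<^sub>R \<phi>1 x w"
proof -
  have "\<exists>!w. v + h *\<^sub>R \<phi>1 x w = w"
  proof (rule banach_fix_type)
    show "0 \<le> h * L2" "h * L2 < 1" using h_pos L2_nonneg h_L2 by auto
    show "\<forall>w1 w2. dist (v + h *\<^sub>R \<phi>1 x w1) (v + h *\<^sub>R \<phi>1 x w2) \<le> h * L2 * dist w1 w2"
      using h_pos \<phi>1_lip[of x _ x]
      by (auto simp: dist_norm scaleR_diff_right[symmetric] intro: mult_left_mono)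
  qed
  then show ?thesis by metis
qed

lemma implicit_step: "implicit_step x v = v + h *\<^sub>R \<phi>1 x (implicit_step x v)"
  unfolding implicit_step_def by (rule someI_ex[OF implicit_step_ex])

lemma implicit_step_unique:
  assumes "w = v + h *\<^sub>R \<phi>1 x w"
  shows "w = implicit_step x v"
  using implicit_step_estimate[OF assms implicit_step[of x v]] h_L2 by (simp add: mult_le_0_iff)

text \<open>The reason why a solution picked by \<open>SOME\<close> depends measurably on the sample
  point.\<close>

lemma continuous_implicit_step: "continuous_on UNIV (\<lambda>p. implicit_step (fst p) (snd p))"
proof (rule lipschitz_on_continuous_on[of "(1 + h * L1) / (1 - h * L2)"], rule lipschitz_onI)
  fix p q :: "'a \<times> 'a"
  let ?w = "\<lambda>p. implicit_step (fst p) (snd p)"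
  have "(1 - h * L2) * norm (?w p - ?w q) \<le> norm (snd p - snd q) + h * L1 * norm (fst p - fst q)"
    by (intro implicit_step_estimate implicit_step)
  also have "\<dots> \<le> norm (p - q) + h * L1 * norm (p - q)"
    using norm_fst_le[of "fst p - fst q" "snd p - snd q"] norm_snd_le[of "snd p - snd q" "fst p - fst q"] h_pos L1_nonneg
    by (intro add_mono mult_left_mono) (auto simp: minus_prod_def)
  finally show "dist (?w p) (?w q) \<le> (1 + h * L1) / (1 - h * L2) * dist p q"
    using h_L2 by (simp add: dist_norm field_simps)
qed (use h_pos L1_nonneg h_L2 in simp)

primrec scheme :: "('k \<Rightarrow> real \<Rightarrow> nat) \<Rightarrow> 'a \<Rightarrow> nat \<Rightarrow> 'a \<times> ('k \<Rightarrow> real)" where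
  "scheme y x0 0 = (x0, \<lambda>_. 0)"
| "scheme y x0 (Suc n) = (let (x, \<tau>) = scheme y x0 n in
     (implicit_step x (x + (\<Sum>k\<in>UNIV. (real (y k (\<tau> k + h * \<phi>3 k x)) - real (y k (\<tau> k))) *\<^sub>R \<nu> k)),
      \<lambda>k. \<tau> k + h * \<phi>3 k x))"

lemma scheme_clock_nonneg: "0 \<le> snd (scheme y x0 n) k"
  by (induction n) (auto simp: case_prod_beta' Let_def h_pos less_imp_le \<phi>3_nonneg)

text \<open>The clock of channel k is nondecreasing, so if it has not passed s by step n, no earlier
  step has read that channel beyond s.\<close>

lemma scheme_local:
  assumes agree: "\<And>j u. j \<noteq> k \<or> u \<le> s \<Longrightarrow> y j u = y' j u"
    and "snd (scheme y x0 n) k \<le> s"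
  shows "scheme y x0 n = scheme y' x0 n"
  using assms(2)
proof (induction n)
  case (Suc n)
  obtain x \<tau> where x: "scheme y x0 n = (x, \<tau>)" by force
  have le: "\<tau> k + h * \<phi>3 k x \<le> s" using Suc.prems x by simp
  moreover have "0 \<le> h * \<phi>3 k x" using h_pos \<phi>3_nonneg by simp
  ultimately have le': "\<tau> k \<le> s" by linarith
  then have eq: "scheme y' x0 n = (x, \<tau>)" using Suc.IH x by simp
  have "y j (\<tau> j + h * \<phi>3 j x) = y' j (\<tau> j + h * \<phi>3 j x)" "y j (\<tau> j) = y' j (\<tau> j)" for j
    using agree le le' by metis+
  then show ?case using x eq by simp
qed simp

text \<open>Whichever of the two clocks is below s, its recursion has read only values on which both
  drivers agree, so the recursions coincide. Hence locality is used in both directions.\<close>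

lemma scheme_clock_less_iff_stopped:
  "snd (scheme y x0 n) k < s \<longleftrightarrow> snd (scheme (stop_channel k s y) x0 n) k < s"
proof -
  have "y j u = stop_channel k s y j u" if "j \<noteq> k \<or> u \<le> s" for j u
    using that by (auto simp: stop_channel_def)
  then show ?thesis
    using scheme_local[of k s y "stop_channel k s y" x0 n] scheme_local[of k s "stop_channel k s y" y x0 n]
    by (metis less_imp_le)
qed

lemma measurable_scheme:
  assumes y: "\<And>k. (\<lambda>(w, u). y w k u) \<in> measurable (N \<Otimes>\<^sub>M borel) (count_space UNIV)"
    and x0: "x0 \<in> borel_measurable N"
  shows "(\<lambda>w. fst (scheme (y w) (x0 w) n)) \<in> borel_measurable N"
    and "(\<lambda>w. snd (scheme (y w) (x0 w) n) k) \<in> borel_measurable N"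
proof -
  have [measurable]: "\<phi>3 k \<in> borel_measurable borel" for k
    by (intro borel_measurable_continuous_onI lipschitz_on_continuous_on[of "L3 k"] lipschitz_onI)
       (use \<phi>3_lip L3_nonneg in \<open>auto simp: dist_norm\<close>)
  have step: "(\<lambda>p. implicit_step (fst p) (snd p)) \<in> borel_measurable (borel \<Otimes>\<^sub>M borel)"
    unfolding borel_prod by (intro borel_measurable_continuous_onI continuous_implicit_step)
  have y': "(\<lambda>w. y w k (u w)) \<in> measurable N (count_space UNIV)" if "u \<in> borel_measurable N" for u k
    using measurable_compose[OF measurable_Pair[OF measurable_ident that] y] by simp
  have "(\<lambda>w. fst (scheme (y w) (x0 w) n)) \<in> borel_measurable N \<and>
    (\<forall>k. (\<lambda>w. snd (scheme (y w) (x0 w) n) k) \<in> borel_measurable N)"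
  proof (induction n)
    case (Suc n)
    then have [measurable]: "(\<lambda>w. fst (scheme (y w) (x0 w) n)) \<in> borel_measurable N"
      "\<And>k. (\<lambda>w. snd (scheme (y w) (x0 w) n) k) \<in> borel_measurable N" by auto
    have [measurable]: "(\<lambda>w. y w k (snd (scheme (y w) (x0 w) n) k)) \<in> measurable N (count_space UNIV)"
       "(\<lambda>w. y w k (snd (scheme (y w) (x0 w) n) k + h * \<phi>3 k (fst (scheme (y w) (x0 w) n))))
         \<in> measurable N (count_space UNIV)" for k
      by (rule y'; measurable)+
    have "(\<lambda>w. (fst (scheme (y w) (x0 w) n), fst (scheme (y w) (x0 w) n) +
        (\<Sum>k\<in>UNIV. (real (y w k (snd (scheme (y w) (x0 w) n) k + h * \<phi>3 k (fst (scheme (y w) (x0 w) n)))) -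
           real (y w k (snd (scheme (y w) (x0 w) n) k))) *\<^sub>R \<nu> k))) \<in> N \<rightarrow>\<^sub>M borel \<Otimes>\<^sub>M borel"
      by measurable
    from measurable_compose[OF this step] show ?case
      by (auto simp: case_prod_beta' Let_def)
  qed (use x0 in auto)
  then show "(\<lambda>w. fst (scheme (y w) (x0 w) n)) \<in> borel_measurable N"
    "(\<lambda>w. snd (scheme (y w) (x0 w) n) k) \<in> borel_measurable N" by auto
qed

end

section \<open>The past of a channel\<close>

definition path_event :: "'w measure \<Rightarrow> (real \<Rightarrow> 'w \<Rightarrow> nat) \<Rightarrow> real set \<Rightarrow> (real \<Rightarrow> nat) \<Rightarrow> 'w set" where
  "path_event M Y J c = {\<omega>\<in>space M. \<forall>u\<in>J. Y u \<omega> = c u}"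

context prob_space begin

text \<open>Values prescribed at finitely many times amount to increments prescribed between
  consecutive times, once 0 is added to the times; independent increments separate these from the
  increment over [s, s']. The translation is valid almost surely, as \<open>Y\<close> starts in 0
  and is nondecreasing almost surely.\<close>

lemma poisson_past_indep:
  assumes Y: "poisson_process M Y" and J: "finite J" "J \<subseteq> {0..s}" and s: "0 \<le> s" "s < s'"
  shows "prob (path_event M Y J c \<inter> {\<omega>\<in>space M. Y s' \<omega> - Y s \<omega> \<in> S}) =
    prob (path_event M Y J c) * prob {\<omega>\<in>space M. Y s' \<omega> - Y s \<omega> \<in> S}"
proof -
  have Ym[measurable]: "0 \<le> t \<Longrightarrow> Y t \<in> measurable M (count_space UNIV)" for t
    using Y by (simp add: poisson_process_def)
  have ae: "AE \<omega> in M. Y 0 \<omega> = 0 \<and> mono_on {0..} (\<lambda>t. Y t \<omega>)"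
    using Y by (auto simp: poisson_process_def)
  have inc: "indep_vars (\<lambda>_. count_space UNIV) (\<lambda>i \<omega>. Y (t (Suc i)) \<omega> - Y (t i) \<omega>) {..<n}"
    if "0 \<le> t 0" "mono t" for t :: "nat \<Rightarrow> real" and n
    using Y that by (simp add: poisson_process_def)
  have Em: "path_event M Y J c \<in> sets M"
    unfolding path_event_def
  proof (rule sets.sets_Collect_finite_All)
    fix u assume "u \<in> J"
    then have [measurable]: "Y u \<in> measurable M (count_space UNIV)" using J by auto
    show "{\<omega>\<in>space M. Y u \<omega> = c u} \<in> sets M" by measurable
  qed (use J in simp)
  have Fm: "{\<omega>\<in>space M. Y s' \<omega> - Y s \<omega> \<in> S} \<in> sets M"
  proof -
    have [measurable]: "Y s' \<in> measurable M (count_space UNIV)" "Y s \<in> measurable M (count_space UNIV)"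
      using s by auto
    show ?thesis by measurable
  qed
  show ?thesis
  proof (cases "0 \<in> J \<and> c 0 \<noteq> 0")
    case True
    have "prob (path_event M Y J c) = 0"
    proof -
      have "AE \<omega> in M. \<omega> \<notin> path_event M Y J c"
        using ae by eventually_elim (use True in \<open>auto simp: path_event_def intro!: bexI[of _ 0]\<close>)
      then show ?thesis using Em by (simp add: prob_eq_0)
    qed
    moreover have "prob (path_event M Y J c \<inter> {\<omega>\<in>space M. Y s' \<omega> - Y s \<omega> \<in> S}) \<le> prob (path_event M Y J c)"
      using Em by (intro finite_measure_mono) auto
    ultimately show ?thesis by (simp add: measure_le_0_iff)
  next
    case False
    define l where "l = sorted_list_of_set (insert 0 J)"
    define n where "n = length l"
    \<comment> \<open>The time 0 joins the list with value 0; a different prescription at 0 is the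
      null case settled before.\<close>
    define c' where "c' = c(0 := 0)"
    \<comment> \<open>After the n listed times come s and s'. Increment n is thus the one over
      [s, s'], and increment n-1 bridges the last listed time and s; the sets \<open>A\<close> leave
      the latter free.\<close>
    define t where "t i = (if i < n then l ! i else if i = n then s else s')" for i
    have set_l: "set l = insert 0 J" unfolding l_def using J by (intro set_sorted_list_of_set) simp
    have sorted: "sorted l" unfolding l_def by (rule sorted_sorted_list_of_set)
    have n0: "0 < n" using set_l by (auto simp: n_def)
    have l_range: "i < n \<Longrightarrow> l ! i \<in> {0..s}" for i
      using nth_mem[of i l] set_l J s by (auto simp: n_def)
    obtain i0 where i0: "i0 < n" "l ! i0 = 0" using set_l by (metis in_set_conv_nth insertI1 n_def)
    have l0: "l ! 0 = 0"
      using sorted_nth_mono[OF sorted, of 0 i0] i0 l_range[OF n0] by (auto simp: n_def)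
    have t0: "t 0 = 0" using n0 l0 by (simp add: t_def)
    have tpos: "0 \<le> t i" for i using l_range[of i] s by (auto simp: t_def)
    have tmono: "mono t"
    proof (rule monoI)
      fix i j :: nat assume "i \<le> j"
      then show "t i \<le> t j"
        using sorted_nth_mono[OF sorted, of i j] l_range[of i] s by (auto simp: t_def n_def)
    qed
    define X where "X i \<omega> = Y (t (Suc i)) \<omega> - Y (t i) \<omega>" for i \<omega>
    define A where "A S i = (if Suc i < n then {d. c' (t i) + d = c' (t (Suc i))}
       else if i = n then S else UNIV)" for S :: "nat set" and i
    define D where "D S = (\<Inter>i\<in>{..<Suc n}. X i -` A S i \<inter> space M)" for S
    have iX: "indep_vars (\<lambda>_. count_space UNIV) X {..<Suc n}"
      unfolding X_def[abs_def] by (rule inc) (use t0 tmono in auto)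
    have Xm: "X i \<in> measurable M (count_space UNIV)" if "i < Suc n" for i
      using iX that by (auto simp: indep_vars_def)
    have Dm: "D S \<in> sets M" for S
      unfolding D_def by (rule sets.countable_INT') (auto intro!: measurable_sets[OF Xm])
    have prodD: "prob (D S) = (\<Prod>i<n. prob (X i -` A UNIV i \<inter> space M)) * prob (X n -` S \<inter> space M)" for S
    proof -
      have "prob (D S) = (\<Prod>i<Suc n. prob (X i -` A S i \<inter> space M))"
        unfolding D_def by (rule indep_varsD[OF iX]) auto
      also have "\<dots> = (\<Prod>i<n. prob (X i -` A S i \<inter> space M)) * prob (X n -` S \<inter> space M)"
        by (simp add: A_def)
      also have "(\<Prod>i<n. prob (X i -` A S i \<inter> space M)) = (\<Prod>i<n. prob (X i -` A UNIV i \<inter> space M))"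
        by (intro prod.cong) (auto simp: A_def)
      finally show ?thesis .
    qed
    have Xn: "X n -` S \<inter> space M = {\<omega>\<in>space M. Y s' \<omega> - Y s \<omega> \<in> S}" for S
      by (auto simp: X_def t_def)
    \<comment> \<open>Subtraction on nat truncates at 0, so the increments determine the values only
      along a nondecreasing path.\<close>
    have key: "\<omega> \<in> path_event M Y J c \<longleftrightarrow> (\<forall>i. Suc i < n \<longrightarrow> X i \<omega> \<in> A S i)"
      if \<omega>: "\<omega> \<in> space M" "Y 0 \<omega> = 0" "mono_on {0..} (\<lambda>t. Y t \<omega>)" for \<omega> S
    proof -
      have "\<omega> \<in> path_event M Y J c \<longleftrightarrow> (\<forall>u\<in>insert 0 J. Y u \<omega> = c' u)"
        using \<omega> False by (auto simp: path_event_def c'_def)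
      also have "\<dots> \<longleftrightarrow> (\<forall>i<n. Y (l ! i) \<omega> = c' (l ! i))"
        unfolding set_l[symmetric] n_def by (auto simp: all_set_conv_all_nth)
      also have "\<dots> \<longleftrightarrow> (\<forall>i<n. Y (t i) \<omega> = c' (t i))" by (simp add: t_def)
      also have "\<dots> \<longleftrightarrow> (\<forall>i. Suc i < n \<longrightarrow> X i \<omega> \<in> A S i)"
      proof safe
        fix i assume "\<forall>i<n. Y (t i) \<omega> = c' (t i)" "Suc i < n"
        moreover have "Y (t i) \<omega> \<le> Y (t (Suc i)) \<omega>"
          using \<omega>(3) tpos by (intro mono_onD[OF \<omega>(3)] monoD[OF tmono]) auto
        ultimately show "X i \<omega> \<in> A S i" by (simp add: X_def A_def)
      next
        fix i assume *: "\<forall>i. Suc i < n \<longrightarrow> X i \<omega> \<in> A S i" and "i < n"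
        show "Y (t i) \<omega> = c' (t i)" using \<open>i < n\<close>
        proof (induction i)
          case 0 then show ?case using \<omega> t0 by (simp add: c'_def)
        next
          case (Suc i)
          moreover have "Y (t i) \<omega> \<le> Y (t (Suc i)) \<omega>"
            using tpos by (intro mono_onD[OF \<omega>(3)] monoD[OF tmono]) auto
          ultimately show ?case using *[rule_format, of i] by (simp add: X_def A_def)
        qed
      qed
      finally show ?thesis .
    qed
    have D_iff: "\<omega> \<in> D S \<longleftrightarrow> (\<forall>i. Suc i < n \<longrightarrow> X i \<omega> \<in> A S i) \<and> Y s' \<omega> - Y s \<omega> \<in> S" if "\<omega> \<in> space M" for \<omega> S
      using that Xn[of S] by (auto simp: D_def A_def less_Suc_eq split: if_splits)
    have e1: "prob (path_event M Y J c \<inter> {\<omega>\<in>space M. Y s' \<omega> - Y s \<omega> \<in> S}) = prob (D S)"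
    proof (rule finite_measure_eq_AE)
      show "AE \<omega> in M. \<omega> \<in> path_event M Y J c \<inter> {\<omega>\<in>space M. Y s' \<omega> - Y s \<omega> \<in> S} \<longleftrightarrow> \<omega> \<in> D S"
        using ae AE_space by eventually_elim (use key[of _ S] D_iff[of _ S] in auto)
    qed (use Em Fm Dm in auto)
    have e2: "prob (path_event M Y J c) = prob (D UNIV)"
    proof (rule finite_measure_eq_AE)
      show "AE \<omega> in M. \<omega> \<in> path_event M Y J c \<longleftrightarrow> \<omega> \<in> D UNIV"
        using ae AE_space by eventually_elim (use key[of _ UNIV] D_iff[of _ UNIV] in auto)
    qed (use Em Dm in auto)
    show ?thesis unfolding e1 e2 prodD Xn by (simp add: prob_space)
  qed
qed

lemma path_event_Int: "\<exists>c''. path_event M Y J c \<inter> path_event M Y J' c' = path_event M Y (J \<union> J') c'' \<or>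
    path_event M Y J c \<inter> path_event M Y J' c' = {}"
proof (cases "\<exists>u\<in>J \<inter> J'. c u \<noteq> c' u")
  case True
  then show ?thesis by (auto simp: path_event_def)
next
  case False
  then have "path_event M Y J c \<inter> path_event M Y J' c' = path_event M Y (J \<union> J') (\<lambda>u. if u \<in> J then c u else c' u)"
    by (auto simp: path_event_def)
  then show ?thesis by blast
qed

text \<open>The empty set is added because two events that prescribe different values at a common
  time have empty intersection.\<close>

definition path_pi_system :: "(real \<Rightarrow> 'a \<Rightarrow> nat) \<Rightarrow> real \<Rightarrow> 'a set set" where
  "path_pi_system Y s = insert {} {path_event M Y J c | J c. finite J \<and> J \<subseteq> {0..s}}"

definition other_channels :: "('k \<Rightarrow> real \<Rightarrow> 'a \<Rightarrow> nat) \<Rightarrow> 'k \<Rightarrow> 'a measure" where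
  "other_channels Y k = vimage_algebra (space M) (\<lambda>\<omega>. \<lambda>j\<in>-{k}. \<lambda>t\<in>{0..}. Y j t \<omega>)
     (PiM (-{k}) (\<lambda>_. PiM {0..} (\<lambda>_. count_space UNIV)))"

text \<open>Their inclusion lets the past distinguish the almost sure set of regular sample points
  from its complement.\<close>

definition trivial_events :: "'a set set" where
  "trivial_events = {z \<in> events. prob z = 0 \<or> prob z = 1}"

text \<open>One event from each source of information: the intersections are closed under
  intersection, and independence can be verified on them factor by factor.\<close>

definition past_pi_system ::
  "('k \<Rightarrow> real \<Rightarrow> 'a \<Rightarrow> nat) \<Rightarrow> ('a \<Rightarrow> 'b::topological_space) \<Rightarrow> 'k \<Rightarrow> real \<Rightarrow> 'a set set" where
  "past_pi_system Y X0 k s = {a \<inter> e \<inter> c \<inter> z | a e c z.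
     a \<in> sets (vimage_algebra (space M) X0 borel) \<and> e \<in> path_pi_system (Y k) s \<and>
     c \<in> sets (other_channels Y k) \<and> z \<in> trivial_events}"

text \<open>What is known when channel \<open>k\<close> has been observed up to its internal time \<open>s\<close> and all the
  other channels have been observed completely, augmented by the events of probability 0 or 1.\<close>

definition channel_past ::
  "('k \<Rightarrow> real \<Rightarrow> 'a \<Rightarrow> nat) \<Rightarrow> ('a \<Rightarrow> 'b::topological_space) \<Rightarrow> 'k \<Rightarrow> real \<Rightarrow> 'a measure" where
  "channel_past Y X0 k s = sigma (space M) (past_pi_system Y X0 k s)"

lemma space_other_channels[simp]: "space (other_channels Y k) = space M"
  by (simp add: other_channels_def)

lemma path_pi_system_Int:
  assumes "e \<in> path_pi_system Y s" "e' \<in> path_pi_system Y s"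
  shows "e \<inter> e' \<in> path_pi_system Y s"
proof (cases "e = {} \<or> e' = {}")
  case False
  then obtain J c J' c' where e: "e = path_event M Y J c" "finite J" "J \<subseteq> {0..s}"
    "e' = path_event M Y J' c'" "finite J'" "J' \<subseteq> {0..s}"
    using assms by (auto simp: path_pi_system_def)
  moreover have "finite (J \<union> J')" "J \<union> J' \<subseteq> {0..s}" using e by auto
  moreover obtain c'' where "e \<inter> e' = path_event M Y (J \<union> J') c'' \<or> e \<inter> e' = {}"
    using path_event_Int[of Y J c J' c'] e by metis
  ultimately show ?thesis unfolding path_pi_system_def
  proof (elim disjE)
    assume "e \<inter> e' = path_event M Y (J \<union> J') c''"
    with \<open>finite (J \<union> J')\<close> \<open>J \<union> J' \<subseteq> {0..s}\<close>
    show "e \<inter> e' \<in> insert {} {path_event M Y J c |J c. finite J \<and> J \<subseteq> {0..s}}"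
      by (intro insertI2 CollectI exI conjI)
  qed simp
qed (auto simp: path_pi_system_def)

lemma trivial_events_Int:
  assumes "z \<in> trivial_events" "z' \<in> trivial_events"
  shows "z \<inter> z' \<in> trivial_events"
proof -
  have ev: "z \<in> events" "z' \<in> events" using assms by (auto simp: trivial_events_def)
  consider "prob z = 0" | "prob z' = 0" | "prob z = 1" "prob z' = 1"
    using assms by (auto simp: trivial_events_def)
  then have "prob (z \<inter> z') = 0 \<or> prob (z \<inter> z') = 1"
  proof cases
    case 1
    then show ?thesis using finite_measure_mono[of "z \<inter> z'" z] ev by (simp add: measure_le_0_iff)
  next
    case 2
    then show ?thesis using finite_measure_mono[of "z \<inter> z'" z'] ev by (simp add: measure_le_0_iff)
  next
    case 3
    then have "AE x in M. x \<in> z" "AE x in M. x \<in> z'" by (auto intro: AE_prob_1)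
    then have "AE x in M. x \<in> z \<inter> z'" by eventually_elim simp
    then show ?thesis using ev by (simp add: prob_eq_1)
  qed
  then show ?thesis using ev by (simp add: trivial_events_def)
qed

lemma Int_stable_past_pi_system: "Int_stable (past_pi_system Y X0 k s)"
proof (rule Int_stableI)
  fix A A' assume "A \<in> past_pi_system Y X0 k s" "A' \<in> past_pi_system Y X0 k s"
  then obtain a e c z a' e' c' z' where
    A: "A = a \<inter> e \<inter> c \<inter> z" "A' = a' \<inter> e' \<inter> c' \<inter> z'" and
    m: "a \<in> sets (vimage_algebra (space M) X0 borel)" "e \<in> path_pi_system (Y k) s"
      "c \<in> sets (other_channels Y k)" "z \<in> trivial_events"
      "a' \<in> sets (vimage_algebra (space M) X0 borel)" "e' \<in> path_pi_system (Y k) s"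
      "c' \<in> sets (other_channels Y k)" "z' \<in> trivial_events"
    unfolding past_pi_system_def by blast
  have "A \<inter> A' = (a \<inter> a') \<inter> (e \<inter> e') \<inter> (c \<inter> c') \<inter> (z \<inter> z')" using A by auto
  then show "A \<inter> A' \<in> past_pi_system Y X0 k s"
    unfolding past_pi_system_def mem_Collect_eq
    using sets.Int[OF m(1,5)] path_pi_system_Int[OF m(2,6)] sets.Int[OF m(3,7)] trivial_events_Int[OF m(4,8)]
    by (intro exI conjI)
qed

lemma path_event_events:
  assumes "finite J" "J \<subseteq> {0..s}" "\<And>t. 0 \<le> t \<Longrightarrow> Y t \<in> measurable L (count_space UNIV)" "space L = space M"
  shows "path_event M Y J c \<in> sets L"
  unfolding path_event_def assms(4)[symmetric]
proof (rule sets.sets_Collect_finite_All)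
  fix u assume "u \<in> J"
  then have [measurable]: "Y u \<in> measurable L (count_space UNIV)" using assms by auto
  show "{\<omega>\<in>space L. Y u \<omega> = c u} \<in> sets L" by measurable
qed (use assms in simp)

section \<open>Independence of the past of a channel from its later increments\<close>

context
  fixes Y :: "'k::finite \<Rightarrow> real \<Rightarrow> 'a \<Rightarrow> nat" and X0 :: "'a \<Rightarrow> real ^ 'd"
  assumes Y: "indep_poisson_processes M Y" and X0: "indep_of_processes M Y X0"
begin

lemma Y_measurable: "0 \<le> t \<Longrightarrow> Y k t \<in> measurable M (count_space UNIV)"
  using Y by (simp add: indep_poisson_processes_def poisson_process_def)

text \<open>The factors are split off one by one: the event of probability 0 or 1 by itself, the
  initial value by its independence of all processes, the other channels by the independence of the
  channels, and the past of channel k by independent increments.\<close>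

lemma past_pi_system_indep:
  assumes A: "A \<in> past_pi_system Y X0 k s" and s: "0 \<le> s" "s < s'"
  shows "A \<in> events"
    and "prob (A \<inter> {\<omega>\<in>space M. Y k s' \<omega> - Y k s \<omega> \<in> S}) = prob A * prob {\<omega>\<in>space M. Y k s' \<omega> - Y k s \<omega> \<in> S}"
proof -
  let ?F = "\<lambda>S. {\<omega>\<in>space M. Y k s' \<omega> - Y k s \<omega> \<in> S}"
  let ?full = "vimage_algebra (space M) (\<lambda>\<omega>. \<lambda>(k, t)\<in>UNIV \<times> {0..}. Y k t \<omega>)
          (PiM (UNIV \<times> {0..}) (\<lambda>_. count_space UNIV))"
  obtain a e c z where A_eq: "A = a \<inter> e \<inter> c \<inter> z" and a: "a \<in> sets (vimage_algebra (space M) X0 borel)"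
    and e: "e \<in> path_pi_system (Y k) s" and c: "c \<in> sets (other_channels Y k)" and z: "z \<in> trivial_events"
    using A unfolding past_pi_system_def by blast
  have full_space: "space ?full = space M" by simp
  note ind = X0[unfolded indep_of_processes_def]
  have full_ev: "sets ?full \<subseteq> events" by (rule indep_setD_ev2[OF ind])
  have a_ev: "a \<in> events" using indep_setD_ev1[OF ind] a by (rule subsetD)
  have full_meas: "Y j t \<in> measurable ?full (count_space UNIV)" if "0 \<le> t" for j t
  proof -
    have "(\<lambda>\<omega>. \<lambda>(k, t)\<in>UNIV \<times> {0..}. Y k t \<omega>) \<in> measurable ?full (PiM (UNIV \<times> {0..}) (\<lambda>_. count_space UNIV))"
      by (intro measurable_vimage_algebra1) (auto simp: space_PiM)
    from measurable_compose[OF this measurable_component_singleton[of "(j, t)"]] that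
    show ?thesis by simp
  qed
  have e_full: "e \<in> sets ?full"
  proof (cases "e = {}")
    case False
    then obtain J d where "e = path_event M (Y k) J d" "finite J" "J \<subseteq> {0..s}"
      using e by (auto simp: path_pi_system_def)
    then show ?thesis using path_event_events[where L = ?full and J = J and s = s and Y = "Y k" and c = d, OF _ _ full_meas full_space] by simp
  qed simp
  have F_full: "?F S \<in> sets ?full" for S
  proof -
    have [measurable]: "Y k s \<in> measurable ?full (count_space UNIV)" "Y k s' \<in> measurable ?full (count_space UNIV)"
      using s by (auto intro!: full_meas)
    have "{\<omega>\<in>space ?full. Y k s' \<omega> - Y k s \<omega> \<in> S} \<in> sets ?full" by measurable
    then show ?thesis by simp
  qed
  let ?M' = "\<lambda>_. PiM {0..} (\<lambda>_. count_space (UNIV :: nat set))"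
  let ?path = "\<lambda>j \<omega>. \<lambda>t\<in>{0..}. Y j t \<omega>"
  have c_space: "(\<lambda>\<omega>. \<lambda>j\<in>-{k}. ?path j \<omega>) \<in> space M \<rightarrow> space (PiM (-{k}) ?M')"
    by (auto simp: space_PiM)
  obtain Q where Q: "Q \<in> sets (PiM (-{k}) ?M')" and c_eq: "c = (\<lambda>\<omega>. \<lambda>j\<in>-{k}. ?path j \<omega>) -` Q \<inter> space M"
    using c unfolding other_channels_def sets_vimage_algebra2[OF c_space] by auto
  have c_full: "c \<in> sets ?full"
  proof -
    have "(\<lambda>\<omega>. \<lambda>j\<in>-{k}. ?path j \<omega>) \<in> measurable ?full (PiM (-{k}) ?M')"
      by (intro measurable_restrict full_meas) simp
    from measurable_sets[OF this Q] show ?thesis by (simp add: c_eq)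
  qed
  \<comment> \<open>The mutual independence of the channels is grouped into channel k against the
    block of all others.\<close>
  have iv: "indep_var (PiM {k} ?M') (\<lambda>\<omega>. \<lambda>j\<in>{k}. ?path j \<omega>) (PiM (-{k}) ?M') (\<lambda>\<omega>. \<lambda>j\<in>-{k}. ?path j \<omega>)"
  proof (rule indep_var_restrict)
    show "indep_vars ?M' ?path UNIV" using Y unfolding indep_poisson_processes_def by (rule conjunct2)
  qed simp_all
  have prod_c: "prob (e \<inter> ?F S \<inter> c) = prob (e \<inter> ?F S) * prob c" for S
  proof (cases "e = {}")
    case False
    then obtain J d where J: "finite J" "J \<subseteq> {0..s}" "e = path_event M (Y k) J d"
      using e by (auto simp: path_pi_system_def)
    \<comment> \<open>The past of channel k together with its later increment, as one measurable set
      in the path space of that channel, to which the independence of the two blocks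
      applies.\<close>
    define P where "P = {p \<in> space (PiM {k} ?M'). (\<forall>u\<in>J. p k u = d u) \<and> p k s' - p k s \<in> S}"
    have comp: "(\<lambda>p. p k u) \<in> measurable (PiM {k} ?M') (count_space UNIV)" if "0 \<le> u" for u
    proof -
      have "(\<lambda>p. p k) \<in> measurable (PiM {k} ?M') (?M' k)" by (rule measurable_component_singleton) simp
      from measurable_compose[OF this measurable_component_singleton[of u]] that show ?thesis by simp
    qed
    have [measurable]: "(\<lambda>p. p k s) \<in> measurable (PiM {k} ?M') (count_space UNIV)"
      "(\<lambda>p. p k s') \<in> measurable (PiM {k} ?M') (count_space UNIV)"
      using s by (auto intro!: comp)
    have "P = {p \<in> space (PiM {k} ?M'). \<forall>u\<in>J. p k u = d u} \<inter> {p \<in> space (PiM {k} ?M'). p k s' - p k s \<in> S}"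
      by (auto simp: P_def)
    also have "\<dots> \<in> sets (PiM {k} ?M')"
    proof (rule sets.Int)
      show "{p \<in> space (PiM {k} ?M'). \<forall>u\<in>J. p k u = d u} \<in> sets (PiM {k} ?M')"
      proof (rule sets.sets_Collect_finite_All)
        fix u assume "u \<in> J"
        then have [measurable]: "(\<lambda>p. p k u) \<in> measurable (PiM {k} ?M') (count_space UNIV)"
          using J by (auto intro!: comp)
        show "{p \<in> space (PiM {k} ?M'). p k u = d u} \<in> sets (PiM {k} ?M')" by measurable
      qed (use J in simp)
      show "{p \<in> space (PiM {k} ?M'). p k s' - p k s \<in> S} \<in> sets (PiM {k} ?M')" by measurable
    qed
    finally have P: "P \<in> sets (PiM {k} ?M')" .
    have eF: "e \<inter> ?F S = (\<lambda>\<omega>. \<lambda>j\<in>{k}. ?path j \<omega>) -` P \<inter> space M"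
      using J s by (auto simp: P_def path_event_def space_PiM)
    have "e \<inter> ?F S \<inter> c = (\<lambda>\<omega>. (\<lambda>j\<in>{k}. ?path j \<omega>, \<lambda>j\<in>-{k}. ?path j \<omega>)) -` (P \<times> Q) \<inter> space M"
      unfolding eF c_eq by auto
    then show ?thesis
      using indep_varD[OF iv P Q] unfolding eF c_eq by simp
  qed simp
  have prod_e: "prob (e \<inter> ?F S) = prob e * prob (?F S)" for S
  proof (cases "e = {}")
    case False
    then obtain J d where "e = path_event M (Y k) J d" "finite J" "J \<subseteq> {0..s}"
      using e by (auto simp: path_pi_system_def)
    moreover have "poisson_process M (Y k)" using Y unfolding indep_poisson_processes_def by simp
    ultimately show ?thesis using poisson_past_indep[where Y = "Y k" and J = J and s = s and s' = s' and c = d and S = S] s by simp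
  qed simp
  have prod_a: "prob (a \<inter> D) = prob a * prob D" if "D \<in> sets ?full" for D
    by (rule indep_setD[OF ind a that])
  have FU: "?F UNIV = space M" by auto
  have ec: "prob (e \<inter> c) = prob e * prob c"
  proof -
    have "e \<subseteq> space M" using e by (auto simp: path_pi_system_def path_event_def)
    then have "e \<inter> space M = e" by auto
    then show ?thesis using prod_c[of UNIV] by (simp add: FU)
  qed
  have aec: "prob (a \<inter> e \<inter> c \<inter> ?F S) = prob (a \<inter> e \<inter> c) * prob (?F S)"
  proof -
    have "prob (a \<inter> (e \<inter> ?F S \<inter> c)) = prob a * (prob (e \<inter> ?F S) * prob c)"
      using e_full c_full F_full by (subst prod_a) (auto simp: prod_c)
    also have "\<dots> = prob a * prob (e \<inter> c) * prob (?F S)" by (simp add: prod_e ec)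
    also have "prob a * prob (e \<inter> c) = prob (a \<inter> (e \<inter> c))"
      using e_full c_full by (subst prod_a) auto
    finally show ?thesis by (simp add: Int_ac)
  qed
  have ev: "a \<inter> e \<inter> c \<in> events" "?F S \<in> events" "z \<in> events"
    using a_ev e_full c_full full_ev F_full z by (auto simp: trivial_events_def)
  then show A_ev: "A \<in> events" by (auto simp: A_eq)
  show "prob (A \<inter> ?F S) = prob A * prob (?F S)"
  proof (cases "prob z = 0")
    case True
    have "prob A \<le> prob z" "prob (A \<inter> ?F S) \<le> prob z"
      using ev by (auto simp: A_eq intro!: finite_measure_mono)
    then show ?thesis using True by (simp add: measure_le_0_iff)
  next
    case False
    then have "AE x in M. x \<in> z" using z by (auto simp: trivial_events_def intro: AE_prob_1)
    then have "prob A = prob (a \<inter> e \<inter> c)" "prob (A \<inter> ?F S) = prob (a \<inter> e \<inter> c \<inter> ?F S)"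
      using ev A_ev by (auto simp: A_eq intro!: finite_measure_eq_AE elim!: eventually_mono)
    then show ?thesis using aec by simp
  qed
qed

lemma past_pi_system_subset: "0 \<le> s \<Longrightarrow> past_pi_system Y X0 k s \<subseteq> Pow (space M)"
  using sets.sets_into_space[OF past_pi_system_indep(1)[of _ k s "s + 1"]] by (intro subsetI PowI) auto

lemma space_channel_past[simp]: "0 \<le> s \<Longrightarrow> space (channel_past Y X0 k s) = space M"
  unfolding channel_past_def by (intro space_measure_of past_pi_system_subset)

lemma sets_channel_past: "0 \<le> s \<Longrightarrow> sets (channel_past Y X0 k s) = sigma_sets (space M) (past_pi_system Y X0 k s)"
  unfolding channel_past_def by (intro sets_measure_of past_pi_system_subset)

text \<open>Independence passes from generators stable under intersection to the generated
  sigma-algebras. The increment events for all value sets together form such a generator.\<close>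

lemma channel_past_indep:
  assumes A: "A \<in> sets (channel_past Y X0 k s)" and s: "0 \<le> s" "s < s'"
  shows "A \<in> events"
    and "prob (A \<inter> {\<omega>\<in>space M. Y k s' \<omega> - Y k s \<omega> \<in> S}) = prob A * prob {\<omega>\<in>space M. Y k s' \<omega> - Y k s \<omega> \<in> S}"
proof -
  let ?F = "\<lambda>S. {\<omega>\<in>space M. Y k s' \<omega> - Y k s \<omega> \<in> S}"
  have [measurable]: "Y k s \<in> measurable M (count_space UNIV)" "Y k s' \<in> measurable M (count_space UNIV)"
    using s by (auto intro!: Y_measurable)
  have "indep_set (sigma_sets (space M) (past_pi_system Y X0 k s)) (sigma_sets (space M) (range ?F))"
  proof (rule indep_set_sigma_sets[OF indep_setI Int_stable_past_pi_system])
    show "past_pi_system Y X0 k s \<subseteq> events" by (rule subsetI) (rule past_pi_system_indep(1)[OF _ s])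
    show "prob (a \<inter> b) = prob a * prob b" if "a \<in> past_pi_system Y X0 k s" "b \<in> range ?F" for a b
      using that(2) by (elim rangeE) (simp only: past_pi_system_indep(2)[OF that(1) s])
    show "range ?F \<subseteq> events" by auto
    show "Int_stable (range ?F)"
    proof (rule Int_stableI)
      fix a b assume "a \<in> range ?F" "b \<in> range ?F"
      then obtain S S' where "a = ?F S" "b = ?F S'" by auto
      then have "a \<inter> b = ?F (S \<inter> S')" by auto
      then show "a \<inter> b \<in> range ?F" by auto
    qed
  qed
  note ind = this
  show "A \<in> events" using indep_setD_ev1[OF ind] A unfolding sets_channel_past[OF s(1)] by (rule subsetD)
  show "prob (A \<inter> ?F S) = prob A * prob (?F S)"
    using A unfolding sets_channel_past[OF s(1)] by (intro indep_setD[OF ind]) auto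
qed

lemma space_in_factors:
  shows "space M \<in> sets (vimage_algebra (space M) X0 borel)" "space M \<in> path_pi_system (Y k) s"
    "space M \<in> sets (other_channels Y k)" "space M \<in> trivial_events"
proof -
  show "space M \<in> sets (vimage_algebra (space M) X0 borel)"
    using sets.top[of "vimage_algebra (space M) X0 borel"] by simp
  have "space M = path_event M (Y k) {} (\<lambda>_. 0)" by (simp add: path_event_def)
  then show "space M \<in> path_pi_system (Y k) s" unfolding path_pi_system_def by fastforce
  show "space M \<in> sets (other_channels Y k)" using sets.top[of "other_channels Y k"] by simp
  show "space M \<in> trivial_events" by (simp add: trivial_events_def prob_space)
qed

text \<open>A single factor is obtained by taking the whole space for the other three.\<close>

lemma channel_past_factors:
  assumes s: "0 \<le> s"
  shows "a \<in> sets (vimage_algebra (space M) X0 borel) \<Longrightarrow> a \<in> sets (channel_past Y X0 k s)"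
    and "e \<in> path_pi_system (Y k) s \<Longrightarrow> e \<in> sets (channel_past Y X0 k s)"
    and "c \<in> sets (other_channels Y k) \<Longrightarrow> c \<in> sets (channel_past Y X0 k s)"
    and "z \<in> trivial_events \<Longrightarrow> z \<in> sets (channel_past Y X0 k s)"
proof -
  have *: "a \<inter> e \<inter> c \<inter> z \<in> sets (channel_past Y X0 k s)"
    if "a \<in> sets (vimage_algebra (space M) X0 borel)" "e \<in> path_pi_system (Y k) s"
      "c \<in> sets (other_channels Y k)" "z \<in> trivial_events" for a e c z
    unfolding sets_channel_past[OF s] past_pi_system_def using that
    by (intro sigma_sets.Basic CollectI exI[of _ a] exI[of _ e] exI[of _ c] exI[of _ z] conjI refl)
  have ss: "a \<in> sets (vimage_algebra (space M) X0 borel) \<Longrightarrow> a \<subseteq> space M"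
    "e \<in> path_pi_system (Y k) s \<Longrightarrow> e \<subseteq> space M" "c \<in> sets (other_channels Y k) \<Longrightarrow> c \<subseteq> space M"
    "z \<in> trivial_events \<Longrightarrow> z \<subseteq> space M" for a e c z
    using sets.sets_into_space[of a "vimage_algebra (space M) X0 borel"]
      sets.sets_into_space[of c "other_channels Y k"] sets.sets_into_space[of z M]
    by (auto simp: path_pi_system_def path_event_def trivial_events_def)
  note si = space_in_factors
  show "a \<in> sets (channel_past Y X0 k s)" if "a \<in> sets (vimage_algebra (space M) X0 borel)"
    using *[OF that si(2-4)] ss(1)[OF that] by (simp add: Int_absorb2)
  show "e \<in> sets (channel_past Y X0 k s)" if "e \<in> path_pi_system (Y k) s"
    using *[OF si(1) that si(3,4)] ss(2)[OF that] by (simp add: Int_absorb1 Int_absorb2)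
  show "c \<in> sets (channel_past Y X0 k s)" if "c \<in> sets (other_channels Y k)"
    using *[OF si(1,2) that si(4)] ss(3)[OF that] by (simp add: Int_absorb1 Int_absorb2)
  show "z \<in> sets (channel_past Y X0 k s)" if "z \<in> trivial_events"
    using *[OF si(1-3) that] ss(4)[OF that] by (simp add: Int_absorb1 Int_absorb2)
qed

lemma channel_past_measurable_X0:
  assumes s: "0 \<le> s"
  shows "X0 \<in> borel_measurable (channel_past Y X0 k s)"
proof (rule measurableI)
  fix A :: "(real ^ 'd) set" assume "A \<in> sets borel"
  then have "X0 -` A \<inter> space M \<in> sets (vimage_algebra (space M) X0 borel)" by (rule in_vimage_algebra)
  then show "X0 -` A \<inter> space (channel_past Y X0 k s) \<in> sets (channel_past Y X0 k s)"
    unfolding space_channel_past[OF s] by (rule channel_past_factors(1)[OF s])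
qed simp

lemma channel_past_measurable_Y:
  assumes s: "0 \<le> s" and u: "0 \<le> u" "j = k \<Longrightarrow> u \<le> s"
  shows "Y j u \<in> measurable (channel_past Y X0 k s) (count_space UNIV)"
proof (cases "j = k")
  case True
  have "Y k u -` {m} \<inter> space (channel_past Y X0 k s) \<in> sets (channel_past Y X0 k s)" for m
  proof -
    have "Y k u -` {m} \<inter> space M = path_event M (Y k) {u} (\<lambda>_. m)" by (auto simp: path_event_def)
    also have "\<dots> \<in> path_pi_system (Y k) s"
      unfolding path_pi_system_def using u True
      by (intro insertI2 CollectI exI[of _ "{u}"] exI[of _ "\<lambda>_. m"] conjI refl) auto
    finally show ?thesis unfolding space_channel_past[OF s] by (rule channel_past_factors(2)[OF s])
  qed
  then have "Y k u \<in> measurable (channel_past Y X0 k s) (count_space UNIV)"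
    by (subst measurable_count_space_eq2_countable) simp_all
  then show ?thesis using True by simp
next
  case False
  have "(\<lambda>\<omega>. \<lambda>j\<in>-{k}. \<lambda>t\<in>{0..}. Y j t \<omega>) \<in> measurable (other_channels Y k)
      (PiM (-{k}) (\<lambda>_. PiM {0..} (\<lambda>_. count_space UNIV)))"
    unfolding other_channels_def by (intro measurable_vimage_algebra1) (auto simp: space_PiM)
  then have m: "(\<lambda>\<omega>. (\<lambda>j\<in>-{k}. \<lambda>t\<in>{0..}. Y j t \<omega>) j) \<in> measurable (other_channels Y k) (PiM {0..} (\<lambda>_. count_space UNIV))"
    by (rule measurable_compose[OF _ measurable_component_singleton]) (use False in simp)
  have "(\<lambda>\<omega>. (\<lambda>j\<in>-{k}. \<lambda>t\<in>{0..}. Y j t \<omega>) j u) \<in> measurable (other_channels Y k) (count_space UNIV)"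
    by (rule measurable_compose[OF m measurable_component_singleton]) (use u in simp)
  then have m: "Y j u \<in> measurable (other_channels Y k) (count_space UNIV)" using False u by simp
  show ?thesis
  proof (rule measurableI)
    fix A :: "nat set" assume A: "A \<in> sets (count_space UNIV)"
    show "Y j u -` A \<inter> space (channel_past Y X0 k s) \<in> sets (channel_past Y X0 k s)"
      unfolding space_channel_past[OF s]
      by (rule channel_past_factors(3)[OF s measurable_sets[OF m A, unfolded space_other_channels]])
  qed simp
qed

end

end

section \<open>Poisson counts at stopping times\<close>

lemma nn_integral_poisson_pmf:
  assumes "0 < r"
  shows "(\<integral>\<^sup>+n. ennreal (real n) \<partial>measure_pmf (poisson_pmf r)) = ennreal r"
proof -
  have "(\<lambda>n. r * exp (-r) * (inverse (fact n) *\<^sub>R r ^ n)) sums (r * exp (-r) * exp r)"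
    by (intro sums_mult exp_converges)
  also have "(\<lambda>n. r * exp (-r) * (inverse (fact n) *\<^sub>R r ^ n)) = (\<lambda>n. r ^ Suc n / fact (Suc n) * exp (-r) * real (Suc n))"
    by (auto simp: fun_eq_iff field_simps simp del: of_nat_Suc)
  also have "r * exp (-r) * exp r = r" by (simp add: exp_minus field_simps)
  finally have "(\<lambda>n. r ^ n / fact n * exp (-r) * real n) sums r"
    by (subst (asm) sums_Suc_iff) simp
  then have "(\<Sum>n. ennreal (r ^ n / fact n * exp (-r) * real n)) = ennreal r"
    using assms by (intro suminf_ennreal_eq) auto
  then show ?thesis
    using assms by (simp add: nn_integral_measure_pmf nn_integral_count_space_nat ennreal_mult[symmetric])
qed

lemma suminf_indicator_less: "(\<Sum>i. if i < n then 1 else 0) = ennreal (real n)"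
proof -
  have "(\<Sum>i. if i < n then 1 else 0) = (\<Sum>i<n. if i < n then 1 else (0::ennreal))"
    by (rule suminf_finite) auto
  then show ?thesis by (simp add: ennreal_of_nat_eq_real_of_nat)
qed

text \<open>Telescoping between \<open>p\<close> and \<open>q\<close>, spread over all i so that the
  range of summation is no longer random. The indices enter only through p \<le> i and q \<le> i,
  which become the events of the stopping argument.\<close>

lemma ennreal_abs_diff_suminf:
  fixes G :: "nat \<Rightarrow> real"
  assumes "mono G"
  shows "ennreal \<bar>G p - G q\<bar> = (\<Sum>i. if (p \<le> i) \<noteq> (q \<le> i) then ennreal (G (Suc i) - G i) else 0)"
proof -
  have *: "ennreal \<bar>G p - G q\<bar> = (\<Sum>i. if (p \<le> i) \<noteq> (q \<le> i) then ennreal (G (Suc i) - G i) else 0)"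
    if "p \<le> q" for p q
  proof -
    have "(\<Sum>i. if (p \<le> i) \<noteq> (q \<le> i) then ennreal (G (Suc i) - G i) else 0) =
        (\<Sum>i\<in>{p..<q}. if (p \<le> i) \<noteq> (q \<le> i) then ennreal (G (Suc i) - G i) else 0)"
      using that by (intro suminf_finite) auto
    also have "\<dots> = (\<Sum>i\<in>{p..<q}. ennreal (G (Suc i) - G i))" by (intro sum.cong) auto
    also have "\<dots> = ennreal (\<Sum>i\<in>{p..<q}. G (Suc i) - G i)"
      using monoD[OF assms] by (intro sum_ennreal) simp
    also have "(\<Sum>i\<in>{p..<q}. G (Suc i) - G i) = G q - G p" using that by (rule sum_Suc_diff')
    also have "\<dots> = \<bar>G p - G q\<bar>" using monoD[OF assms that] by simp
    finally show ?thesis by simp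
  qed
  show ?thesis
  proof (cases "p \<le> q")
    case False
    have "(\<lambda>i. if (p \<le> i) \<noteq> (q \<le> i) then ennreal (G (Suc i) - G i) else 0) =
       (\<lambda>i. if (q \<le> i) \<noteq> (p \<le> i) then ennreal (G (Suc i) - G i) else 0)" by auto
    then show ?thesis using *[of q p] False by (simp add: abs_minus_commute)
  qed (rule *)
qed

context prob_space begin

text \<open>Expanding both sides into tail sums, E V = \<Sum> P(V > i), reduces the product formula
  to independence of events and also covers infinite expectations.\<close>

lemma nn_integral_indep_nat:
  assumes A: "A \<in> events" and V[measurable]: "V \<in> measurable M (count_space UNIV)"
    and indep: "\<And>S. prob (A \<inter> {\<omega>\<in>space M. V \<omega> \<in> S}) = prob A * prob {\<omega>\<in>space M. V \<omega> \<in> S}"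
  shows "(\<integral>\<^sup>+\<omega>. indicator A \<omega> * ennreal (real (V \<omega>)) \<partial>M) = emeasure M A * (\<integral>\<^sup>+\<omega>. ennreal (real (V \<omega>)) \<partial>M)"
proof -
  note [measurable] = A
  have Vs: "{\<omega>\<in>space M. V \<omega> \<in> S} \<in> events" for S
    using measurable_sets[OF V, of S] by (simp add: vimage_def Int_def conj_commute)
  have *: "(\<integral>\<^sup>+\<omega>. indicator B \<omega> * ennreal (real (V \<omega>)) \<partial>M) = (\<Sum>i. emeasure M (B \<inter> {\<omega>\<in>space M. V \<omega> \<in> {i<..}}))"
    if [measurable]: "B \<in> events" for B
  proof -
    have "(\<integral>\<^sup>+\<omega>. indicator B \<omega> * ennreal (real (V \<omega>)) \<partial>M) =
        (\<integral>\<^sup>+\<omega>. (\<Sum>i. indicator B \<omega> * (if i < V \<omega> then 1 else 0)) \<partial>M)"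
      by (simp add: ennreal_suminf_cmult suminf_indicator_less)
    also have "\<dots> = (\<Sum>i. \<integral>\<^sup>+\<omega>. indicator B \<omega> * (if i < V \<omega> then 1 else 0) \<partial>M)"
      by (intro nn_integral_suminf) measurable
    also have "\<dots> = (\<Sum>i. \<integral>\<^sup>+\<omega>. indicator (B \<inter> {\<omega>\<in>space M. V \<omega> \<in> {i<..}}) \<omega> \<partial>M)"
      by (intro suminf_cong nn_integral_cong) (auto simp: indicator_def)
    also have "\<dots> = (\<Sum>i. emeasure M (B \<inter> {\<omega>\<in>space M. V \<omega> \<in> {i<..}}))"
      by (intro suminf_cong nn_integral_indicator sets.Int that Vs)
    finally show ?thesis .
  qed
  have ind: "prob (A \<inter> {\<omega>\<in>space M. i < V \<omega>}) = prob A * prob {\<omega>\<in>space M. i < V \<omega>}" for i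
    using indep[of "{i<..}"] by simp
  have "(\<integral>\<^sup>+\<omega>. indicator A \<omega> * ennreal (real (V \<omega>)) \<partial>M) =
      (\<Sum>i. emeasure M A * emeasure M (space M \<inter> {\<omega>\<in>space M. V \<omega> \<in> {i<..}}))"
    unfolding *[OF A] by (intro suminf_cong)
      (simp add: emeasure_eq_measure ind ennreal_mult Int_absorb1 Collect_restrict)
  also have "\<dots> = emeasure M A * (\<integral>\<^sup>+\<omega>. indicator (space M) \<omega> * ennreal (real (V \<omega>)) \<partial>M)"
    unfolding *[OF sets.top] by (rule ennreal_suminf_cmult)
  also have "(\<integral>\<^sup>+\<omega>. indicator (space M) \<omega> * ennreal (real (V \<omega>)) \<partial>M) = (\<integral>\<^sup>+\<omega>. ennreal (real (V \<omega>)) \<partial>M)"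
    by (intro nn_integral_cong) simp
  finally show ?thesis .
qed

lemma grid_above_eq: "0 \<le> u \<Longrightarrow> grid_above m u = real (nat (\<lfloor>real (Suc m) * u\<rfloor> + 1)) / real (Suc m)"
  unfolding grid_above_def by (simp del: of_nat_Suc)

text \<open>Here the shift by one in \<open>grid_above\<close> yields a strict inequality for
  \<open>u\<close>.\<close>

lemma grid_index_le_iff:
  assumes "0 \<le> u"
  shows "nat (\<lfloor>real (Suc m) * u\<rfloor> + 1) \<le> i \<longleftrightarrow> u < real i / real (Suc m)"
proof -
  have "nat (\<lfloor>real (Suc m) * u\<rfloor> + 1) \<le> i \<longleftrightarrow> \<lfloor>real (Suc m) * u\<rfloor> < int i" by linarith
  also have "\<dots> \<longleftrightarrow> real (Suc m) * u < real i" by (simp add: floor_less_iff del: of_nat_Suc)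
  also have "\<dots> \<longleftrightarrow> u < real i / real (Suc m)" by (simp add: pos_less_divide_eq mult.commute del: of_nat_Suc)
  finally show ?thesis .
qed

text \<open>Doob's optional stopping in the only form needed here: the hypothesis \<open>increment\<close> holds as soon
  as the events \<open>{\<tau> < s}\<close> and \<open>{\<tau>' < s}\<close> are independent of the increments of \<open>y\<close> after \<open>s\<close>.
  On a grid, the left-hand side is a sum of such increments; Fatou's lemma removes the grid.\<close>

lemma stopped_counts_diff_le:
  fixes y :: "'a \<Rightarrow> real \<Rightarrow> nat" and \<tau> \<tau>' :: "'a \<Rightarrow> real"
  assumes y: "\<And>u. (\<lambda>\<omega>. y \<omega> u) \<in> measurable M (count_space UNIV)"
    and mono: "\<And>\<omega>. mono (y \<omega>)" and rc: "\<And>\<omega> u. continuous (at_right u) (y \<omega>)"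
    and [measurable]: "\<tau> \<in> borel_measurable M" "\<tau>' \<in> borel_measurable M"
    and nonneg: "\<And>\<omega>. 0 \<le> \<tau> \<omega>" "\<And>\<omega>. 0 \<le> \<tau>' \<omega>"
    and increment: "\<And>s s'. 0 \<le> s \<Longrightarrow> s < s' \<Longrightarrow>
      (\<integral>\<^sup>+\<omega>. indicator {\<omega>\<in>space M. (\<tau> \<omega> < s) \<noteq> (\<tau>' \<omega> < s)} \<omega> * ennreal (real (y \<omega> s' - y \<omega> s)) \<partial>M) =
      emeasure M {\<omega>\<in>space M. (\<tau> \<omega> < s) \<noteq> (\<tau>' \<omega> < s)} * ennreal (s' - s)"
  shows "(\<integral>\<^sup>+\<omega>. ennreal \<bar>real (y \<omega> (\<tau> \<omega>)) - real (y \<omega> (\<tau>' \<omega>))\<bar> \<partial>M) \<le> (\<integral>\<^sup>+\<omega>. ennreal \<bar>\<tau> \<omega> - \<tau>' \<omega>\<bar> \<partial>M)"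
proof -
  have yj: "(\<lambda>(\<omega>, u). y \<omega> u) \<in> measurable (M \<Otimes>\<^sub>M borel) (count_space UNIV)"
    by (intro measurable_right_cont_joint_nat y rc)
  have [measurable]: "(\<lambda>\<omega>. y \<omega> (u \<omega>)) \<in> measurable M (count_space UNIV)" if "u \<in> borel_measurable M" for u
    using measurable_compose[OF measurable_Pair[OF measurable_ident that] yj] by simp
  have [measurable]: "grid_above m \<in> borel_measurable borel" for m
    unfolding grid_above_def[abs_def] by measurable
  note [measurable] = y
  let ?D = "\<lambda>s. {\<omega>\<in>space M. (\<tau> \<omega> < s) \<noteq> (\<tau>' \<omega> < s)}"
  let ?I = "\<lambda>m. \<integral>\<^sup>+\<omega>. ennreal \<bar>real (y \<omega> (grid_above m (\<tau> \<omega>))) - real (y \<omega> (grid_above m (\<tau>' \<omega>)))\<bar> \<partial>M"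
  \<comment> \<open>Used twice, with g a Poisson path and with g the identity; the selecting events
    are the same in both sums.\<close>
  have sum_form: "ennreal \<bar>g (grid_above m (\<tau> \<omega>)) - g (grid_above m (\<tau>' \<omega>))\<bar> =
      (\<Sum>i. indicator (?D (real i / real (Suc m))) \<omega> *
        ennreal (g (real (Suc i) / real (Suc m)) - g (real i / real (Suc m))))"
    if \<omega>: "\<omega> \<in> space M" and g: "mono g" for \<omega> m and g :: "real \<Rightarrow> real"
  proof -
    have "mono (\<lambda>i. g (real i / real (Suc m)))"
      by (intro monoI monoD[OF g] divide_right_mono) auto
    from ennreal_abs_diff_suminf[OF this]
    show ?thesis unfolding grid_above_eq[OF nonneg(1)] grid_above_eq[OF nonneg(2)]
      using \<omega> by (simp only: grid_index_le_iff[OF nonneg(1)] grid_index_le_iff[OF nonneg(2)])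
         (intro suminf_cong, simp add: indicator_def)
  qed
  have I: "?I m \<le> (\<integral>\<^sup>+\<omega>. ennreal \<bar>\<tau> \<omega> - \<tau>' \<omega>\<bar> \<partial>M) + ennreal (1 / real (Suc m))" for m
  proof -
    let ?s = "\<lambda>i. real i / real (Suc m)"
    have "?I m = (\<integral>\<^sup>+\<omega>. (\<Sum>i. indicator (?D (?s i)) \<omega> * ennreal (real (y \<omega> (?s (Suc i)) - y \<omega> (?s i)))) \<partial>M)"
    proof (intro nn_integral_cong)
      fix \<omega> assume \<omega>: "\<omega> \<in> space M"
      have "mono (\<lambda>u. real (y \<omega> u))" using mono[of \<omega>] by (auto simp: mono_def)
      moreover have "y \<omega> (?s i) \<le> y \<omega> (?s (Suc i))" for i
        by (intro monoD[OF mono] divide_right_mono) auto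
      ultimately show "ennreal \<bar>real (y \<omega> (grid_above m (\<tau> \<omega>))) - real (y \<omega> (grid_above m (\<tau>' \<omega>)))\<bar> =
          (\<Sum>i. indicator (?D (?s i)) \<omega> * ennreal (real (y \<omega> (?s (Suc i)) - y \<omega> (?s i))))"
        using sum_form[OF \<omega>, of "\<lambda>u. real (y \<omega> u)" m] by (simp add: of_nat_diff)
    qed
    also have "\<dots> = (\<Sum>i. \<integral>\<^sup>+\<omega>. indicator (?D (?s i)) \<omega> * ennreal (real (y \<omega> (?s (Suc i)) - y \<omega> (?s i))) \<partial>M)"
      by (intro nn_integral_suminf) measurable
    \<comment> \<open>Each Poisson increment is replaced by its mean, the length of the grid
      interval.\<close>
    also have "\<dots> = (\<Sum>i. emeasure M (?D (?s i)) * ennreal (?s (Suc i) - ?s i))"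
      by (intro suminf_cong increment divide_strict_right_mono) auto
    also have "\<dots> = (\<Sum>i. \<integral>\<^sup>+\<omega>. indicator (?D (?s i)) \<omega> * ennreal (?s (Suc i) - ?s i) \<partial>M)"
      by (intro suminf_cong, subst nn_integral_multc) (auto simp: nn_integral_indicator)
    also have "\<dots> = (\<integral>\<^sup>+\<omega>. (\<Sum>i. indicator (?D (?s i)) \<omega> * ennreal (?s (Suc i) - ?s i)) \<partial>M)"
      by (intro nn_integral_suminf[symmetric]) measurable
    \<comment> \<open>The formula for the identity function, read backwards, reassembles the
      interval lengths into the distance of the two rounded times.\<close>
    also have "\<dots> = (\<integral>\<^sup>+\<omega>. ennreal \<bar>grid_above m (\<tau> \<omega>) - grid_above m (\<tau>' \<omega>)\<bar> \<partial>M)"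
      by (intro nn_integral_cong sum_form[of _ "\<lambda>u. u" m, symmetric] monoI)
    also have "\<dots> \<le> (\<integral>\<^sup>+\<omega>. ennreal \<bar>\<tau> \<omega> - \<tau>' \<omega>\<bar> + ennreal (1 / real (Suc m)) \<partial>M)"
    proof (intro nn_integral_mono)
      fix \<omega>
      have "\<bar>grid_above m (\<tau> \<omega>) - grid_above m (\<tau>' \<omega>)\<bar> \<le> \<bar>\<tau> \<omega> - \<tau>' \<omega>\<bar> + 1 / real (Suc m)"
        using grid_above_gt[of "\<tau> \<omega>" m] grid_above_gt[of "\<tau>' \<omega>" m]
          grid_above_le[of m "\<tau> \<omega>"] grid_above_le[of m "\<tau>' \<omega>"] by linarith
      then show "ennreal \<bar>grid_above m (\<tau> \<omega>) - grid_above m (\<tau>' \<omega>)\<bar> \<le> ennreal \<bar>\<tau> \<omega> - \<tau>' \<omega>\<bar> + ennreal (1 / real (Suc m))"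
        by (subst ennreal_plus[symmetric]) (auto intro: ennreal_leI simp del: ennreal_plus)
    qed
    also have "\<dots> = (\<integral>\<^sup>+\<omega>. ennreal \<bar>\<tau> \<omega> - \<tau>' \<omega>\<bar> \<partial>M) + ennreal (1 / real (Suc m))"
      by (subst nn_integral_add) (auto simp: emeasure_space_1)
    finally show ?thesis .
  qed
  have "(\<integral>\<^sup>+\<omega>. ennreal \<bar>real (y \<omega> (\<tau> \<omega>)) - real (y \<omega> (\<tau>' \<omega>))\<bar> \<partial>M) =
      (\<integral>\<^sup>+\<omega>. liminf (\<lambda>m. ennreal \<bar>real (y \<omega> (grid_above m (\<tau> \<omega>))) - real (y \<omega> (grid_above m (\<tau>' \<omega>)))\<bar>) \<partial>M)"
    by (intro nn_integral_cong lim_imp_Liminf[symmetric] tendsto_ennrealI tendsto_rabs tendsto_diff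
      right_cont_grid_above right_cont_nat_real rc) simp
  also have "\<dots> \<le> liminf ?I"
    by (intro nn_integral_liminf) measurable
  also have "\<dots> \<le> liminf (\<lambda>m. (\<integral>\<^sup>+\<omega>. ennreal \<bar>\<tau> \<omega> - \<tau>' \<omega>\<bar> \<partial>M) + ennreal (1 / real (Suc m)))"
    by (intro Liminf_mono always_eventually allI I)
  also have "\<dots> = (\<integral>\<^sup>+\<omega>. ennreal \<bar>\<tau> \<omega> - \<tau>' \<omega>\<bar> \<partial>M) + 0"
  proof (intro lim_imp_Liminf)
    have "(\<lambda>m. ennreal (1 / real (Suc m))) \<longlonglongrightarrow> ennreal 0"
      using LIMSEQ_inverse_real_of_nat by (intro tendsto_ennrealI) (simp add: inverse_eq_divide)
    then show "(\<lambda>m. (\<integral>\<^sup>+\<omega>. ennreal \<bar>\<tau> \<omega> - \<tau>' \<omega>\<bar> \<partial>M) + ennreal (1 / real (Suc m)))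
        \<longlonglongrightarrow> (\<integral>\<^sup>+\<omega>. ennreal \<bar>\<tau> \<omega> - \<tau>' \<omega>\<bar> \<partial>M) + 0"
      by (intro tendsto_add tendsto_const) simp
  qed simp
  finally show ?thesis by simp
qed

end

section \<open>Adaptedness of the internal times\<close>

lemma borel_measurable_right_cont:
  fixes x :: "real \<Rightarrow> 'b::metric_space"
  assumes "\<And>u. continuous (at_right u) x"
  shows "x \<in> borel_measurable borel"
proof -
  have "(\<lambda>(w, u). x u) \<in> borel_measurable (count_space (UNIV :: unit set) \<Otimes>\<^sub>M borel)"
    by (rule measurable_right_cont_joint[OF _ assms]) simp
  moreover have "(\<lambda>u. ((), u)) \<in> borel \<rightarrow>\<^sub>M count_space UNIV \<Otimes>\<^sub>M borel" by measurable
  ultimately have "(\<lambda>u. (\<lambda>(w, u). x u) ((), u)) \<in> borel_measurable borel"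
    by (rule measurable_compose[rotated])
  then show ?thesis by simp
qed

lemma continuous_at_right_eventually_eq:
  fixes x y :: "real \<Rightarrow> 'b::topological_space"
  assumes "continuous (at_right u) x" "x u = y u" "\<forall>\<^sub>F v in at_right u. x v = y v"
  shows "continuous (at_right u) y"
  unfolding continuous_within assms(2)[symmetric]
  using assms(1)[unfolded continuous_within] assms(3) by (rule Lim_transform_eventually)

locale rtc_setting = prob_space M + rtc_data f lam \<nu> C B \<Lambda>
  for M :: "'w measure" and f :: "real ^ 'd \<Rightarrow> real ^ 'd" and lam :: "'k::finite \<Rightarrow> real ^ 'd \<Rightarrow> real"
    and \<nu> :: "'k \<Rightarrow> real ^ 'd" and C B \<Lambda> :: real +
  fixes Y :: "'k \<Rightarrow> real \<Rightarrow> 'w \<Rightarrow> nat" and X :: "real \<Rightarrow> 'w \<Rightarrow> real ^ 'd" and T :: real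
  assumes T_pos: "0 < T" and Y: "indep_poisson_processes M Y" and X: "rtc_solution M T Y \<nu> f lam X"
begin

section \<open>Versions of the processes that are regular at every sample point\<close>

definition rtc_equation :: "'w \<Rightarrow> bool" where
  "rtc_equation \<omega> \<longleftrightarrow> (\<forall>t\<in>{0..T}. X t \<omega> = X 0 \<omega> + (LBINT s:{0..t}. f (X s \<omega>)) +
     (\<Sum>k\<in>UNIV. real (Y k (LBINT s:{0..t}. lam k (X s \<omega>)) \<omega>) *\<^sub>R \<nu> k))"

definition regular :: "'w \<Rightarrow> bool" where
  "regular \<omega> \<longleftrightarrow>
     (\<forall>k. Y k 0 \<omega> = 0 \<and> mono_on {0..} (\<lambda>t. Y k t \<omega>) \<and> (\<forall>t\<ge>0. continuous (at_right t) (\<lambda>s. Y k s \<omega>))) \<and>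
     cadlag_on T (\<lambda>t. X t \<omega>) \<and> rtc_equation \<omega>"

text \<open>By \<open>SOME\<close>, since the set of all regular \<open>\<omega>\<close> need not be measurable.\<close>

definition good :: "'w set" where
  "good = (SOME G. G \<in> events \<and> prob G = 1 \<and> (\<forall>\<omega>\<in>G. regular \<omega>))"

lemma good: "good \<in> events" "prob good = 1" "\<omega> \<in> good \<Longrightarrow> regular \<omega>"
proof -
  have "AE \<omega> in M. \<forall>k\<in>UNIV. Y k 0 \<omega> = 0 \<and> mono_on {0..} (\<lambda>t. Y k t \<omega>) \<and>
      (\<forall>t\<ge>0. continuous (at_right t) (\<lambda>s. Y k s \<omega>))"
  proof (rule AE_finite_allI)
    fix k
    have "poisson_process M (Y k)" using Y unfolding indep_poisson_processes_def by simp
    then show "AE \<omega> in M. Y k 0 \<omega> = 0 \<and> mono_on {0..} (\<lambda>t. Y k t \<omega>) \<and>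
        (\<forall>t\<ge>0. continuous (at_right t) (\<lambda>s. Y k s \<omega>))"
      unfolding poisson_process_def by (elim conjE)
  qed simp
  moreover have "AE \<omega> in M. cadlag_on T (\<lambda>t. X t \<omega>) \<and> rtc_equation \<omega>"
    using X unfolding rtc_solution_def rtc_equation_def by (elim conjE)
  ultimately have "AE \<omega> in M. regular \<omega>"
    by eventually_elim (simp add: regular_def)
  then obtain Z where Z: "Z \<in> null_sets M" "{\<omega>\<in>space M. \<not> regular \<omega>} \<subseteq> Z"
    unfolding eventually_ae_filter by (elim bexE) simp
  have "Z \<in> events" "prob Z = 0" using Z(1) by (auto simp: null_setsD2 measure_eq_0_null_sets)
  then have "prob (space M - Z) = 1" by (simp add: prob_compl)
  moreover have "\<forall>\<omega>\<in>space M - Z. regular \<omega>" using Z(2) by auto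
  ultimately have "space M - Z \<in> events \<and> prob (space M - Z) = 1 \<and> (\<forall>\<omega>\<in>space M - Z. regular \<omega>)"
    using \<open>Z \<in> events\<close> by simp
  from someI[of "\<lambda>G. G \<in> events \<and> prob G = 1 \<and> (\<forall>\<omega>\<in>G. regular \<omega>)", OF this]
  show "good \<in> events" "prob good = 1" "\<omega> \<in> good \<Longrightarrow> regular \<omega>"
    unfolding good_def[symmetric] by auto
qed

lemma AE_good: "AE \<omega> in M. \<omega> \<in> good"
  using good(2) by (rule AE_prob_1)

text \<open>Constant off \<open>good\<close> and at negative times, so that monotonicity and right
  continuity hold for every sample point and every real time and the pathwise lemmas apply without
  exceptions.\<close>

definition Yg :: "'w \<Rightarrow> 'k \<Rightarrow> real \<Rightarrow> nat" where
  "Yg \<omega> k u = (if \<omega> \<in> good then Y k (max 0 u) \<omega> else 0)"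

text \<open>Freezing the path after T supplies the right continuity at T, which
  \<open>cadlag_on\<close> does not give; a jump at time 0 does not disturb it.\<close>

definition Xg :: "'w \<Rightarrow> real \<Rightarrow> real ^ 'd" where
  "Xg \<omega> t = (if \<omega> \<in> good \<and> 0 \<le> t then X (min t T) \<omega> else 0)"

lemma X0_indep: "indep_of_processes M Y (X 0)"
  using X unfolding rtc_solution_def by (elim conjE)

lemma X_measurable: "0 \<le> t \<Longrightarrow> t \<le> T \<Longrightarrow> X t \<in> borel_measurable M"
  using X unfolding rtc_solution_def by auto

lemma Yg_eq: "\<omega> \<in> good \<Longrightarrow> 0 \<le> u \<Longrightarrow> Yg \<omega> k u = Y k u \<omega>"
  by (simp add: Yg_def)

lemma Xg_eq: "\<omega> \<in> good \<Longrightarrow> 0 \<le> t \<Longrightarrow> t \<le> T \<Longrightarrow> Xg \<omega> t = X t \<omega>"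
  by (simp add: Xg_def)

lemma Yg_mono: "mono (Yg \<omega> k)"
proof (rule monoI)
  fix u v :: real assume "u \<le> v"
  then have "max 0 u \<le> max 0 v" by simp
  then show "Yg \<omega> k u \<le> Yg \<omega> k v"
    using good(3)[of \<omega>] by (auto simp: Yg_def regular_def intro!: mono_onD[of "{0..}" "\<lambda>t. Y k t \<omega>"])
qed

lemma Yg_right_cont: "continuous (at_right u) (Yg \<omega> k)"
proof (cases "\<omega> \<in> good")
  case True
  have gt: "\<forall>\<^sub>F v in at_right u. u < v" by (rule eventually_at_right_less)
  show ?thesis
  proof (cases "0 \<le> u")
    case u: True
    have "continuous (at_right u) (\<lambda>s. Y k s \<omega>)" using good(3)[OF True] u by (simp add: regular_def)
    then show ?thesis
      by (rule continuous_at_right_eventually_eq)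
         (use True u in \<open>auto simp: Yg_def intro: eventually_mono[OF gt]\<close>)
  next
    case False
    have "\<forall>\<^sub>F v in at_right u. v < 0"
      by (rule eventually_at_rightI[of _ 0]) (use False in auto)
    then have "\<forall>\<^sub>F v in at_right u. Yg \<omega> k u = Yg \<omega> k v"
      by eventually_elim (use False in \<open>simp add: Yg_def max_def\<close>)
    then show ?thesis
      by (intro continuous_at_right_eventually_eq[OF continuous_const refl])
  qed
qed (simp add: Yg_def[abs_def])

lemma Xg_right_cont: "continuous (at_right u) (Xg \<omega>)"
proof (cases "\<omega> \<in> good")
  case True
  have gt: "\<forall>\<^sub>F v in at_right u. u < v" by (rule eventually_at_right_less)
  consider "u < 0" | "0 \<le> u" "u < T" | "T \<le> u" by linarith
  then show ?thesis
  proof cases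
    case 1
    then have "\<forall>\<^sub>F v in at_right u. v < 0" by (intro eventually_at_rightI[of _ 0]) auto
    then have "\<forall>\<^sub>F v in at_right u. Xg \<omega> u = Xg \<omega> v"
      by eventually_elim (use 1 in \<open>simp add: Xg_def\<close>)
    then show ?thesis
      by (intro continuous_at_right_eventually_eq[OF continuous_const refl])
  next
    case 2
    then have lt: "\<forall>\<^sub>F v in at_right u. v < T" by (intro eventually_at_rightI[of _ T]) auto
    have cont: "continuous (at_right u) (\<lambda>t. X t \<omega>)"
      using good(3)[OF True] 2 unfolding regular_def cadlag_on_def by auto
    have "\<forall>\<^sub>F v in at_right u. X v \<omega> = Xg \<omega> v"
      using gt lt by eventually_elim (use 2 True in \<open>simp add: Xg_def\<close>)
    then show ?thesis
      by (intro continuous_at_right_eventually_eq[OF cont]) (use 2 True in \<open>simp add: Xg_def\<close>)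
  next
    case 3
    have "\<forall>\<^sub>F v in at_right u. Xg \<omega> u = Xg \<omega> v"
      using gt by eventually_elim (use 3 T_pos in \<open>simp add: Xg_def min_def\<close>)
    then show ?thesis
      by (intro continuous_at_right_eventually_eq[OF continuous_const refl])
  qed
qed (simp add: Xg_def[abs_def])

lemma Xg_path_measurable[measurable]: "Xg \<omega> \<in> borel_measurable borel"
  by (intro borel_measurable_right_cont Xg_right_cont)

lemma Xg_joint: "(\<lambda>(\<omega>, t). Xg \<omega> t) \<in> borel_measurable (M \<Otimes>\<^sub>M borel)"
proof (intro measurable_right_cont_joint Xg_right_cont)
  fix u
  note [measurable] = good(1)
  show "(\<lambda>\<omega>. Xg \<omega> u) \<in> borel_measurable M"
  proof (cases "0 \<le> u")
    case True
    then have [measurable]: "X (min u T) \<in> borel_measurable M" using T_pos by (intro X_measurable) auto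
    show ?thesis unfolding Xg_def using True by measurable
  qed (simp add: Xg_def)
qed

lemma Xg_measurable[measurable]: "(\<lambda>\<omega>. Xg \<omega> t) \<in> borel_measurable M"
  using measurable_compose[OF _ Xg_joint, of "\<lambda>\<omega>. (\<omega>, t)" M] by simp

lemma Yg_joint: "(\<lambda>(\<omega>, u). Yg \<omega> k u) \<in> measurable (M \<Otimes>\<^sub>M borel) (count_space UNIV)"
proof (intro measurable_right_cont_joint_nat Yg_right_cont)
  fix u
  note [measurable] = good(1)
  have [measurable]: "Y k (max 0 u) \<in> measurable M (count_space UNIV)" by (intro Y_measurable[OF Y X0_indep]) simp
  show "(\<lambda>\<omega>. Yg \<omega> k u) \<in> measurable M (count_space UNIV)"
    unfolding Yg_def by measurable
qed

lemma Xg_rtc_path: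
  assumes "\<omega> \<in> good"
  shows "rtc_path (Yg \<omega>) (X 0 \<omega>) T (Xg \<omega>)"
  unfolding rtc_path_def
proof (intro conjI Xg_path_measurable allI impI)
  fix t assume t: "0 \<le> t" "t \<le> T"
  have f_eq: "(LBINT s:{0..t}. f (Xg \<omega> s)) = (LBINT s:{0..t}. f (X s \<omega>))"
    by (intro set_lebesgue_integral_cong) (use t assms in \<open>auto simp: Xg_eq\<close>)
  have clock_eq: "clock lam (Xg \<omega>) k t = (LBINT s:{0..t}. lam k (X s \<omega>))" for k
    unfolding clock_def by (intro set_lebesgue_integral_cong) (use t assms in \<open>auto simp: Xg_eq\<close>)
  have "Yg \<omega> k (clock lam (Xg \<omega>) k t) = Y k (LBINT s:{0..t}. lam k (X s \<omega>)) \<omega>" for k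
    using Yg_eq[OF assms clock_nonneg[OF Xg_path_measurable t(1), of \<omega> k], of k] by (simp only: clock_eq)
  then show "Xg \<omega> t = X 0 \<omega> + (LBINT s:{0..t}. f (Xg \<omega> s)) +
      (\<Sum>k\<in>UNIV. real (Yg \<omega> k (clock lam (Xg \<omega>) k t)) *\<^sub>R \<nu> k)"
    using good(3)[OF assms] t unfolding regular_def rtc_equation_def by (simp only: f_eq Xg_eq[OF assms] atLeastAtMost_iff)
qed

context
  fixes k :: 'k and s :: real
  assumes s: "0 \<le> s"
begin

abbreviation "past \<equiv> channel_past Y (X 0) k s"

lemma space_past: "space past = space M"
  by (rule space_channel_past[OF Y X0_indep s])

lemma good_past: "good \<in> sets past"
  using good by (intro channel_past_factors(4)[OF Y X0_indep s]) (simp add: trivial_events_def)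

text \<open>The stopped family reads channel k up to internal time s and the other channels at any
  time, which is what this past observes.\<close>

lemma stopped_past_joint:
  "(\<lambda>(\<omega>, u). stop_channel k s (Yg \<omega>) j u) \<in> measurable (past \<Otimes>\<^sub>M borel) (count_space UNIV)"
proof (intro measurable_right_cont_joint_nat right_cont_stop_channel Yg_right_cont)
  fix u
  note [measurable] = good_past
  have [measurable]: "Y j (max 0 (if j = k then min u s else u)) \<in> measurable past (count_space UNIV)"
    using s by (intro channel_past_measurable_Y[OF Y X0_indep]) auto
  show "(\<lambda>\<omega>. stop_channel k s (Yg \<omega>) j u) \<in> measurable past (count_space UNIV)"
    unfolding stop_channel_def Yg_def by measurable
qed

lemma clock_less_past:
  assumes t: "0 \<le> t" "t \<le> T"
  shows "{\<omega>\<in>space M. clock lam (Xg \<omega>) k t < s} \<in> sets past"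
proof -
  note [measurable] = good_past
  let ?z = "\<lambda>\<omega> n. rtc_approx f lam \<nu> (stop_channel k s (Yg \<omega>)) (X 0 \<omega>) n"
  have m: "(\<lambda>(\<omega>, t). ?z \<omega> n t) \<in> borel_measurable (past \<Otimes>\<^sub>M borel)" for n
    by (intro measurable_rtc_approx_joint f_measurable lam_measurable stopped_past_joint
        channel_past_measurable_X0[OF Y X0_indep s])
  have [measurable]: "(\<lambda>\<omega>. clock lam (?z \<omega> n) k t) \<in> borel_measurable past" for n
    using measurable_compose[OF _ measurable_clock_joint[OF lam_measurable m], of "\<lambda>\<omega>. (\<omega>, t)" past] by simp
  \<comment> \<open>Off \<open>good\<close> the path \<open>Xg\<close> is the zero path, so the
    condition there is deterministic.\<close>
  have eq: "clock lam (Xg \<omega>) k t < s \<longleftrightarrow>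
      (if \<omega> \<in> good then \<exists>n0. \<forall>n\<ge>n0. clock lam (?z \<omega> n) k t < s else clock lam (\<lambda>_. 0) k t < s)" for \<omega>
  proof (cases "\<omega> \<in> good")
    case True
    then show ?thesis
      using clock_less_iff_stopped[OF Xg_rtc_path[OF True] Yg_mono Yg_right_cont t s, of k]
      by (simp add: eventually_sequentially)
  qed (simp add: Xg_def[abs_def])
  have "{\<omega>\<in>space past. (if \<omega> \<in> good then \<exists>n0. \<forall>n\<ge>n0. clock lam (?z \<omega> n) k t < s
      else clock lam (\<lambda>_. 0) k t < s)} \<in> sets past"
    by measurable
  then show ?thesis unfolding eq space_past .
qed

end

end

section \<open>Error recursion\<close>

lemma set_integral_Icc_grid:
  fixes u :: "real \<Rightarrow> 'b::euclidean_space"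
  assumes "\<And>a b. set_integrable lborel {a..b} u" "0 \<le> h"
  shows "(LBINT s:{0..real n * h}. u s) = (\<Sum>m<n. LBINT s:{real m * h..real (Suc m) * h}. u s)"
proof (induction n)
  case (Suc n)
  have "(LBINT s:{0..real (Suc n) * h}. u s) =
      (LBINT s:{0..real n * h}. u s) + (LBINT s:{real n * h..real (Suc n) * h}. u s)"
    using assms(2) by (intro set_integral_Icc_split[OF assms(1)] mult_right_mono) auto
  with Suc show ?case by simp
qed (simp add: set_integral_singleton)

lemma (in scheme_data) scheme_clock_sum: "snd (scheme y x0 n) k = (\<Sum>m<n. h * \<phi>3 k (fst (scheme y x0 m)))"
  by (induction n) (simp_all add: case_prod_beta' Let_def)

text \<open>The Poisson terms telescope because each step starts at the internal time where the
  previous one ended; only the current clock and time 0 remain.\<close>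

lemma (in scheme_data) scheme_state_sum:
  "fst (scheme y x0 n) = x0 + (\<Sum>m<n. h *\<^sub>R \<phi>1 (fst (scheme y x0 m)) (fst (scheme y x0 (Suc m)))) +
     (\<Sum>k\<in>UNIV. (real (y k (snd (scheme y x0 n) k)) - real (y k 0)) *\<^sub>R \<nu> k)"
proof (induction n)
  case (Suc n)
  let ?x = "fst (scheme y x0 n)" and ?\<tau> = "snd (scheme y x0 n)" and ?x' = "fst (scheme y x0 (Suc n))"
    and ?\<tau>' = "snd (scheme y x0 (Suc n))"
  have \<tau>': "?\<tau>' k = ?\<tau> k + h * \<phi>3 k ?x" for k by (simp add: case_prod_beta' Let_def)
  define v where "v = ?x + (\<Sum>k\<in>UNIV. (real (y k (?\<tau>' k)) - real (y k (?\<tau> k))) *\<^sub>R \<nu> k)"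
  have "?x' = implicit_step ?x v"
    unfolding v_def \<tau>' by (simp add: case_prod_beta' Let_def)
  then have "?x' = v + h *\<^sub>R \<phi>1 ?x ?x'" using implicit_step[of ?x v] by simp
  moreover have "v = x0 + (\<Sum>m<n. h *\<^sub>R \<phi>1 (fst (scheme y x0 m)) (fst (scheme y x0 (Suc m)))) +
     (\<Sum>k\<in>UNIV. (real (y k (?\<tau>' k)) - real (y k 0)) *\<^sub>R \<nu> k)"
    unfolding v_def by (subst Suc) (simp add: sum.distrib[symmetric] scaleR_left_distrib[symmetric] add.assoc)
  ultimately show ?case by (simp add: algebra_simps del: scheme.simps)
qed simp

text \<open>The induction bounds the right-hand side, which grows at most by the factor 1 + b per
  step, instead of \<open>e\<close> itself.\<close>

lemma ennreal_gronwall: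
  fixes e :: "nat \<Rightarrow> ennreal"
  assumes "\<And>n. n \<le> N \<Longrightarrow> e n \<le> a + b * (\<Sum>m<n. e m)" "n \<le> N"
  shows "e n \<le> a * (1 + b) ^ n"
proof -
  have "a + b * (\<Sum>m<n. e m) \<le> a * (1 + b) ^ n" using \<open>n \<le> N\<close>
  proof (induction n)
    case (Suc n)
    have "a + b * (\<Sum>m<Suc n. e m) = (a + b * (\<Sum>m<n. e m)) + b * e n"
      by (simp add: distrib_left add.assoc)
    also have "\<dots> \<le> (a + b * (\<Sum>m<n. e m)) + b * (a + b * (\<Sum>m<n. e m))"
      using assms(1)[of n] Suc.prems by (intro add_left_mono mult_left_mono) auto
    also have "\<dots> = (a + b * (\<Sum>m<n. e m)) * (1 + b)" by (simp add: algebra_simps)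
    also have "\<dots> \<le> a * (1 + b) ^ n * (1 + b)" using Suc by (intro mult_right_mono) auto
    finally show ?case by (simp add: algebra_simps)
  qed simp
  with assms(1)[OF assms(2)] show ?thesis by (rule order_trans)
qed

section \<open>Solution and scheme on the same probability space; errors along a path\<close>

locale rtc_scheme = rtc_setting M f lam \<nu> C B \<Lambda> Y X T + scheme_data \<phi>1 \<phi>3 \<nu> h L1 L2 L3
  for M :: "'w measure" and f :: "real ^ 'd \<Rightarrow> real ^ 'd" and lam :: "'k::finite \<Rightarrow> real ^ 'd \<Rightarrow> real"
    and \<nu> :: "'k \<Rightarrow> real ^ 'd" and C B \<Lambda> :: real
    and Y :: "'k \<Rightarrow> real \<Rightarrow> 'w \<Rightarrow> nat" and X :: "real \<Rightarrow> 'w \<Rightarrow> real ^ 'd" and T :: real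
    and \<phi>1 :: "real ^ 'd \<Rightarrow> real ^ 'd \<Rightarrow> real ^ 'd" and \<phi>3 :: "'k \<Rightarrow> real ^ 'd \<Rightarrow> real"
    and h L1 L2 :: real and L3 :: "'k \<Rightarrow> real"
begin

abbreviation "scheme_state \<omega> n \<equiv> fst (scheme (Yg \<omega>) (X 0 \<omega>) n)"
abbreviation "scheme_clock \<omega> n k \<equiv> snd (scheme (Yg \<omega>) (X 0 \<omega>) n) k"
abbreviation "exact_clock \<omega> t k \<equiv> clock lam (Xg \<omega>) k t"

lemma X0_measurable: "X 0 \<in> borel_measurable M"
  using T_pos by (intro X_measurable) auto

lemma scheme_state_measurable[measurable]: "(\<lambda>\<omega>. scheme_state \<omega> n) \<in> borel_measurable M"
  by (intro measurable_scheme Yg_joint X0_measurable)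

lemma scheme_clock_measurable[measurable]: "(\<lambda>\<omega>. scheme_clock \<omega> n k) \<in> borel_measurable M"
  by (intro measurable_scheme Yg_joint X0_measurable)

lemma exact_clock_measurable[measurable]: "(\<lambda>\<omega>. exact_clock \<omega> t k) \<in> borel_measurable M"
  using measurable_compose[OF _ measurable_clock_joint[OF lam_measurable Xg_joint], of "\<lambda>\<omega>. (\<omega>, t)" M] by simp

lemma scheme_clock_less_past:
  assumes s: "0 \<le> s"
  shows "{\<omega>\<in>space M. scheme_clock \<omega> n k < s} \<in> sets (channel_past Y (X 0) k s)"
proof -
  have [measurable]: "(\<lambda>\<omega>. snd (scheme (stop_channel k s (Yg \<omega>)) (X 0 \<omega>) n) k)
      \<in> borel_measurable (channel_past Y (X 0) k s)"
    by (intro measurable_scheme stopped_past_joint[OF s] channel_past_measurable_X0[OF Y X0_indep s])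
  have "{\<omega>\<in>space (channel_past Y (X 0) k s). snd (scheme (stop_channel k s (Yg \<omega>)) (X 0 \<omega>) n) k < s}
      \<in> sets (channel_past Y (X 0) k s)" by measurable
  then show ?thesis unfolding space_past[OF s] by (subst scheme_clock_less_iff_stopped)
qed

text \<open>The event \<open>D\<close> is decided by the past, so the later increment keeps its
  Poisson mean, which for unit rate is s' - s.\<close>

lemma Yg_mean_increment:
  assumes D: "D \<in> sets (channel_past Y (X 0) k s)" and s: "0 \<le> s" "s < s'"
  shows "(\<integral>\<^sup>+\<omega>. indicator D \<omega> * ennreal (real (Yg \<omega> k s' - Yg \<omega> k s)) \<partial>M) = emeasure M D * ennreal (s' - s)"
proof -
  let ?V = "\<lambda>\<omega>. Y k s' \<omega> - Y k s \<omega>"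
  have s': "0 \<le> s'" using s by simp
  have [measurable]: "Y k s \<in> measurable M (count_space UNIV)" "Y k s' \<in> measurable M (count_space UNIV)"
    using s by (auto intro!: Y_measurable[OF Y X0_indep])
  have V: "?V \<in> measurable M (count_space UNIV)" by measurable
  have "(\<integral>\<^sup>+\<omega>. indicator D \<omega> * ennreal (real (Yg \<omega> k s' - Yg \<omega> k s)) \<partial>M) =
      (\<integral>\<^sup>+\<omega>. indicator D \<omega> * ennreal (real (?V \<omega>)) \<partial>M)"
    using AE_good by (intro nn_integral_cong_AE) (auto elim!: eventually_mono simp: Yg_eq s s')
  also have "\<dots> = emeasure M D * (\<integral>\<^sup>+\<omega>. ennreal (real (?V \<omega>)) \<partial>M)"
    by (rule nn_integral_indep_nat[OF channel_past_indep(1)[OF Y X0_indep D s] V channel_past_indep(2)[OF Y X0_indep D s]])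
  also have "(\<integral>\<^sup>+\<omega>. ennreal (real (?V \<omega>)) \<partial>M) = (\<integral>\<^sup>+n. ennreal (real n) \<partial>distr M (count_space UNIV) ?V)"
    by (rule nn_integral_distr[OF V, symmetric]) simp
  also have "distr M (count_space UNIV) ?V = measure_pmf (poisson_pmf (s' - s))"
  proof -
    have "poisson_process M (Y k)" using Y unfolding indep_poisson_processes_def by simp
    then have "\<forall>s t. 0 \<le> s \<longrightarrow> s < t \<longrightarrow>
        distr M (count_space UNIV) (\<lambda>\<omega>. Y k t \<omega> - Y k s \<omega>) = measure_pmf (poisson_pmf (t - s))"
      unfolding poisson_process_def by (elim conjE)
    then show ?thesis using s by simp
  qed
  also have "(\<integral>\<^sup>+n. ennreal (real n) \<partial>measure_pmf (poisson_pmf (s' - s))) = ennreal (s' - s)"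
    using s by (intro nn_integral_poisson_pmf) simp
  finally show ?thesis .
qed

text \<open>The past of channel k decides for each clock whether it lies below s, hence also whether
  exactly one of them does, by a symmetric difference. This is the condition under which optional
  stopping was proved.\<close>

lemma counts_diff_le_clock_diff:
  assumes t: "0 \<le> t" "t \<le> T"
  shows "(\<integral>\<^sup>+\<omega>. ennreal \<bar>real (Yg \<omega> k (exact_clock \<omega> t k)) - real (Yg \<omega> k (scheme_clock \<omega> n k))\<bar> \<partial>M)
    \<le> (\<integral>\<^sup>+\<omega>. ennreal \<bar>exact_clock \<omega> t k - scheme_clock \<omega> n k\<bar> \<partial>M)"
proof (rule stopped_counts_diff_le)
  show "(\<lambda>\<omega>. Yg \<omega> k u) \<in> measurable M (count_space UNIV)" for u
    using measurable_compose[OF _ Yg_joint, of "\<lambda>\<omega>. (\<omega>, u)" M] by simp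
  fix s s' :: real assume s: "0 \<le> s" "s < s'"
  let ?E = "{\<omega>\<in>space M. exact_clock \<omega> t k < s}" and ?S = "{\<omega>\<in>space M. scheme_clock \<omega> n k < s}"
  have "{\<omega>\<in>space M. (exact_clock \<omega> t k < s) \<noteq> (scheme_clock \<omega> n k < s)} = (?E - ?S) \<union> (?S - ?E)" by auto
  also have "\<dots> \<in> sets (channel_past Y (X 0) k s)"
    using clock_less_past[OF s(1) t] scheme_clock_less_past[OF s(1)] by (intro sets.Un sets.Diff)
  finally show "(\<integral>\<^sup>+\<omega>. indicator {\<omega>\<in>space M. (exact_clock \<omega> t k < s) \<noteq> (scheme_clock \<omega> n k < s)} \<omega> *
      ennreal (real (Yg \<omega> k s' - Yg \<omega> k s)) \<partial>M) =
    emeasure M {\<omega>\<in>space M. (exact_clock \<omega> t k < s) \<noteq> (scheme_clock \<omega> n k < s)} * ennreal (s' - s)"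
    using s by (rule Yg_mean_increment)
qed (use t in \<open>auto intro!: Yg_mono Yg_right_cont clock_nonneg scheme_clock_nonneg\<close>)

definition drift_residual :: "nat \<Rightarrow> 'w \<Rightarrow> real ^ 'd" where
  "drift_residual m \<omega> = (LBINT s:{real m * h..real (Suc m) * h}. f (Xg \<omega> s)) -
     h *\<^sub>R \<phi>1 (Xg \<omega> (real m * h)) (Xg \<omega> (real (Suc m) * h))"

definition clock_residual :: "nat \<Rightarrow> 'k \<Rightarrow> 'w \<Rightarrow> real" where
  "clock_residual m k \<omega> = (LBINT s:{real m * h..real (Suc m) * h}. lam k (Xg \<omega> s)) -
     h * \<phi>3 k (Xg \<omega> (real m * h))"

definition state_err :: "nat \<Rightarrow> 'w \<Rightarrow> real ^ 'd" where
  "state_err n \<omega> = Xg \<omega> (real n * h) - scheme_state \<omega> n"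

definition count_err :: "nat \<Rightarrow> 'k \<Rightarrow> 'w \<Rightarrow> real" where
  "count_err n k \<omega> = real (Yg \<omega> k (exact_clock \<omega> (real n * h) k)) - real (Yg \<omega> k (scheme_clock \<omega> n k))"

lemma f_integrable: "set_integrable lborel {a..b::real} (\<lambda>s. f (Xg \<omega> s))"
  by (rule set_integrable_bounded_comp[OF f_measurable Xg_path_measurable f_bound])

text \<open>Both processes are written as sums from time 0 and subtracted. The second argument of
  \<phi>1 contributes L2 times the error at the end of each step; only the last step involves the
  error at n itself, and moving that term to the left leaves 1 - h L2.\<close>

lemma state_err_le:
  assumes \<omega>: "\<omega> \<in> good" and n: "real n * h \<le> T"
  shows "(1 - h * L2) * norm (state_err n \<omega>) \<le>
    (\<Sum>m<n. norm (drift_residual m \<omega>)) + h * (L1 + L2) * (\<Sum>m<n. norm (state_err m \<omega>)) +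
    (\<Sum>k\<in>UNIV. norm (\<nu> k) * \<bar>count_err n k \<omega>\<bar>)"
proof -
  let ?x = "scheme_state \<omega>" and ?X = "\<lambda>n. Xg \<omega> (real n * h)"
  have Y0: "Yg \<omega> k 0 = 0" for k using good(3)[OF \<omega>] \<omega> by (simp add: Yg_def regular_def)
  have nh: "0 \<le> real n * h" using h_pos by simp
  have "?X n = X 0 \<omega> + (\<Sum>m<n. LBINT s:{real m * h..real (Suc m) * h}. f (Xg \<omega> s)) +
      (\<Sum>k\<in>UNIV. real (Yg \<omega> k (exact_clock \<omega> (real n * h) k)) *\<^sub>R \<nu> k)"
    using Xg_rtc_path[OF \<omega>, unfolded rtc_path_def, THEN conjunct2, rule_format, OF nh n]
    unfolding set_integral_Icc_grid[OF f_integrable less_imp_le[OF h_pos]] .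
  also have "\<dots> = X 0 \<omega> + (\<Sum>m<n. drift_residual m \<omega> + h *\<^sub>R \<phi>1 (?X m) (?X (Suc m))) +
      (\<Sum>k\<in>UNIV. real (Yg \<omega> k (exact_clock \<omega> (real n * h) k)) *\<^sub>R \<nu> k)"
    by (simp only: drift_residual_def diff_add_cancel)
  finally have X: "?X n = X 0 \<omega> + (\<Sum>m<n. drift_residual m \<omega> + h *\<^sub>R \<phi>1 (?X m) (?X (Suc m))) +
      (\<Sum>k\<in>UNIV. real (Yg \<omega> k (exact_clock \<omega> (real n * h) k)) *\<^sub>R \<nu> k)" .
  have x: "?x n = X 0 \<omega> + (\<Sum>m<n. h *\<^sub>R \<phi>1 (?x m) (?x (Suc m))) +
      (\<Sum>k\<in>UNIV. real (Yg \<omega> k (scheme_clock \<omega> n k)) *\<^sub>R \<nu> k)"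
    using scheme_state_sum[of "Yg \<omega>" "X 0 \<omega>" n] by (simp only: Y0 of_nat_0 diff_zero)
  have eq: "state_err n \<omega> = (\<Sum>m<n. drift_residual m \<omega> + h *\<^sub>R (\<phi>1 (?X m) (?X (Suc m)) - \<phi>1 (?x m) (?x (Suc m)))) +
      (\<Sum>k\<in>UNIV. count_err n k \<omega> *\<^sub>R \<nu> k)"
    unfolding state_err_def X x count_err_def sum.distrib sum_subtractf scaleR_diff_left scaleR_diff_right
    by (simp only: algebra_simps)
  have bound: "norm (state_err n \<omega>) \<le>
      (\<Sum>m<n. norm (drift_residual m \<omega>) + h * (L1 * norm (state_err m \<omega>) + L2 * norm (state_err (Suc m) \<omega>))) +
      (\<Sum>k\<in>UNIV. norm (\<nu> k) * \<bar>count_err n k \<omega>\<bar>)"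
  proof (subst eq, rule norm_triangle_mono; rule sum_norm_le)
    fix m
    have "norm (h *\<^sub>R (\<phi>1 (?X m) (?X (Suc m)) - \<phi>1 (?x m) (?x (Suc m)))) \<le>
        h * (L1 * norm (state_err m \<omega>) + L2 * norm (state_err (Suc m) \<omega>))"
      unfolding state_err_def norm_scaleR abs_of_pos[OF h_pos]
      by (rule mult_left_mono[OF \<phi>1_lip less_imp_le[OF h_pos]])
    then show "norm (drift_residual m \<omega> + h *\<^sub>R (\<phi>1 (?X m) (?X (Suc m)) - \<phi>1 (?x m) (?x (Suc m)))) \<le>
        norm (drift_residual m \<omega>) + h * (L1 * norm (state_err m \<omega>) + L2 * norm (state_err (Suc m) \<omega>))"
      by (rule norm_triangle_le[OF add_left_mono])
  qed (simp add: mult.commute)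
  \<comment> \<open>The shifted sum differs from the sum of the earlier errors by e n - e 0; the
    first term is absorbed on the left, and the second is dropped by its sign.\<close>
  have shift: "(\<Sum>m<n. e (Suc m)) = (\<Sum>m<n. e m) + e n - e 0" for e :: "nat \<Rightarrow> real"
    by (induction n) auto
  have split: "(\<Sum>m<n. d m + h * (L1 * e m + L2 * e (Suc m))) =
      (\<Sum>m<n. d m) + h * L1 * (\<Sum>m<n. e m) + h * L2 * ((\<Sum>m<n. e m) + e n - e 0)" for d e :: "nat \<Rightarrow> real"
    unfolding shift[symmetric] by (simp add: sum.distrib sum_distrib_left distrib_left mult.assoc)
  have arith: "(1 - h * L2) * e \<le> a + h * (L1 + L2) * s + c"
    if "e \<le> a + h * L1 * s + h * L2 * (s + e - e0) + c" "0 \<le> e0" for a c e e0 s :: real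
  proof -
    have lin: "e - q \<le> a + (p + r) + c" if "e \<le> a + p + (r + q - u) + c" "0 \<le> u" for p q r u :: real
      using that by linarith
    have "0 \<le> h * L2 * e0" using h_pos L2_nonneg that(2) by simp
    with that(1) have "e - h * L2 * e \<le> a + (h * L1 * s + h * L2 * s) + c"
      unfolding right_diff_distrib distrib_left by (intro lin)
    then show ?thesis by (simp only: left_diff_distrib distrib_left distrib_right mult_1)
  qed
  show ?thesis
    using bound unfolding split[of "\<lambda>m. norm (drift_residual m \<omega>)" "\<lambda>m. norm (state_err m \<omega>)"]
    by (rule arith) (rule norm_ge_zero)
qed

lemma clock_err_le:
  "\<bar>exact_clock \<omega> (real n * h) k - scheme_clock \<omega> n k\<bar> \<le>
    (\<Sum>m<n. \<bar>clock_residual m k \<omega>\<bar>) + h * L3 k * (\<Sum>m<n. norm (state_err m \<omega>))"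
proof -
  let ?x = "scheme_state \<omega>" and ?X = "\<lambda>n. Xg \<omega> (real n * h)"
  have "exact_clock \<omega> (real n * h) k = (\<Sum>m<n. LBINT s:{real m * h..real (Suc m) * h}. lam k (Xg \<omega> s))"
    unfolding clock_def using h_pos by (intro set_integral_Icc_grid lam_integrable[OF Xg_path_measurable]) simp
  also have "\<dots> = (\<Sum>m<n. clock_residual m k \<omega> + h * \<phi>3 k (?X m))"
    by (simp only: clock_residual_def diff_add_cancel)
  finally have "exact_clock \<omega> (real n * h) k = (\<Sum>m<n. clock_residual m k \<omega> + h * \<phi>3 k (?X m))" .
  then have "exact_clock \<omega> (real n * h) k - scheme_clock \<omega> n k = (\<Sum>m<n. clock_residual m k \<omega> + h * (\<phi>3 k (?X m) - \<phi>3 k (?x m)))"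
    unfolding scheme_clock_sum by (simp only: sum_subtractf[symmetric] right_diff_distrib add_diff_eq)
  then have "\<bar>exact_clock \<omega> (real n * h) k - scheme_clock \<omega> n k\<bar> \<le>
      (\<Sum>m<n. \<bar>clock_residual m k \<omega> + h * (\<phi>3 k (?X m) - \<phi>3 k (?x m))\<bar>)"
    by (simp only: sum_abs)
  also have "\<dots> \<le> (\<Sum>m<n. \<bar>clock_residual m k \<omega>\<bar> + h * (L3 k * norm (state_err m \<omega>)))"
  proof (rule sum_mono)
    fix m
    have "\<bar>h * (\<phi>3 k (?X m) - \<phi>3 k (?x m))\<bar> \<le> h * (L3 k * norm (state_err m \<omega>))"
      unfolding state_err_def abs_mult abs_of_pos[OF h_pos]
      by (rule mult_left_mono[OF \<phi>3_lip less_imp_le[OF h_pos]])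
    then show "\<bar>clock_residual m k \<omega> + h * (\<phi>3 k (?X m) - \<phi>3 k (?x m))\<bar> \<le>
        \<bar>clock_residual m k \<omega>\<bar> + h * (L3 k * norm (state_err m \<omega>))"
      by (rule order_trans[OF abs_triangle_ineq add_left_mono])
  qed
  finally show ?thesis unfolding sum.distrib sum_distrib_left mult.assoc .
qed

end

section \<open>Expected errors and the global bound\<close>

lemma ennreal_le_inverse_mult:
  assumes "ennreal c * x \<le> y" "0 < c"
  shows "x \<le> ennreal (1 / c) * y"
proof -
  have "x = ennreal (1 / c) * (ennreal c * x)"
    using assms(2) by (simp add: mult.assoc[symmetric] ennreal_mult[symmetric])
  also have "\<dots> \<le> ennreal (1 / c) * y" using assms(1) by (rule mult_left_mono) simp
  finally show ?thesis .
qed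

lemma Enorm_cong_AE:
  assumes "AE \<omega> in M. Z \<omega> = Z' \<omega>"
  shows "Enorm M Z = Enorm M Z'"
  unfolding Enorm_def by (intro nn_integral_cong_AE) (use assms in \<open>auto elim!: eventually_mono\<close>)

lemma Enorm_scaleR:
  assumes "Z \<in> borel_measurable M"
  shows "Enorm M (\<lambda>\<omega>. c *\<^sub>R Z \<omega>) = ennreal \<bar>c\<bar> * Enorm M Z"
  using assms unfolding Enorm_def
  by (subst nn_integral_cmult[symmetric]) (auto simp: ennreal_mult)

context rtc_scheme begin

lemma drift_residual_measurable[measurable]: "drift_residual m \<in> borel_measurable M"
proof -
  have upto: "(\<lambda>\<omega>. LBINT s:{0..t}. f (Xg \<omega> s)) \<in> borel_measurable M" for t
    using measurable_set_integral_upto[of "\<lambda>(\<omega>, s). f (Xg \<omega> s)" M "\<lambda>_. t"]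
      measurable_compose[OF Xg_joint f_measurable] by (simp add: case_prod_beta')
  \<comment> \<open>Measurability is available for integrals starting at 0, so the integral over one
    step is written as a difference of two of them.\<close>
  have split: "(LBINT s:{real m * h..real (Suc m) * h}. f (Xg \<omega> s)) =
      (LBINT s:{0..real (Suc m) * h}. f (Xg \<omega> s)) - (LBINT s:{0..real m * h}. f (Xg \<omega> s))" for \<omega>
    using h_pos set_integral_Icc_split[OF f_integrable, of 0 "real m * h" "real (Suc m) * h" \<omega>]
    by (simp add: mult_right_mono)
  have "continuous_on UNIV (\<lambda>p. \<phi>1 (fst p) (snd p))"
  proof (rule lipschitz_on_continuous_on[of "L1 + L2"], rule lipschitz_onI)
    fix p q :: "(real ^ 'd) \<times> (real ^ 'd)"
    have "norm (\<phi>1 (fst p) (snd p) - \<phi>1 (fst q) (snd q)) \<le> L1 * norm (fst p - fst q) + L2 * norm (snd p - snd q)"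
      by (rule \<phi>1_lip)
    also have "\<dots> \<le> L1 * norm (p - q) + L2 * norm (p - q)"
      using norm_fst_le[of "fst p - fst q" "snd p - snd q"] norm_snd_le[of "snd p - snd q" "fst p - fst q"] L1_nonneg L2_nonneg
      by (intro add_mono mult_left_mono) (auto simp: minus_prod_def)
    finally show "dist (\<phi>1 (fst p) (snd p)) (\<phi>1 (fst q) (snd q)) \<le> (L1 + L2) * dist p q"
      by (simp add: dist_norm distrib_right)
  qed (use L1_nonneg L2_nonneg in simp)
  then have "(\<lambda>p. \<phi>1 (fst p) (snd p)) \<in> borel_measurable (borel \<Otimes>\<^sub>M borel)"
    unfolding borel_prod by (rule borel_measurable_continuous_onI)
  from measurable_compose[OF measurable_Pair[OF Xg_measurable Xg_measurable] this]
  have [measurable]: "(\<lambda>\<omega>. \<phi>1 (Xg \<omega> s) (Xg \<omega> t)) \<in> borel_measurable M" for s t by simp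
  note [measurable] = upto
  show ?thesis unfolding drift_residual_def[abs_def] split by measurable
qed

lemma clock_residual_measurable[measurable]: "clock_residual m k \<in> borel_measurable M"
proof -
  have [measurable]: "\<phi>3 k \<in> borel_measurable borel"
    by (intro borel_measurable_continuous_onI lipschitz_on_continuous_on[of "L3 k"] lipschitz_onI)
       (use \<phi>3_lip L3_nonneg in \<open>auto simp: dist_norm\<close>)
  have split: "(LBINT s:{real m * h..real (Suc m) * h}. lam k (Xg \<omega> s)) =
      exact_clock \<omega> (real (Suc m) * h) k - exact_clock \<omega> (real m * h) k" for \<omega>
    using h_pos by (intro clock_diff[symmetric] Xg_path_measurable) (auto intro: mult_right_mono)
  show ?thesis unfolding clock_residual_def[abs_def] split by measurable
qed

lemma state_err_measurable[measurable]: "state_err n \<in> borel_measurable M"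
  unfolding state_err_def[abs_def] by measurable

lemma count_err_measurable[measurable]: "count_err n k \<in> borel_measurable M"
proof -
  have [measurable]: "(\<lambda>\<omega>. Yg \<omega> k (u \<omega>)) \<in> measurable M (count_space UNIV)" if "u \<in> borel_measurable M" for u
    using measurable_compose[OF measurable_Pair[OF measurable_ident that] Yg_joint[of k]] by simp
  show ?thesis unfolding count_err_def[abs_def] by measurable
qed

lemma Enorm_count_err_le:
  assumes "real n * h \<le> T"
  shows "Enorm M (count_err n k) \<le>
    (\<Sum>m<n. Enorm M (clock_residual m k)) + ennreal (h * L3 k) * (\<Sum>m<n. Enorm M (state_err m))"
proof -
  have "Enorm M (count_err n k) \<le> (\<integral>\<^sup>+\<omega>. ennreal \<bar>exact_clock \<omega> (real n * h) k - scheme_clock \<omega> n k\<bar> \<partial>M)"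
    unfolding Enorm_def count_err_def real_norm_def
    using h_pos assms by (intro counts_diff_le_clock_diff) auto
  also have "\<dots> \<le> (\<integral>\<^sup>+\<omega>. (\<Sum>m<n. ennreal (norm (clock_residual m k \<omega>))) +
      ennreal (h * L3 k) * (\<Sum>m<n. ennreal (norm (state_err m \<omega>))) \<partial>M)"
  proof (rule nn_integral_mono)
    fix \<omega>
    have "ennreal \<bar>exact_clock \<omega> (real n * h) k - scheme_clock \<omega> n k\<bar> \<le>
        ennreal ((\<Sum>m<n. \<bar>clock_residual m k \<omega>\<bar>) + h * L3 k * (\<Sum>m<n. norm (state_err m \<omega>)))"
      by (rule ennreal_leI[OF clock_err_le])
    also have "\<dots> = (\<Sum>m<n. ennreal (norm (clock_residual m k \<omega>))) +
      ennreal (h * L3 k) * (\<Sum>m<n. ennreal (norm (state_err m \<omega>)))"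
      using h_pos L3_nonneg[of k] by (subst ennreal_plus) (simp_all add: sum_nonneg ennreal_mult)
    finally show "ennreal \<bar>exact_clock \<omega> (real n * h) k - scheme_clock \<omega> n k\<bar> \<le>
      (\<Sum>m<n. ennreal (norm (clock_residual m k \<omega>))) +
      ennreal (h * L3 k) * (\<Sum>m<n. ennreal (norm (state_err m \<omega>)))" .
  qed
  also have "\<dots> = (\<Sum>m<n. Enorm M (clock_residual m k)) + ennreal (h * L3 k) * (\<Sum>m<n. Enorm M (state_err m))"
    unfolding Enorm_def by (simp add: nn_integral_add nn_integral_sum nn_integral_cmult del: sum_ennreal)
  finally show ?thesis .
qed

lemma Enorm_state_err_le:
  assumes n: "real n * h \<le> T"
  shows "ennreal (1 - h * L2) * Enorm M (state_err n) \<le>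
    (\<Sum>m<n. Enorm M (drift_residual m)) + ennreal (h * (L1 + L2)) * (\<Sum>m<n. Enorm M (state_err m)) +
    (\<Sum>k\<in>UNIV. ennreal (norm (\<nu> k)) * Enorm M (count_err n k))"
proof -
  have "ennreal (1 - h * L2) * Enorm M (state_err n) = (\<integral>\<^sup>+\<omega>. ennreal ((1 - h * L2) * norm (state_err n \<omega>)) \<partial>M)"
    unfolding Enorm_def using h_L2 by (subst nn_integral_cmult[symmetric]) (auto simp: ennreal_mult)
  also have "\<dots> \<le> (\<integral>\<^sup>+\<omega>. (\<Sum>m<n. ennreal (norm (drift_residual m \<omega>))) +
      ennreal (h * (L1 + L2)) * (\<Sum>m<n. ennreal (norm (state_err m \<omega>))) +
      (\<Sum>k\<in>UNIV. ennreal (norm (\<nu> k)) * ennreal (norm (count_err n k \<omega>))) \<partial>M)"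
  proof (rule nn_integral_mono_AE, use AE_good in eventually_elim)
    fix \<omega> assume \<omega>: "\<omega> \<in> good"
    have "ennreal ((1 - h * L2) * norm (state_err n \<omega>)) \<le>
       ennreal ((\<Sum>m<n. norm (drift_residual m \<omega>)) + h * (L1 + L2) * (\<Sum>m<n. norm (state_err m \<omega>)) +
    (\<Sum>k\<in>UNIV. norm (\<nu> k) * \<bar>count_err n k \<omega>\<bar>))"
      by (rule ennreal_leI[OF state_err_le[OF \<omega> n]])
    also have "\<dots> = ennreal (\<Sum>m<n. norm (drift_residual m \<omega>)) + ennreal (h * (L1 + L2) * (\<Sum>m<n. norm (state_err m \<omega>))) +
      ennreal (\<Sum>k\<in>UNIV. norm (\<nu> k) * \<bar>count_err n k \<omega>\<bar>)"
      using h_pos L1_nonneg L2_nonneg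
      by (intro ennreal_plus[THEN trans] arg_cong2[where f = plus] ennreal_plus refl add_nonneg_nonneg sum_nonneg mult_nonneg_nonneg) auto
    also have "\<dots> = (\<Sum>m<n. ennreal (norm (drift_residual m \<omega>))) +
      ennreal (h * (L1 + L2)) * (\<Sum>m<n. ennreal (norm (state_err m \<omega>))) +
      (\<Sum>k\<in>UNIV. ennreal (norm (\<nu> k)) * ennreal (norm (count_err n k \<omega>)))"
      using h_pos L1_nonneg L2_nonneg by (simp add: sum_nonneg ennreal_mult sum_ennreal[symmetric] del: sum_ennreal)
    finally show "ennreal ((1 - h * L2) * norm (state_err n \<omega>)) \<le> \<dots>" .
  qed
  also have "\<dots> = (\<Sum>m<n. Enorm M (drift_residual m)) + ennreal (h * (L1 + L2)) * (\<Sum>m<n. Enorm M (state_err m)) +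
    (\<Sum>k\<in>UNIV. ennreal (norm (\<nu> k)) * Enorm M (count_err n k))"
    unfolding Enorm_def by (simp add: nn_integral_add nn_integral_sum nn_integral_cmult del: sum_ennreal)
  finally show ?thesis .
qed

text \<open>The quadrature errors enter channel by channel because each Poisson process is compared
  with itself. \<open>residual_eq\<close> and \<open>residual_le_jump_err\<close> connect this
  quantity with the errors in the theorem.\<close>

definition residual :: "nat \<Rightarrow> ennreal" where
  "residual m = Enorm M (drift_residual m) + (\<Sum>k\<in>UNIV. ennreal (norm (\<nu> k)) * Enorm M (clock_residual m k))"

text \<open>The rate for Gronwall's inequality: h times it multiplies the sum of the earlier errors.
  L1 and L2 stem from the drift, the weighted sum from the clocks.\<close>

definition growth :: real where
  "growth = L1 + L2 + (\<Sum>k\<in>UNIV. norm (\<nu> k) * L3 k)"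

lemma growth_nonneg: "0 \<le> growth"
  unfolding growth_def using L1_nonneg L2_nonneg L3_nonneg by (intro add_nonneg_nonneg sum_nonneg mult_nonneg_nonneg) auto

lemma Enorm_state_err_recursion:
  assumes n: "real n * h \<le> T"
  shows "ennreal (1 - h * L2) * Enorm M (state_err n) \<le>
    (\<Sum>m<n. residual m) + ennreal (h * growth) * (\<Sum>m<n. Enorm M (state_err m))"
proof -
  let ?e = "\<Sum>m<n. Enorm M (state_err m)"
  have "ennreal (1 - h * L2) * Enorm M (state_err n) \<le>
    (\<Sum>m<n. Enorm M (drift_residual m)) + ennreal (h * (L1 + L2)) * ?e +
    (\<Sum>k\<in>UNIV. ennreal (norm (\<nu> k)) * Enorm M (count_err n k))"
    by (rule Enorm_state_err_le[OF n])
  also have "\<dots> \<le> (\<Sum>m<n. Enorm M (drift_residual m)) + ennreal (h * (L1 + L2)) * ?e +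
    (\<Sum>k\<in>UNIV. ennreal (norm (\<nu> k)) * ((\<Sum>m<n. Enorm M (clock_residual m k)) + ennreal (h * L3 k) * ?e))"
    by (intro add_left_mono sum_mono mult_left_mono Enorm_count_err_le n) auto
  also have "(\<Sum>k\<in>UNIV. ennreal (norm (\<nu> k)) * ((\<Sum>m<n. Enorm M (clock_residual m k)) + ennreal (h * L3 k) * ?e)) =
      (\<Sum>m<n. \<Sum>k\<in>UNIV. ennreal (norm (\<nu> k)) * Enorm M (clock_residual m k)) +
      (\<Sum>k\<in>UNIV. ennreal (norm (\<nu> k)) * ennreal (h * L3 k)) * ?e"
    unfolding distrib_left sum.distrib sum_distrib_left sum_distrib_right mult.assoc
    by (intro arg_cong2[where f = plus] sum.swap)
  also have "(\<Sum>k\<in>UNIV. ennreal (norm (\<nu> k)) * ennreal (h * L3 k)) = ennreal (h * (\<Sum>k\<in>UNIV. norm (\<nu> k) * L3 k))"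
    using h_pos L3_nonneg by (simp add: ennreal_mult[symmetric] sum_distrib_left mult_ac)
  finally have "ennreal (1 - h * L2) * Enorm M (state_err n) \<le>
    (\<Sum>m<n. residual m) + (ennreal (h * (L1 + L2)) + ennreal (h * (\<Sum>k\<in>UNIV. norm (\<nu> k) * L3 k))) * ?e"
    by (simp add: residual_def sum.distrib distrib_right add_ac)
  also have "ennreal (h * (L1 + L2)) + ennreal (h * (\<Sum>k\<in>UNIV. norm (\<nu> k) * L3 k)) = ennreal (h * growth)"
    using h_pos L1_nonneg L2_nonneg L3_nonneg
    by (subst ennreal_plus[symmetric]) (auto simp: growth_def distrib_left sum_nonneg)
  finally show ?thesis .
qed

text \<open>At most N local errors of size \<open>W\<close> accumulate, and N = T/h is the origin of
  the factor 1/h. Dividing by \<open>c\<close> instead of 1 - h L2 makes the constant uniform in h;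
  Gronwall's factor (1 + h growth/c)^n is at most exp(growth T/c) because n h \<le> T.\<close>

lemma Enorm_state_err_global:
  assumes N: "real N * h = T" and c: "0 < c" "c \<le> 1 - h * L2"
    and W: "\<And>m. m < N \<Longrightarrow> residual m \<le> W" and n: "n \<le> N"
  shows "Enorm M (state_err n) \<le> ennreal (T / c * exp (growth * T / c) * inverse h) * W"
proof -
  let ?a = "ennreal (1 / c) * (of_nat N * W)" and ?b = "ennreal (1 / c) * ennreal (h * growth)"
  have "Enorm M (state_err n) \<le> ?a * (1 + ?b) ^ n"
  proof (rule ennreal_gronwall[OF _ n])
    fix n assume n: "n \<le> N"
    have nT: "real n * h \<le> T" using n h_pos N by (metis mult_right_mono less_imp_le of_nat_le_iff)
    have "ennreal c * Enorm M (state_err n) \<le> ennreal (1 - h * L2) * Enorm M (state_err n)"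
      using c by (intro mult_right_mono ennreal_leI) auto
    also have "\<dots> \<le> (\<Sum>m<n. residual m) + ennreal (h * growth) * (\<Sum>m<n. Enorm M (state_err m))"
      by (rule Enorm_state_err_recursion[OF nT])
    also have "(\<Sum>m<n. residual m) \<le> of_nat (card {..<n}) * W"
      using W n by (intro sum_bounded_above) auto
    also have "of_nat (card {..<n}) * W \<le> of_nat N * W" using n by (intro mult_right_mono) auto
    finally have "ennreal c * Enorm M (state_err n) \<le>
        of_nat N * W + ennreal (h * growth) * (\<Sum>m<n. Enorm M (state_err m))"
      by (simp add: add_right_mono)
    from ennreal_le_inverse_mult[OF this c(1)]
    show "Enorm M (state_err n) \<le> ?a + ?b * (\<Sum>m<n. Enorm M (state_err m))"
      by (simp add: distrib_left mult.assoc)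
  qed
  also have "(1 + ?b) ^ n \<le> ennreal (exp (growth * T / c))"
  proof -
    have pos: "0 \<le> h * growth / c" using h_pos growth_nonneg c by simp
    have "1 + ?b = ennreal (1 + h * growth / c)"
      using h_pos growth_nonneg c by (simp add: ennreal_mult[symmetric])
    also have "\<dots> ^ n = ennreal ((1 + h * growth / c) ^ n)" using pos by (intro ennreal_power) simp
    also have "\<dots> \<le> ennreal (exp (h * growth / c) ^ n)"
      using pos by (intro ennreal_leI power_mono exp_ge_add_one_self) auto
    also have "exp (h * growth / c) ^ n = exp (real n * (h * growth / c))"
      by (rule exp_of_nat_mult[symmetric])
    also have "\<dots> \<le> exp (real N * (h * growth / c))"
      using mult_right_mono[OF of_nat_mono[OF n] pos] by simp
    also have "real N * (h * growth / c) = growth * T / c" by (simp add: N[symmetric])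
    finally show ?thesis by (simp add: ennreal_leI)
  qed
  also have "?a * ennreal (exp (growth * T / c)) = ennreal (T / c * exp (growth * T / c) * inverse h) * W"
  proof -
    have "T * inverse h = real N" using N h_pos by (simp add: field_simps)
    then have *: "T / c * exp (growth * T / c) * inverse h = 1 / c * real N * exp (growth * T / c)"
      by (simp add: divide_inverse mult_ac)
    have "ennreal (1 / c * real N * exp (growth * T / c)) = ennreal (1 / c) * of_nat N * ennreal (exp (growth * T / c))"
      using c by (simp add: ennreal_mult[symmetric] ennreal_of_nat_eq_real_of_nat)
    then show ?thesis unfolding * by (simp only: mult_ac)
  qed
  finally show ?thesis by (simp add: mult_left_mono)
qed

section \<open>Transfer to the method and the errors as originally defined\<close>

lemma maruyama_path_scheme:
  assumes \<omega>: "\<omega> \<in> good" and \<Phi>1: "\<And>x y. \<Phi>1 x y h = \<phi>1 x y" and \<Phi>3: "\<And>k x. \<Phi>3 k x h = \<phi>3 k x"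
  shows "maruyama_path (\<lambda>k t. Y k t \<omega>) \<nu> \<Phi>1 \<Phi>3 h N (X 0 \<omega>) (scheme_state \<omega>) (\<lambda>k n. scheme_clock \<omega> n k)"
proof -
  have "scheme_state \<omega> (Suc n) = scheme_state \<omega> n + h *\<^sub>R \<phi>1 (scheme_state \<omega> n) (scheme_state \<omega> (Suc n)) +
      (\<Sum>k\<in>UNIV. (real (Y k (scheme_clock \<omega> n k + h * \<phi>3 k (scheme_state \<omega> n)) \<omega>) - real (Y k (scheme_clock \<omega> n k) \<omega>)) *\<^sub>R \<nu> k)" for n
  proof -
    let ?v = "scheme_state \<omega> n + (\<Sum>k\<in>UNIV. (real (Yg \<omega> k (scheme_clock \<omega> n k + h * \<phi>3 k (scheme_state \<omega> n))) -
        real (Yg \<omega> k (scheme_clock \<omega> n k))) *\<^sub>R \<nu> k)"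
    have x: "scheme_state \<omega> (Suc n) = implicit_step (scheme_state \<omega> n) ?v"
      by (simp add: case_prod_beta' Let_def)
    \<comment> \<open>The recursion reads the channels at nonnegative times only, where
      \<open>Yg\<close> and \<open>Y\<close> agree.\<close>
    have "0 \<le> scheme_clock \<omega> n k" "0 \<le> scheme_clock \<omega> n k + h * \<phi>3 k (scheme_state \<omega> n)" for k
      using scheme_clock_nonneg h_pos \<phi>3_nonneg by (auto intro!: add_nonneg_nonneg)
    then have "?v = scheme_state \<omega> n + (\<Sum>k\<in>UNIV. (real (Y k (scheme_clock \<omega> n k + h * \<phi>3 k (scheme_state \<omega> n)) \<omega>) -
        real (Y k (scheme_clock \<omega> n k) \<omega>)) *\<^sub>R \<nu> k)"
      by (simp only: Yg_eq[OF \<omega>])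
    then have "?v + h *\<^sub>R \<phi>1 (scheme_state \<omega> n) (scheme_state \<omega> (Suc n)) = scheme_state \<omega> n + h *\<^sub>R \<phi>1 (scheme_state \<omega> n) (scheme_state \<omega> (Suc n)) +
      (\<Sum>k\<in>UNIV. (real (Y k (scheme_clock \<omega> n k + h * \<phi>3 k (scheme_state \<omega> n)) \<omega>) - real (Y k (scheme_clock \<omega> n k) \<omega>)) *\<^sub>R \<nu> k)"
      by (simp only: add_ac)
    with implicit_step[of "scheme_state \<omega> n" ?v, folded x] show ?thesis by (rule trans)
  qed
  moreover have "scheme_clock \<omega> (Suc n) k = scheme_clock \<omega> n k + h * \<phi>3 k (scheme_state \<omega> n)" for n k
    by (simp add: case_prod_beta' Let_def)
  ultimately show ?thesis
    unfolding maruyama_path_def \<Phi>1 \<Phi>3 by (intro conjI allI impI) (assumption | simp del: scheme.simps(2))+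
qed

lemma maruyama_path_unique:
  assumes \<omega>: "\<omega> \<in> good" and \<Phi>1: "\<And>x y. \<Phi>1 x y h = \<phi>1 x y" and \<Phi>3: "\<And>k x. \<Phi>3 k x h = \<phi>3 k x"
    and path: "maruyama_path (\<lambda>k t. Y k t \<omega>) \<nu> \<Phi>1 \<Phi>3 h N (X 0 \<omega>) x \<tau>" and "n \<le> N"
  shows "x n = scheme_state \<omega> n \<and> (\<forall>k. \<tau> k n = scheme_clock \<omega> n k)"
  using \<open>n \<le> N\<close>
proof (induction n)
  case 0
  then show ?case using path by (simp add: maruyama_path_def)
next
  case (Suc n)
  then have IH: "x n = scheme_state \<omega> n" "\<And>k. \<tau> k n = scheme_clock \<omega> n k" and n: "n < N" by auto
  have \<tau>: "\<tau> k (Suc n) = \<tau> k n + h * \<phi>3 k (x n)" for k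
    using path n unfolding maruyama_path_def \<Phi>3 by blast
  have x: "x (Suc n) = x n + h *\<^sub>R \<phi>1 (x n) (x (Suc n)) +
      (\<Sum>k\<in>UNIV. (real (Y k (\<tau> k n + h * \<phi>3 k (x n)) \<omega>) - real (Y k (\<tau> k n) \<omega>)) *\<^sub>R \<nu> k)"
    using path n unfolding maruyama_path_def \<Phi>1 \<Phi>3 by blast
  have nonneg: "0 \<le> \<tau> k n" "0 \<le> \<tau> k n + h * \<phi>3 k (x n)" for k
    using scheme_clock_nonneg h_pos \<phi>3_nonneg by (auto intro!: add_nonneg_nonneg simp: IH)
  let ?v = "x n + (\<Sum>k\<in>UNIV. (real (Yg \<omega> k (\<tau> k n + h * \<phi>3 k (x n))) - real (Yg \<omega> k (\<tau> k n))) *\<^sub>R \<nu> k)"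
  have "x (Suc n) = ?v + h *\<^sub>R \<phi>1 (x n) (x (Suc n))"
    unfolding Yg_eq[OF \<omega> nonneg(1)] Yg_eq[OF \<omega> nonneg(2)] by (rule trans[OF x]) (simp only: add_ac)
  then have "x (Suc n) = implicit_step (x n) ?v" by (rule implicit_step_unique)
  then show ?case using \<tau> by (simp add: IH case_prod_beta' Let_def)
qed

lemma gridpt_eq: "h = T / real N \<Longrightarrow> gridpt T N n = real n * h"
  by (simp add: gridpt_def)

lemma gridpt_le: "h = T / real N \<Longrightarrow> n \<le> N \<Longrightarrow> real n * h \<le> T"
  using T_pos mult_right_mono[of "real n" "real N" h] h_pos by (cases "N = 0") simp_all

lemma Enorm_drift_err:
  assumes h: "h = T / real N" and \<Phi>1: "\<And>x y. \<Phi>1 x y h = \<phi>1 x y" and m: "m < N"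
  shows "Enorm M (drift_err T f \<Phi>1 X N m) = Enorm M (drift_residual m)"
proof (rule Enorm_cong_AE, use AE_good in eventually_elim)
  fix \<omega> assume \<omega>: "\<omega> \<in> good"
  have T: "real m * h \<le> T" "real (Suc m) * h \<le> T" "0 \<le> real m * h" "0 \<le> real (Suc m) * h"
    using gridpt_le[OF h, of m] gridpt_le[OF h, of "Suc m"] m h_pos by (simp_all del: of_nat_Suc)
  have "(LBINT s:{real m * h..real (Suc m) * h}. f (X s \<omega>)) = (LBINT s:{real m * h..real (Suc m) * h}. f (Xg \<omega> s))"
    using T by (intro set_lebesgue_integral_cong) (auto simp: Xg_eq[OF \<omega>] simp del: of_nat_Suc)
  then show "drift_err T f \<Phi>1 X N m \<omega> = drift_residual m \<omega>"
    unfolding drift_err_def drift_residual_def gridpt_eq[OF h] h[symmetric] \<Phi>1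
      Xg_eq[OF \<omega> T(3) T(1)] Xg_eq[OF \<omega> T(4) T(2)] by simp
qed

lemma channel_err_eq:
  assumes h: "h = T / real N" and \<Phi>3: "\<And>k x. \<Phi>3 k x h = \<phi>3 k x" and m: "m < N" and \<omega>: "\<omega> \<in> good"
  shows "channel_err T \<nu> lam \<Phi>3 X N m k \<omega> = clock_residual m k \<omega> *\<^sub>R \<nu> k"
proof -
  have T: "real m * h \<le> T" "real (Suc m) * h \<le> T" "0 \<le> real m * h" "0 \<le> real (Suc m) * h"
    using gridpt_le[OF h, of m] gridpt_le[OF h, of "Suc m"] m h_pos by (simp_all del: of_nat_Suc)
  have "(LBINT s:{real m * h..real (Suc m) * h}. lam k (X s \<omega>)) = (LBINT s:{real m * h..real (Suc m) * h}. lam k (Xg \<omega> s))"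
    using T by (intro set_lebesgue_integral_cong) (auto simp: Xg_eq[OF \<omega>] simp del: of_nat_Suc)
  then show ?thesis
    unfolding channel_err_def clock_residual_def gridpt_eq[OF h] h[symmetric] \<Phi>3 Xg_eq[OF \<omega> T(3) T(1)] by simp
qed

lemma residual_eq:
  assumes "h = T / real N" "\<And>x y. \<Phi>1 x y h = \<phi>1 x y" "\<And>k x. \<Phi>3 k x h = \<phi>3 k x" "m < N"
  shows "residual m = Enorm M (drift_err T f \<Phi>1 X N m) + (\<Sum>k\<in>UNIV. Enorm M (channel_err T \<nu> lam \<Phi>3 X N m k))"
proof -
  have "Enorm M (channel_err T \<nu> lam \<Phi>3 X N m k) = ennreal (norm (\<nu> k)) * Enorm M (clock_residual m k)" for k
  proof -
    have "Enorm M (channel_err T \<nu> lam \<Phi>3 X N m k) = Enorm M (\<lambda>\<omega>. norm (\<nu> k) *\<^sub>R clock_residual m k \<omega>)"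
      unfolding Enorm_def
      by (intro nn_integral_cong_AE, use AE_good in eventually_elim)
         (simp add: channel_err_eq[where ?\<Phi>3.0 = \<Phi>3, OF assms(1,3,4)] abs_mult)
    then show ?thesis by (simp only: Enorm_scaleR[OF clock_residual_measurable] abs_norm_cancel)
  qed
  then show ?thesis unfolding residual_def by (simp add: Enorm_drift_err[where ?\<Phi>1.0 = \<Phi>1, OF assms(1,2,4)])
qed

text \<open>The bound with \<open>K\<close> holds for all coefficients, so it is applied to the
  clock residuals at each sample point before integration. As K is at least 1, the drift error can
  share the factor.\<close>

lemma residual_le_jump_err:
  assumes "h = T / real N" "\<And>x y. \<Phi>1 x y h = \<phi>1 x y" "\<And>k x. \<Phi>3 k x h = \<phi>3 k x" "m < N"
    and K: "1 \<le> K" "\<And>a. (\<Sum>k\<in>UNIV. norm (a k *\<^sub>R \<nu> k)) \<le> K * norm (\<Sum>k\<in>UNIV. a k *\<^sub>R \<nu> k)"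
  shows "residual m \<le> ennreal K * (Enorm M (drift_err T f \<Phi>1 X N m) + Enorm M (jump_err T \<nu> lam \<Phi>3 X N m))"
proof -
  let ?J = "\<lambda>\<omega>. \<Sum>k\<in>UNIV. clock_residual m k \<omega> *\<^sub>R \<nu> k"
  have jump: "Enorm M (jump_err T \<nu> lam \<Phi>3 X N m) = Enorm M ?J"
    by (rule Enorm_cong_AE, use AE_good in eventually_elim)
       (simp add: jump_err_def channel_err_eq[where ?\<Phi>3.0 = \<Phi>3, OF assms(1,3,4)])
  have "(\<Sum>k\<in>UNIV. ennreal (norm (\<nu> k)) * Enorm M (clock_residual m k)) =
      (\<integral>\<^sup>+\<omega>. (\<Sum>k\<in>UNIV. ennreal (norm (\<nu> k)) * ennreal (norm (clock_residual m k \<omega>))) \<partial>M)"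
    unfolding Enorm_def by (simp add: nn_integral_sum nn_integral_cmult del: sum_ennreal)
  also have "\<dots> \<le> (\<integral>\<^sup>+\<omega>. ennreal K * ennreal (norm (?J \<omega>)) \<partial>M)"
  proof (rule nn_integral_mono)
    fix \<omega>
    have "(\<Sum>k\<in>UNIV. ennreal (norm (\<nu> k)) * ennreal (norm (clock_residual m k \<omega>))) =
        ennreal (\<Sum>k\<in>UNIV. norm (clock_residual m k \<omega> *\<^sub>R \<nu> k))"
      by (simp add: ennreal_mult[symmetric] mult.commute)
    also have "\<dots> \<le> ennreal (K * norm (?J \<omega>))" by (rule ennreal_leI[OF K(2)])
    also have "\<dots> = ennreal K * ennreal (norm (?J \<omega>))" using K(1) by (simp add: ennreal_mult)
    finally show "(\<Sum>k\<in>UNIV. ennreal (norm (\<nu> k)) * ennreal (norm (clock_residual m k \<omega>))) \<le>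
        ennreal K * ennreal (norm (?J \<omega>))" .
  qed
  also have "\<dots> = ennreal K * Enorm M ?J"
    unfolding Enorm_def by (rule nn_integral_cmult) measurable
  finally have *: "(\<Sum>k\<in>UNIV. ennreal (norm (\<nu> k)) * Enorm M (clock_residual m k)) \<le> ennreal K * Enorm M ?J" .
  have "Enorm M (drift_residual m) = 1 * Enorm M (drift_residual m)" by simp
  also have "\<dots> \<le> ennreal K * Enorm M (drift_residual m)"
    using K(1) by (intro mult_right_mono) (auto simp: ennreal_1[symmetric] simp del: ennreal_1 intro: ennreal_leI)
  finally have "Enorm M (drift_residual m) \<le> ennreal K * Enorm M (drift_residual m)" .
  from add_mono[OF this *] show ?thesis
    unfolding residual_def jump Enorm_drift_err[where ?\<Phi>1.0 = \<Phi>1, OF assms(1,2,4)] distrib_left .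
qed

lemma maruyama_unique:
  assumes "\<And>x y. \<Phi>1 x y h = \<phi>1 x y" "\<And>k x. \<Phi>3 k x h = \<phi>3 k x"
  shows "maruyama_unique_solution M Y \<nu> \<Phi>1 \<Phi>3 h N (X 0)"
  unfolding maruyama_unique_solution_def
proof (intro exI conjI)
  show "maruyama_solution M Y \<nu> \<Phi>1 \<Phi>3 h N (X 0) (\<lambda>n \<omega>. scheme_state \<omega> n) (\<lambda>k n \<omega>. scheme_clock \<omega> n k)"
    unfolding maruyama_solution_def
    using AE_good by (auto elim!: eventually_mono intro!: maruyama_path_scheme assms)
  show "AE \<omega> in M. \<forall>x \<tau>. maruyama_path (\<lambda>k t. Y k t \<omega>) \<nu> \<Phi>1 \<Phi>3 h N (X 0 \<omega>) x \<tau> \<longrightarrow>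
      (\<forall>n\<le>N. x n = scheme_state \<omega> n \<and> (\<forall>k. \<tau> k n = scheme_clock \<omega> n k))"
    using AE_good
  proof eventually_elim
    case (elim \<omega>)
    show ?case using maruyama_path_unique[where ?\<Phi>1.0 = \<Phi>1 and ?\<Phi>3.0 = \<Phi>3, OF elim assms] by metis
  qed
qed

text \<open>Every version of the numerical solution coincides almost surely with
  \<open>scheme\<close>, so its expected errors are those of \<open>state_err\<close>.\<close>

lemma strong_global_err_le:
  assumes h: "h = T / real N" and N: "1 \<le> N"
    and \<Phi>: "\<And>x y. \<Phi>1 x y h = \<phi>1 x y" "\<And>k x. \<Phi>3 k x h = \<phi>3 k x"
    and sol: "maruyama_solution M Y \<nu> \<Phi>1 \<Phi>3 h N (X 0) Xh \<tau>h"
    and c: "0 < c" "c \<le> 1 - h * L2" and W: "\<And>m. m < N \<Longrightarrow> residual m \<le> W"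
  shows "strong_global_err M T X N Xh \<le> ennreal (T / c * exp (growth * T / c) * inverse h) * W"
  unfolding strong_global_err_def
proof (rule Max.boundedI)
  show "finite ((\<lambda>n. Enorm M (\<lambda>\<omega>. X (gridpt T N n) \<omega> - Xh n \<omega>)) ` {1..N})" by simp
  show "(\<lambda>n. Enorm M (\<lambda>\<omega>. X (gridpt T N n) \<omega> - Xh n \<omega>)) ` {1..N} \<noteq> {}" using N by simp
  fix e assume "e \<in> (\<lambda>n. Enorm M (\<lambda>\<omega>. X (gridpt T N n) \<omega> - Xh n \<omega>)) ` {1..N}"
  then obtain n where n: "n \<le> N" and e: "e = Enorm M (\<lambda>\<omega>. X (gridpt T N n) \<omega> - Xh n \<omega>)" by auto
  have nT: "0 \<le> real n * h" "real n * h \<le> T" using gridpt_le[OF h n] h_pos by auto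
  have "AE \<omega> in M. maruyama_path (\<lambda>k t. Y k t \<omega>) \<nu> \<Phi>1 \<Phi>3 h N (X 0 \<omega>) (\<lambda>n. Xh n \<omega>) (\<lambda>k n. \<tau>h k n \<omega>)"
    using sol unfolding maruyama_solution_def by (elim conjE)
  then have "AE \<omega> in M. X (gridpt T N n) \<omega> - Xh n \<omega> = state_err n \<omega>"
    using AE_good
  proof eventually_elim
    case (elim \<omega>)
    from maruyama_path_unique[where ?\<Phi>1.0 = \<Phi>1 and ?\<Phi>3.0 = \<Phi>3, OF elim(2) \<Phi> elim(1) n]
    show ?case unfolding state_err_def gridpt_eq[OF h] Xg_eq[OF elim(2) nT] by simp
  qed
  then have "e = Enorm M (state_err n)" unfolding e by (rule Enorm_cong_AE)
  moreover have "real N * h = T" using h N by simp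
  ultimately show "e \<le> ennreal (T / c * exp (growth * T / c) * inverse h) * W"
    using Enorm_state_err_global[OF _ c W n] by simp
qed

end

section \<open>Uniform constants and convergence\<close>

text \<open>Once the coefficients of zero vectors are set to 0, absence of cancellation makes the
  map from coefficients to sums injective, and an injective linear map on a finite-dimensional space
  is bounded below.\<close>

lemma no_cancellation_bound:
  fixes \<nu> :: "'k::finite \<Rightarrow> real ^ 'd"
  assumes "no_cancellation \<nu>"
  obtains K where "1 \<le> K" "\<And>a. (\<Sum>k\<in>UNIV. norm (a k *\<^sub>R \<nu> k)) \<le> K * norm (\<Sum>k\<in>UNIV. a k *\<^sub>R \<nu> k)"
proof -
  define F where "F v = (\<Sum>k\<in>UNIV. (v $ k) *\<^sub>R \<nu> k)" for v :: "real ^ 'k"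
  define U where "U = {v :: real ^ 'k. \<forall>k. \<nu> k = 0 \<longrightarrow> v $ k = 0}"
  have U: "subspace U" by (auto simp: U_def subspace_def)
  have "linear F"
    by (rule linearI) (simp_all add: F_def scaleR_left_distrib sum.distrib scaleR_sum_right)
  then have F: "bounded_linear F" by (simp add: linear_conv_bounded_linear)
  have "\<forall>v\<in>U. F v = 0 \<longrightarrow> v = 0"
  proof (intro ballI impI)
    fix v assume v: "v \<in> U" "F v = 0"
    then have "\<forall>k. (v $ k) *\<^sub>R \<nu> k = 0" using assms unfolding no_cancellation_def F_def by blast
    then have "v $ k = 0" for k using v(1) unfolding U_def by (cases "\<nu> k = 0") auto
    then show "v = 0" by (simp add: vec_eq_iff)
  qed
  from injective_imp_isometric[OF closed_subspace[OF U] U F this]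
  obtain e where e: "e > 0" "\<And>v. v \<in> U \<Longrightarrow> e * norm v \<le> norm (F v)" by auto
  \<comment> \<open>Each coefficient is at most |F v| / e in absolute value, which gives the second
    summand; the first secures 1 \<le> K.\<close>
  define K where "K = 1 + (\<Sum>k\<in>UNIV. norm (\<nu> k)) / e"
  have "(\<Sum>k\<in>UNIV. norm (a k *\<^sub>R \<nu> k)) \<le> K * norm (\<Sum>k\<in>UNIV. a k *\<^sub>R \<nu> k)" for a
  proof -
    define v :: "real ^ 'k" where "v = (\<chi> k. if \<nu> k = 0 then 0 else a k)"
    have vU: "v \<in> U" by (simp add: v_def U_def)
    have va: "(v $ k) *\<^sub>R \<nu> k = a k *\<^sub>R \<nu> k" for k by (simp add: v_def)
    have Fv: "F v = (\<Sum>k\<in>UNIV. a k *\<^sub>R \<nu> k)" by (simp add: F_def va)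
    have "(\<Sum>k\<in>UNIV. norm (a k *\<^sub>R \<nu> k)) \<le> (\<Sum>k\<in>UNIV. norm v * norm (\<nu> k))"
      unfolding va[symmetric] norm_scaleR real_norm_def[symmetric]
      by (intro sum_mono mult_right_mono component_le_norm_cart[unfolded real_norm_def[symmetric]]) auto
    also have "\<dots> = norm v * (\<Sum>k\<in>UNIV. norm (\<nu> k))" by (simp add: sum_distrib_left)
    also have "\<dots> \<le> (norm (F v) / e) * (\<Sum>k\<in>UNIV. norm (\<nu> k))"
      using e(1) e(2)[OF vU] by (intro mult_right_mono sum_nonneg) (auto simp: pos_le_divide_eq mult.commute)
    also have "\<dots> \<le> K * norm (F v)" by (simp add: K_def algebra_simps)
    finally show ?thesis unfolding Fv .
  qed
  moreover have "1 \<le> K" using e(1) by (simp add: K_def sum_nonneg)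
  ultimately show ?thesis using that by blast
qed

text \<open>The restriction h L2 < 1 by itself leaves no gap uniform in h. But the step sizes are
  T/N, so there is a coarsest admissible one, and it has the smallest gap.\<close>

lemma step_restriction_uniform:
  assumes "0 < T" "0 \<le> L2"
  obtains c where "0 < c"
    "\<And>N. N \<in> step_numbers T L2 \<phi>1 \<Longrightarrow> c \<le> 1 - T / real N * (if explicit_method T \<phi>1 then 0 else L2)"
proof (cases "explicit_method T \<phi>1 \<or> step_numbers T L2 \<phi>1 = {}")
  case True
  then show ?thesis using that[of 1] by auto
next
  case False
  define N0 where "N0 = (LEAST N. N \<in> step_numbers T L2 \<phi>1)"
  have N0: "N0 \<in> step_numbers T L2 \<phi>1" unfolding N0_def using False by (auto intro: LeastI)
  show ?thesis
  proof (rule that[of "1 - T / real N0 * L2"])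
    show "0 < 1 - T / real N0 * L2" using N0 False by (simp add: step_numbers_def)
    fix N assume N: "N \<in> step_numbers T L2 \<phi>1"
    then have "N0 \<le> N" unfolding N0_def by (rule Least_le)
    then have "T / real N \<le> T / real N0"
      using N0 assms by (intro divide_left_mono) (auto simp: step_numbers_def)
    then show "1 - T / real N0 * L2 \<le> 1 - T / real N * (if explicit_method T \<phi>1 then 0 else L2)"
      using False assms(2) mult_right_mono[of "T / real N" "T / real N0" L2] by simp
  qed
qed

lemma eventually_step_numbers:
  assumes "0 < T"
  shows "\<forall>\<^sub>F N in sequentially. N \<in> step_numbers T L2 \<phi>1"
proof -
  have "(\<lambda>N. T / real N * L2) \<longlonglongrightarrow> 0"
    using tendsto_mult_left_zero[OF lim_const_over_n[of T]] by simp
  then have "\<forall>\<^sub>F N in sequentially. T / real N * L2 < 1" by (rule order_tendstoD) simp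
  moreover have "\<forall>\<^sub>F N in sequentially. 1 \<le> N" by (rule eventually_ge_at_top)
  ultimately show ?thesis by eventually_elim (simp add: step_numbers_def)
qed

text \<open>The factor 1/h consumes one power of h^(1+q), and h^q remains.\<close>

lemma tendsto_0_if_bigo_step:
  fixes g :: "nat \<Rightarrow> ennreal" and a b :: "nat \<Rightarrow> nat \<Rightarrow> ennreal"
  assumes "0 < T" "0 < q" "0 < S"
    and a: "bigo_step T q (\<lambda>N. MAX n\<in>{..<N}. a N n)" and b: "bigo_step T q (\<lambda>N. MAX n\<in>{..<N}. b N n)"
    and g: "\<forall>\<^sub>F N in sequentially. g N \<le> ennreal (S * inverse (T / real N)) * (MAX n\<in>{..<N}. a N n + b N n)"
  shows "g \<longlonglongrightarrow> 0"
proof -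
  obtain C1 where C1: "\<forall>\<^sub>F N in sequentially. (MAX n\<in>{..<N}. a N n) \<le> ennreal (C1 * (T / real N) powr (1 + q))"
    using a by (auto simp: bigo_step_def)
  obtain C2 where C2: "\<forall>\<^sub>F N in sequentially. (MAX n\<in>{..<N}. b N n) \<le> ennreal (C2 * (T / real N) powr (1 + q))"
    using b by (auto simp: bigo_step_def)
  \<comment> \<open>The constants supplied by \<open>bigo_step\<close> may be negative, hence the
    absolute values.\<close>
  let ?u = "\<lambda>N. ennreal (S * (\<bar>C1\<bar> + \<bar>C2\<bar>) * (T / real N) powr q)"
  have bound: "\<forall>\<^sub>F N in sequentially. g N \<le> ?u N"
    using g C1 C2 eventually_ge_at_top[of 1]
  proof eventually_elim
    case (elim N)
    define h where "h = T / real N"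
    have h: "0 < h" using elim assms by (simp add: h_def)
    have ne: "{..<N} \<noteq> {}" using elim(4) by (simp add: lessThan_empty_iff)
    have "(MAX n\<in>{..<N}. a N n + b N n) \<le> (MAX n\<in>{..<N}. a N n) + (MAX n\<in>{..<N}. b N n)"
      using ne by (subst Max_le_iff) (auto intro!: add_mono)
    also have "\<dots> \<le> ennreal (\<bar>C1\<bar> * h powr (1 + q)) + ennreal (\<bar>C2\<bar> * h powr (1 + q))"
      using elim(2,3) unfolding h_def
      by (intro add_mono; elim order_trans) (auto intro!: ennreal_leI mult_right_mono)
    also have "\<dots> = ennreal ((\<bar>C1\<bar> + \<bar>C2\<bar>) * h powr (1 + q))"
      by (simp add: ennreal_plus[symmetric] distrib_right del: ennreal_plus)
    finally have "ennreal (S * inverse h) * (MAX n\<in>{..<N}. a N n + b N n) \<le>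
        ennreal (S * inverse h) * ennreal ((\<bar>C1\<bar> + \<bar>C2\<bar>) * h powr (1 + q))"
      by (rule mult_left_mono) simp
    also have "\<dots> = ennreal (S * (\<bar>C1\<bar> + \<bar>C2\<bar>) * (inverse h * h powr (1 + q)))"
      using h \<open>0 < S\<close> by (simp add: ennreal_mult[symmetric] mult_ac)
    also have "inverse h * h powr (1 + q) = h powr q"
      using h by (simp add: powr_add)
    finally show ?case using elim(1) unfolding h_def by (rule order_trans[rotated])
  qed
  have "(\<lambda>N. (T / real N) powr q) \<longlonglongrightarrow> 0"
    using assms(1,2)
    by (intro tendsto_zero_powrI[OF lim_const_over_n tendsto_const]) (auto intro!: always_eventually)
  then have "?u \<longlonglongrightarrow> ennreal (S * (\<bar>C1\<bar> + \<bar>C2\<bar>) * 0)"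
    by (intro tendsto_ennrealI tendsto_mult_left)
  then have u: "?u \<longlonglongrightarrow> 0" by simp
  show ?thesis by (rule tendsto_sandwich[OF _ bound tendsto_const u]) simp
qed

theorem theorem3p4:
  fixes M :: "'w measure"
    and T :: real
    and Y :: "'k::finite \<Rightarrow> real \<Rightarrow> 'w \<Rightarrow> nat"
    and \<nu> :: "'k \<Rightarrow> real ^ 'd"
    and f :: "real ^ 'd \<Rightarrow> real ^ 'd"
    and lam :: "'k \<Rightarrow> real ^ 'd \<Rightarrow> real"
    and \<phi>1 :: "real ^ 'd \<Rightarrow> real ^ 'd \<Rightarrow> real \<Rightarrow> real ^ 'd"
    and \<phi>3 :: "'k \<Rightarrow> real ^ 'd \<Rightarrow> real \<Rightarrow> real"
    and L1 L2 :: real and L3 :: "'k \<Rightarrow> real"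
  assumes "prob_space M" and "complete_measure M" and "0 < T"
    and "indep_poisson_processes M Y"
    and "\<exists>C. C-lipschitz_on UNIV f" and "bounded (range f)"
    and "\<And>k. \<exists>C. C-lipschitz_on UNIV (lam k)" and "\<And>k. bounded (range (lam k))"
    and "\<And>k x. 0 \<le> lam k x"
    and "0 \<le> L1" and "0 \<le> L2" and "\<And>k. 0 \<le> L3 k"
    and "\<And>N x1 x2 y1 y2. N \<in> step_numbers T L2 \<phi>1 \<Longrightarrow>
           norm (\<phi>1 x1 y1 (T / N) - \<phi>1 x2 y2 (T / N)) \<le> L1 * norm (x1 - x2) + L2 * norm (y1 - y2)"
    and "\<And>N k x1 x2. N \<in> step_numbers T L2 \<phi>1 \<Longrightarrow>
           \<bar>\<phi>3 k x1 (T / N) - \<phi>3 k x2 (T / N)\<bar> \<le> L3 k * norm (x1 - x2)"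
    and "\<And>N k x. N \<in> step_numbers T L2 \<phi>1 \<Longrightarrow> 0 \<le> \<phi>3 k x (T / N)"
  shows
    "(\<forall>X. rtc_solution M T Y \<nu> f lam X \<longrightarrow>
        (\<forall>N\<in>step_numbers T L2 \<phi>1. maruyama_unique_solution M Y \<nu> \<phi>1 \<phi>3 (T / N) N (X 0)) \<and>
        (no_cancellation \<nu> \<longrightarrow> strongly_consistent M T \<nu> f lam \<phi>1 \<phi>3 X \<longrightarrow>
           strongly_convergent M T Y \<nu> \<phi>1 \<phi>3 L2 X) \<and>
        (strongly_consistent_channelwise M T \<nu> f lam \<phi>1 \<phi>3 X \<longrightarrow>
           strongly_convergent M T Y \<nu> \<phi>1 \<phi>3 L2 X)) \<and>
     (\<exists>S>0. \<forall>X. rtc_solution M T Y \<nu> f lam X \<longrightarrow>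
        (\<forall>N\<in>step_numbers T L2 \<phi>1. \<forall>Xh \<tau>h.
           maruyama_solution M Y \<nu> \<phi>1 \<phi>3 (T / N) N (X 0) Xh \<tau>h \<longrightarrow>
           (no_cancellation \<nu> \<longrightarrow>
              strong_global_err M T X N Xh
                \<le> ennreal (S * inverse (T / N)) *
                   (MAX n\<in>{..<N}. Enorm M (drift_err T f \<phi>1 X N n) +
                                   Enorm M (jump_err T \<nu> lam \<phi>3 X N n))) \<and>
           strong_global_err M T X N Xh
             \<le> ennreal (S * inverse (T / N)) *
                (MAX n\<in>{..<N}. Enorm M (drift_err T f \<phi>1 X N n) +
                   (\<Sum>k\<in>UNIV. Enorm M (channel_err T \<nu> lam \<phi>3 X N n k)))))"
proof -
  let ?steps = "step_numbers T L2 \<phi>1"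
  obtain C where C: "C-lipschitz_on UNIV f" using assms(5) ..
  obtain B where B: "norm (f x) \<le> B" for x using assms(6) by (auto simp: bounded_iff)
  have "\<exists>b. \<forall>x. lam k x \<le> b" for k
    using assms(8)[of k] by (auto simp: bounded_iff abs_le_iff)
  then obtain b where b: "\<And>k x. lam k x \<le> b k" by metis
  define \<Lambda> where "\<Lambda> = (\<Sum>k\<in>UNIV. \<bar>b k\<bar>)"
  have \<Lambda>: "lam k x \<le> \<Lambda>" for k x
    using b[of k x] member_le_sum[of k UNIV "\<lambda>k. \<bar>b k\<bar>"] by (simp add: \<Lambda>_def)
  have lam_m: "lam k \<in> borel_measurable borel" for k
    using assms(7)[of k] by (auto intro: borel_measurable_continuous_onI lipschitz_on_continuous_on)
  define L2' where "L2' = (if explicit_method T \<phi>1 then 0 else L2)"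
  obtain c where c: "0 < c" "\<And>N. N \<in> ?steps \<Longrightarrow> c \<le> 1 - T / real N * L2'"
    unfolding L2'_def using step_restriction_uniform[OF \<open>0 < T\<close> \<open>0 \<le> L2\<close>, of \<phi>1] by metis
  \<comment> \<open>\<open>K\<close> is chosen in either case, so that a single \<open>S\<close>
    serves both error bounds.\<close>
  have "\<exists>K\<ge>1. no_cancellation \<nu> \<longrightarrow>
      (\<forall>a. (\<Sum>k\<in>UNIV. norm (a k *\<^sub>R \<nu> k)) \<le> K * norm (\<Sum>k\<in>UNIV. a k *\<^sub>R \<nu> k))"
  proof (cases "no_cancellation \<nu>")
    case True
    then show ?thesis by (rule no_cancellation_bound) blast
  qed auto
  then obtain K where K: "1 \<le> K"
    "no_cancellation \<nu> \<Longrightarrow> (\<Sum>k\<in>UNIV. norm (a k *\<^sub>R \<nu> k)) \<le> K * norm (\<Sum>k\<in>UNIV. a k *\<^sub>R \<nu> k)" for a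
    by blast
  define \<Gamma> where "\<Gamma> = L1 + L2' + (\<Sum>k\<in>UNIV. norm (\<nu> k) * L3 k)"
  \<comment> \<open>T, c, \<Gamma> and \<open>K\<close> are fixed before any solution X and any N
    are considered; this gives the independence of the initial condition.\<close>
  define S0 where "S0 = T / c * exp (\<Gamma> * T / c)"
  define S where "S = S0 * K"
  have S0: "0 < S0" using \<open>0 < T\<close> c(1) by (simp add: S0_def)
  have S: "0 < S" "S0 \<le> S" using S0 K(1) by (simp_all add: S_def)
  have N1: "1 \<le> N" if "N \<in> ?steps" for N using that by (simp add: step_numbers_def)

  have setting: "rtc_scheme M f lam \<nu> C B \<Lambda> Y X T (\<lambda>x y. \<phi>1 x y (T / real N)) (\<lambda>k x. \<phi>3 k x (T / real N)) (T / real N) L1 L2' L3"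
    if X: "rtc_solution M T Y \<nu> f lam X" and N: "N \<in> ?steps" for X N
  proof -
    have lip: "norm (\<phi>1 x1 y1 (T / real N) - \<phi>1 x2 y2 (T / real N)) \<le> L1 * norm (x1 - x2) + L2' * norm (y1 - y2)" for x1 x2 y1 y2
    proof (cases "explicit_method T \<phi>1")
      case True
      \<comment> \<open>The second arguments may be made equal without changing \<phi>1, and then
        the L2 term of the Lipschitz bound vanishes.\<close>
      then have "\<phi>1 x1 y1 (T / real N) = \<phi>1 x1 y2 (T / real N)"
        using N1[OF N] unfolding explicit_method_def by simp
      then show ?thesis using assms(13)[OF N, of x1 y2 x2 y2] True by (simp add: L2'_def)
    qed (use assms(13)[OF N] in \<open>simp add: L2'_def\<close>)
    interpret prob_space M by fact
    show ?thesis
    proof unfold_locales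
      show "0 < T / real N" using \<open>0 < T\<close> N1[OF N] by simp
      show "T / real N * L2' < 1" using c(1) c(2)[OF N] by linarith
      show "0 \<le> L2'" using assms(11) by (simp add: L2'_def)
    qed (fact C B lam_m \<Lambda> X lip assms | rule assms N)+
  qed

  have bounds: "maruyama_unique_solution M Y \<nu> \<phi>1 \<phi>3 (T / N) N (X 0)"
    "maruyama_solution M Y \<nu> \<phi>1 \<phi>3 (T / N) N (X 0) Xh \<tau>h \<Longrightarrow> strong_global_err M T X N Xh
             \<le> ennreal (S * inverse (T / N)) *
                (MAX n\<in>{..<N}. Enorm M (drift_err T f \<phi>1 X N n) +
                   (\<Sum>k\<in>UNIV. Enorm M (channel_err T \<nu> lam \<phi>3 X N n k)))"
    "no_cancellation \<nu> \<Longrightarrow> maruyama_solution M Y \<nu> \<phi>1 \<phi>3 (T / N) N (X 0) Xh \<tau>h \<Longrightarrow> strong_global_err M T X N Xh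
                \<le> ennreal (S * inverse (T / N)) *
                   (MAX n\<in>{..<N}. Enorm M (drift_err T f \<phi>1 X N n) +
                                   Enorm M (jump_err T \<nu> lam \<phi>3 X N n))"
    if X: "rtc_solution M T Y \<nu> f lam X" and N: "N \<in> ?steps" for X N Xh \<tau>h
  proof -
    interpret rtc_scheme M f lam \<nu> C B \<Lambda> Y X T "\<lambda>x y. \<phi>1 x y (T / real N)" "\<lambda>k x. \<phi>3 k x (T / real N)" "T / real N" L1 L2' L3
      by (rule setting[OF X N])
    have \<Gamma>: "growth = \<Gamma>" by (simp add: growth_def \<Gamma>_def)
    show "maruyama_unique_solution M Y \<nu> \<phi>1 \<phi>3 (T / N) N (X 0)"
      by (rule maruyama_unique) simp_all
    let ?chan = "\<lambda>n. Enorm M (drift_err T f \<phi>1 X N n) + (\<Sum>k\<in>UNIV. Enorm M (channel_err T \<nu> lam \<phi>3 X N n k))"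
      and ?jump = "\<lambda>n. Enorm M (drift_err T f \<phi>1 X N n) + Enorm M (jump_err T \<nu> lam \<phi>3 X N n)"
    have h: "0 < T / real N" by (rule h_pos)
    have le: "strong_global_err M T X N Xh \<le> ennreal (S0 * inverse (T / N)) * W"
      if sol: "maruyama_solution M Y \<nu> \<phi>1 \<phi>3 (T / N) N (X 0) Xh \<tau>h" and W: "\<And>m. m < N \<Longrightarrow> residual m \<le> W" for W
      unfolding S0_def \<Gamma>[symmetric]
      by (rule strong_global_err_le[OF refl N1[OF N] refl refl sol c(1) c(2)[OF N] W])
    show "strong_global_err M T X N Xh \<le> ennreal (S * inverse (T / N)) * (MAX n\<in>{..<N}. ?chan n)"
      if sol: "maruyama_solution M Y \<nu> \<phi>1 \<phi>3 (T / N) N (X 0) Xh \<tau>h"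
    proof -
      have "strong_global_err M T X N Xh \<le> ennreal (S0 * inverse (T / N)) * (MAX n\<in>{..<N}. ?chan n)"
      proof (rule le[OF sol])
        fix m assume "m < N"
        then show "residual m \<le> (MAX n\<in>{..<N}. ?chan n)"
          by (subst residual_eq[where ?\<Phi>1.0 = \<phi>1 and ?\<Phi>3.0 = \<phi>3, OF refl refl refl]) (auto intro!: Max_ge)
      qed
      also have "\<dots> \<le> ennreal (S * inverse (T / N)) * (MAX n\<in>{..<N}. ?chan n)"
        using S(2) \<open>0 < T\<close> by (intro mult_right_mono ennreal_leI) auto
      finally show ?thesis .
    qed
    show "strong_global_err M T X N Xh \<le> ennreal (S * inverse (T / N)) * (MAX n\<in>{..<N}. ?jump n)"
      if nc: "no_cancellation \<nu>" and sol: "maruyama_solution M Y \<nu> \<phi>1 \<phi>3 (T / N) N (X 0) Xh \<tau>h"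
    proof -
      have "strong_global_err M T X N Xh \<le> ennreal (S0 * inverse (T / N)) * (ennreal K * (MAX n\<in>{..<N}. ?jump n))"
      proof (rule le[OF sol])
        fix m assume m: "m < N"
        have "residual m \<le> ennreal K * ?jump m"
          by (rule residual_le_jump_err[where ?\<Phi>1.0 = \<phi>1 and ?\<Phi>3.0 = \<phi>3, OF refl refl refl m K(1) K(2)[OF nc]])
        also have "\<dots> \<le> ennreal K * (MAX n\<in>{..<N}. ?jump n)"
          using m by (intro mult_left_mono Max_ge) auto
        finally show "residual m \<le> ennreal K * (MAX n\<in>{..<N}. ?jump n)" .
      qed
      also have "\<dots> = ennreal (S * inverse (T / N)) * (MAX n\<in>{..<N}. ?jump n)"
      proof -
        have "ennreal (S * inverse (T / N)) = ennreal (S0 * inverse (T / N)) * ennreal K"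
          using S0 \<open>0 < T\<close> K(1) by (subst ennreal_mult[symmetric]) (auto simp: S_def mult_ac)
        then show ?thesis by (simp only: mult.assoc)
      qed
      finally show ?thesis .
    qed
  qed

  \<comment> \<open>\<open>E\<close> stands for the summed as well as for the channelwise quadrature
    error, so both convergence claims follow from one argument.\<close>
  have convergent: "strongly_convergent M T Y \<nu> \<phi>1 \<phi>3 L2 X"
    if b: "\<And>N Xh \<tau>h. N \<in> ?steps \<Longrightarrow> maruyama_solution M Y \<nu> \<phi>1 \<phi>3 (T / N) N (X 0) Xh \<tau>h \<Longrightarrow>
        strong_global_err M T X N Xh \<le> ennreal (S * inverse (T / N)) *
          (MAX n\<in>{..<N}. Enorm M (drift_err T f \<phi>1 X N n) + E N n)"
      and q: "0 < q" "bigo_step T q (\<lambda>N. MAX n\<in>{..<N}. Enorm M (drift_err T f \<phi>1 X N n))"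
        "bigo_step T q (\<lambda>N. MAX n\<in>{..<N}. E N n)" for X q and E :: "nat \<Rightarrow> nat \<Rightarrow> ennreal"
    unfolding strongly_convergent_def
  proof (intro allI impI)
    fix Xh \<tau>h
    assume sol: "\<forall>N\<in>?steps. maruyama_solution M Y \<nu> \<phi>1 \<phi>3 (T / N) N (X 0) (Xh N) (\<tau>h N)"
    show "(\<lambda>N. strong_global_err M T X N (Xh N)) \<longlonglongrightarrow> 0"
    proof (rule tendsto_0_if_bigo_step[OF \<open>0 < T\<close> q(1) S(1) q(2,3)])
      show "\<forall>\<^sub>F N in sequentially. strong_global_err M T X N (Xh N) \<le> ennreal (S * inverse (T / N)) *
          (MAX n\<in>{..<N}. Enorm M (drift_err T f \<phi>1 X N n) + E N n)"
        using eventually_step_numbers[OF \<open>0 < T\<close>]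
      proof (rule eventually_mono)
        fix N assume N: "N \<in> ?steps"
        show "strong_global_err M T X N (Xh N) \<le> ennreal (S * inverse (T / N)) *
          (MAX n\<in>{..<N}. Enorm M (drift_err T f \<phi>1 X N n) + E N n)"
          by (rule b[OF N sol[rule_format, OF N]])
      qed
    qed
  qed

  show ?thesis
  proof (intro conjI allI impI ballI exI[of _ S] S(1))
    fix X assume X: "rtc_solution M T Y \<nu> f lam X"
    show "strongly_convergent M T Y \<nu> \<phi>1 \<phi>3 L2 X"
      if nc: "no_cancellation \<nu>" and sc: "strongly_consistent M T \<nu> f lam \<phi>1 \<phi>3 X"
    proof -
      obtain q where q: "0 < q" "bigo_step T q (\<lambda>N. MAX n\<in>{..<N}. Enorm M (drift_err T f \<phi>1 X N n))"
        "bigo_step T q (\<lambda>N. MAX n\<in>{..<N}. Enorm M (jump_err T \<nu> lam \<phi>3 X N n))"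
        using sc unfolding strongly_consistent_def by (elim exE conjE)
      show ?thesis by (rule convergent[OF bounds(3)[OF X _ nc] q])
    qed
    show "strongly_convergent M T Y \<nu> \<phi>1 \<phi>3 L2 X"
      if sc: "strongly_consistent_channelwise M T \<nu> f lam \<phi>1 \<phi>3 X"
    proof -
      obtain q where q: "0 < q" "bigo_step T q (\<lambda>N. MAX n\<in>{..<N}. Enorm M (drift_err T f \<phi>1 X N n))"
        "bigo_step T q (\<lambda>N. MAX n\<in>{..<N}. \<Sum>k\<in>UNIV. Enorm M (channel_err T \<nu> lam \<phi>3 X N n k))"
        using sc unfolding strongly_consistent_channelwise_def by (elim exE conjE)
      show ?thesis by (rule convergent[OF bounds(2)[OF X] q])
    qed
  qed (rule bounds; assumption)+
qed

end
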